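(* Let $K$ be the $2$-uniform tiling of the plane whose vertex types are $[3^1,4^1,6^1,4^1]$ and $[4^1,6^1,12^1]$. If $X$ is a map on the torus that is a quotient $X=K/\Gamma$ of $K$, then the vertices of $X$ form at most $9$ orbits under ${\rm Aut}(X)$.
   Context: A map is a polyhedral map: a cellular embedding of a connected graph in a closed surface such that the intersection of any two distinct faces is empty, a single vertex, or a single edge. For a vertex $u$, the faces containing $u$ form a cyclic sequence (the face-cycle at $u$); if this cyclic sequence consists of consecutive blocks of $n_1$ $p_1$-gons, then $n_2$ $p_2$-gons, ..., then $n_k$ $p_k$-gons, with cyclically consecutive $p_i$ distinct, then $u$ is said to have type $[p_1^{n_1},\dots,p_k^{n_k}]$ (defined up to cyclic shift and reversal). A $2$-uniform tiling is an edge-to-edge tiling of the Euclidean plane $\mathbb{R}^2$ by regular polygons whose symmetry group has exactly two orbits on the set of vertices; viewed as a map on the plane, its vertices have (at most) two types, listed as $[W;Z]$. (Up to isomorphism there are exactly $20$ such tilings; there is exactly one with the vertex types named in the claim.) For a map $K$ on the plane, a quotient of $K$ on the torus is a map $X$ on the torus together with a polyhedral covering map $\eta:K\to X$ with $X=K/\Gamma$, where $\Gamma\le {\rm Aut}(K)$ is a subgroup acting without fixed vertices, edges or faces and $K/\Gamma$ is homeomorphic to the torus. ${\rm Aut}(X)$ denotes the automorphism group of the map $X$, acting on its vertex set $V(X)$. *)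

theory Defs
  imports "HOL-Analysis.Analysis"
begin

text \<open>The plane is the type complex. A tile is represented by its (finite) set of
corner points; the tile itself is the convex hull of that set.\<close>

definition regular_polygon :: "complex set \<Rightarrow> bool" where
  "regular_polygon P \<longleftrightarrow>
     (\<exists>c r \<theta> (n::nat). n \<ge> 3 \<and> r > 0 \<and>
        P = (\<lambda>k. c + complex_of_real r * cis (\<theta> + 2 * pi * real k / real n)) ` {..<n})"

definition poly_edge :: "complex set \<Rightarrow> complex \<Rightarrow> complex \<Rightarrow> bool" where
  "poly_edge P a b \<longleftrightarrow> a \<in> P \<and> b \<in> P \<and> a \<noteq> b \<and>
     closed_segment a b \<subseteq> frontier (convex hull P)"

definition edge_to_edge_tiling :: "complex set set \<Rightarrow> bool" where
  "edge_to_edge_tiling T \<longleftrightarrow>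
     (\<forall>P\<in>T. regular_polygon P) \<and>
     \<Union>((\<lambda>P. convex hull P) ` T) = UNIV \<and>
     (\<forall>P\<in>T. \<forall>Q\<in>T. P \<noteq> Q \<longrightarrow>
        interior (convex hull P) \<inter> interior (convex hull Q) = {}) \<and>
     (\<forall>P\<in>T. \<forall>Q\<in>T. P \<noteq> Q \<longrightarrow>
        (convex hull P \<inter> convex hull Q = {} \<or>
         (\<exists>v. v \<in> P \<and> v \<in> Q \<and> convex hull P \<inter> convex hull Q = {v}) \<or>
         (\<exists>a b. poly_edge P a b \<and> poly_edge Q a b \<and>
                convex hull P \<inter> convex hull Q = closed_segment a b)))"

definition tverts :: "complex set set \<Rightarrow> complex set" where
  "tverts T = \<Union>T"

definition tedges :: "complex set set \<Rightarrow> complex set set" where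
  "tedges T = {{a, b} | a b. \<exists>P\<in>T. poly_edge P a b}"

definition tiling_sym :: "complex set set \<Rightarrow> (complex \<Rightarrow> complex) set" where
  "tiling_sym T = {f. (\<forall>x y. dist (f x) (f y) = dist x y) \<and> (\<lambda>P. f ` P) ` T = T}"

definition two_uniform_tiling :: "complex set set \<Rightarrow> bool" where
  "two_uniform_tiling T \<longleftrightarrow> edge_to_edge_tiling T \<and>
     card ((\<lambda>v. {f v | f. f \<in> tiling_sym T}) ` tverts T) = 2"

definition cyc_equiv :: "'a list \<Rightarrow> 'a list \<Rightarrow> bool" where
  "cyc_equiv xs ys \<longleftrightarrow> (\<exists>k. ys = rotate k xs \<or> ys = rotate k (rev xs))"

definition has_vertex_type :: "complex set set \<Rightarrow> complex \<Rightarrow> nat list \<Rightarrow> bool" where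
  "has_vertex_type T u s \<longleftrightarrow>
     (\<exists>L. distinct L \<and> length L \<ge> 3 \<and> set L = {P \<in> T. u \<in> P} \<and>
        (\<forall>i < length L. \<exists>w. poly_edge (L ! i) u w \<and>
                              poly_edge (L ! ((i + 1) mod length L)) u w) \<and>
        cyc_equiv (map card L) s)"

definition vertex_types :: "complex set set \<Rightarrow> nat list set \<Rightarrow> bool" where
  "vertex_types T S \<longleftrightarrow>
     (\<forall>u \<in> tverts T. \<exists>s \<in> S. has_vertex_type T u s) \<and>
     (\<forall>s \<in> S. \<exists>u \<in> tverts T. has_vertex_type T u s)"

definition map_aut :: "'v set \<Rightarrow> 'v set set \<Rightarrow> 'v set set \<Rightarrow> ('v \<Rightarrow> 'v) \<Rightarrow> bool" where
  "map_aut V E F \<phi> \<longleftrightarrow> bij_betw \<phi> V V \<and> (\<forall>x. x \<notin> V \<longrightarrow> \<phi> x = x) \<and>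
     (\<forall>\<sigma>. \<sigma> \<subseteq> V \<longrightarrow> (\<sigma> \<in> E \<longleftrightarrow> \<phi> ` \<sigma> \<in> E)) \<and>
     (\<forall>\<sigma>. \<sigma> \<subseteq> V \<longrightarrow> (\<sigma> \<in> F \<longleftrightarrow> \<phi> ` \<sigma> \<in> F))"

definition aut_orbits :: "'v set \<Rightarrow> 'v set set \<Rightarrow> 'v set set \<Rightarrow> 'v set set" where
  "aut_orbits V E F = (\<lambda>x. {\<phi> x | \<phi>. map_aut V E F \<phi>}) ` V"

definition free_aut_subgroup :: "complex set set \<Rightarrow> (complex \<Rightarrow> complex) set \<Rightarrow> bool" where
  "free_aut_subgroup T \<Gamma> \<longleftrightarrow>
     (\<forall>g\<in>\<Gamma>. map_aut (tverts T) (tedges T) T g) \<and>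
     id \<in> \<Gamma> \<and> (\<forall>g\<in>\<Gamma>. \<forall>g'\<in>\<Gamma>. g \<circ> g' \<in> \<Gamma>) \<and> (\<forall>g\<in>\<Gamma>. inv g \<in> \<Gamma>) \<and>
     (\<forall>g\<in>\<Gamma>. g \<noteq> id \<longrightarrow>
        (\<forall>v \<in> tverts T. g v \<noteq> v) \<and> (\<forall>e \<in> tedges T. g ` e \<noteq> e) \<and> (\<forall>P\<in>T. g ` P \<noteq> P))"

definition torus_top :: "(complex \<times> complex) topology" where
  "torus_top = prod_topology (top_of_set (sphere 0 1)) (top_of_set (sphere 0 1))"

text \<open>K/Gamma is homeomorphic to the torus: the combinatorial action of Gamma is
realised cellularly by a group action of homeomorphisms of the plane whose orbit
space is homeomorphic to the torus.\<close>
definition quotient_is_torus :: "complex set set \<Rightarrow> (complex \<Rightarrow> complex) set \<Rightarrow> bool" where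
  "quotient_is_torus T \<Gamma> \<longleftrightarrow>
     (\<exists>h :: (complex \<Rightarrow> complex) \<Rightarrow> complex \<Rightarrow> complex.
        h id = id \<and>
        (\<forall>g\<in>\<Gamma>. homeomorphism UNIV UNIV (h g) (h (inv g))) \<and>
        (\<forall>g\<in>\<Gamma>. \<forall>g'\<in>\<Gamma>. h (g \<circ> g') = h g \<circ> h g') \<and>
        (\<forall>g\<in>\<Gamma>. \<forall>v \<in> tverts T. h g v = g v) \<and>
        (\<forall>g\<in>\<Gamma>. \<forall>P\<in>T. \<forall>a b. poly_edge P a b \<longrightarrow>
            h g ` closed_segment a b = closed_segment (g a) (g b)) \<and>
        (\<forall>g\<in>\<Gamma>. \<forall>P\<in>T. h g ` (convex hull P) = convex hull (g ` P)) \<and>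
        (\<exists>q. quotient_map euclidean torus_top q \<and>
             (\<forall>x y. q x = q y \<longleftrightarrow> (\<exists>g\<in>\<Gamma>. h g x = y))))"

definition qv :: "(complex \<Rightarrow> complex) set \<Rightarrow> complex \<Rightarrow> complex set" where
  "qv \<Gamma> v = {g v | g. g \<in> \<Gamma>}"

definition qverts :: "complex set set \<Rightarrow> (complex \<Rightarrow> complex) set \<Rightarrow> complex set set" where
  "qverts T \<Gamma> = qv \<Gamma> ` tverts T"

definition qedges :: "complex set set \<Rightarrow> (complex \<Rightarrow> complex) set \<Rightarrow> complex set set set" where
  "qedges T \<Gamma> = (\<lambda>e. qv \<Gamma> ` e) ` tedges T"

definition qfaces :: "complex set set \<Rightarrow> (complex \<Rightarrow> complex) set \<Rightarrow> complex set set set" where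
  "qfaces T \<Gamma> = (\<lambda>P. qv \<Gamma> ` P) ` T"

definition qedge_orb :: "(complex \<Rightarrow> complex) set \<Rightarrow> complex set \<Rightarrow> complex set set" where
  "qedge_orb \<Gamma> e = {g ` e | g. g \<in> \<Gamma>}"

definition qface_edges :: "(complex \<Rightarrow> complex) set \<Rightarrow> complex set \<Rightarrow> complex set set set" where
  "qface_edges \<Gamma> P = {qedge_orb \<Gamma> {a, b} | a b. poly_edge P a b}"

text \<open>X = K/Gamma is a polyhedral map: each face is a polygon without repeated
vertices, the graph is simple, and two distinct faces meet in nothing, a single
vertex, or a single edge.\<close>
definition polyhedral_quotient :: "complex set set \<Rightarrow> (complex \<Rightarrow> complex) set \<Rightarrow> bool" where
  "polyhedral_quotient T \<Gamma> \<longleftrightarrow>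
     (\<forall>P\<in>T. inj_on (qv \<Gamma>) P) \<and>
     (\<forall>e\<in>tedges T. \<forall>e'\<in>tedges T. qv \<Gamma> ` e = qv \<Gamma> ` e' \<longrightarrow> (\<exists>g\<in>\<Gamma>. g ` e = e')) \<and>
     (\<forall>P\<in>T. \<forall>Q\<in>T. (\<forall>g\<in>\<Gamma>. g ` P \<noteq> Q) \<longrightarrow>
        (let C = qv \<Gamma> ` P \<inter> qv \<Gamma> ` Q; D = qface_edges \<Gamma> P \<inter> qface_edges \<Gamma> Q in
          (C = {} \<and> D = {}) \<or> (\<exists>x. C = {x} \<and> D = {}) \<or>
          (\<exists>e\<in>tedges T. D = {qedge_orb \<Gamma> e} \<and> C = qv \<Gamma> ` e)))"

end

theory Submission
  imports Defs
begin

text \<open>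
The symmetry group of the tiling acts transitively on each of the two kinds of vertices. Hence the stabiliser of a
dodecagon contains the rotation by 60 degrees about its centre, and for two dodecagons with centres
\<open>c\<close> and \<open>d\<close> a product of such rotations is the translation by \<open>d - c\<close>. So every vertex of type 4.6.12
is, up to translations and half turns in the symmetry group, one of six vertices of a fixed
dodecagon. Each vertex of type 3.4.6.4 turns out to lie on a mirror, so these vertices are all images of one of
them under orientation-preserving symmetries, whose linear parts are powers of a rotation by 60 degrees; up
to sign there are three of them. This gives nine representatives.

A combinatorial automorphism of the tiling is an isometry, because it is one on each tile and cannot change across an edge.
The group of the torus acts freely, hence by translations and glide reflections. It is
commutative, being a group of deck transformations of the plane over a torus, and cocompact, which excludes
glide reflections. Translations and half turns of the tiling normalise a group of translations and
descend to the quotient.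
\<close>

text \<open>The tiling is given only by its vertex types and its number of vertex orbits, without
  coordinates. Structure is therefore read off locally, from cyclic enumerations of tiles, and
  spread by adjacency across edges or by symmetries.

  The lattice of \<Gamma> is arbitrary, so a rotation by 60 degrees need not preserve it; only
  symmetries with linear part 1 or -1 are certain to descend. That is why two orbits in the plane
  may become nine. The mirror through a vertex of type 3.4.6.4 matters for the count: with
  reflections the linear parts make up a group of order 12, six classes up to sign, and replacing
  each symmetry by an orientation-preserving one with the same effect on that vertex halves them.

  Members of \<Gamma> move vertices and are the identity elsewhere. They have two extensions to the
  plane: the homeomorphism \<open>h g\<close>, which carries the topology of the quotient, and the
  isometry determined by the vertices. These need agree only on vertices, but both respect cells.
  Commutativity is proved for the first and transferred through the vertices to the second, where it
  excludes glide reflections.\<close>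

subsection \<open>Regular polygons\<close>

text \<open>Indexing by all integers makes rotations and reversals of the corners plain index maps
  \<open>j + s * k\<close>; the complex number \<open>w\<close> holds radius and initial angle
  together.\<close>

definition ngon :: "nat \<Rightarrow> complex \<Rightarrow> complex \<Rightarrow> int \<Rightarrow> complex" where
  "ngon n c w k = c + w * cis (2 * pi * real_of_int k / real n)"

text \<open>Depends on the corner set alone, so no centre has to be chosen; for a regular polygon it
  is the centre (\<open>centroid_ngon\<close>), and isometries carry it along.\<close>

definition centroid :: "complex set \<Rightarrow> complex" where
  "centroid P = (\<Sum>x\<in>P. x) / of_nat (card P)"

lemma cis_eq_iff_int: "cis x = cis y \<longleftrightarrow> (\<exists>m::int. x = y + 2 * pi * m)"
proof -
  have "cis x = cis y \<longleftrightarrow> sin x = sin y \<and> cos x = cos y"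
    by (auto simp: complex_eq_iff)
  thus ?thesis by (simp add: sin_cos_eq_iff)
qed

lemma ngon_eq_iff:
  assumes "n > 0" "w \<noteq> 0"
  shows "ngon n c w i = ngon n c w j \<longleftrightarrow> int n dvd i - j"
proof -
  have "ngon n c w i = ngon n c w j \<longleftrightarrow>
        (\<exists>m::int. 2 * pi * i / n = 2 * pi * j / n + 2 * pi * m)"
    using assms by (simp add: ngon_def cis_eq_iff_int)
  also have "\<dots> \<longleftrightarrow> (\<exists>m::int. real_of_int i = real_of_int (j + m * int n))"
  proof (intro ex_cong1)
    fix m :: int
    have "2 * pi * i / n = 2 * pi * j / n + 2 * pi * m \<longleftrightarrow> 2 * pi * i = 2 * pi * (j + m * n)"
      using assms by (simp add: field_simps)
    also have "\<dots> \<longleftrightarrow> real_of_int i = real_of_int j + m * n" by simp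
    finally show "2 * pi * i / n = 2 * pi * j / n + 2 * pi * m
        \<longleftrightarrow> real_of_int i = real_of_int (j + m * int n)" by simp
  qed
  also have "\<dots> \<longleftrightarrow> (\<exists>m::int. i = j + m * int n)" by (simp only: of_int_eq_iff)
  also have "\<dots> \<longleftrightarrow> int n dvd i - j" by (auto simp: dvd_def algebra_simps)
  finally show ?thesis .
qed

lemma ngon_period:
  assumes "n > 0"
  shows "ngon n c w (k mod int n) = ngon n c w k"
proof (cases "w = 0")
  case False
  have "k mod int n - k = int n * (- (k div int n))"
    using minus_mult_div_eq_mod[of k "int n"] by linarith
  then have "int n dvd k mod int n - k" by (metis dvd_triv_left)
  then show ?thesis using ngon_eq_iff[OF assms False] by blast
qed (simp add: ngon_def)

lemma range_ngon:
  assumes "n > 0"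
  shows "range (ngon n c w) = (\<lambda>k. ngon n c w (int k)) ` {..<n}"
proof
  show "range (ngon n c w) \<subseteq> (\<lambda>k. ngon n c w (int k)) ` {..<n}"
  proof
    fix x assume "x \<in> range (ngon n c w)"
    then obtain k where k: "x = ngon n c w k" by auto
    have "x = ngon n c w (int (nat (k mod int n)))" using k ngon_period[OF assms] assms by simp
    moreover have "nat (k mod int n) < n" using assms by (simp add: nat_less_iff)
    ultimately show "x \<in> (\<lambda>k. ngon n c w (int k)) ` {..<n}" by blast
  qed
qed auto

lemma regular_polygonD:
  assumes "regular_polygon P"
  obtains n c w where "n \<ge> 3" "w \<noteq> 0" "P = range (ngon n c w)"
proof -
  obtain c r t n where 1: "n \<ge> (3::nat)" "r > 0"
    "P = (\<lambda>k. c + complex_of_real r * cis (t + 2 * pi * real k / real n)) ` {..<n}"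
    using assms unfolding regular_polygon_def by blast
  have "P = (\<lambda>k. ngon n c (of_real r * cis t) (int k)) ` {..<n}"
    unfolding 1(3) by (intro image_cong) (auto simp: ngon_def cis_mult[symmetric])
  also have "\<dots> = range (ngon n c (of_real r * cis t))" using range_ngon 1(1) by simp
  finally have P: "P = range (ngon n c (of_real r * cis t))" .
  have "of_real r * cis t \<noteq> 0" using 1(2) by simp
  then show ?thesis using that[OF 1(1) _ P] by blast
qed

lemma card_ngon:
  assumes "n > 0" "w \<noteq> 0"
  shows "card (range (ngon n c w)) = n"
proof -
  have "inj_on (\<lambda>k. ngon n c w (int k)) {..<n}"
  proof (rule inj_onI)
    fix i j assume ij: "i \<in> {..<n}" "j \<in> {..<n}" "ngon n c w (int i) = ngon n c w (int j)"
    then have "int n dvd int i - int j" using ngon_eq_iff[OF assms] by simp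
    then have "int i mod int n = int j mod int n" by (simp add: mod_eq_dvd_iff)
    then show "i = j" using ij by simp
  qed
  then show ?thesis using range_ngon[OF assms(1)] by (simp add: card_image)
qed

lemma finite_ngon: "n > 0 \<Longrightarrow> finite (range (ngon n c w))"
  by (simp add: range_ngon)

lemma sum_cis_roots:
  assumes "n > 1"
  shows "(\<Sum>k<n. cis (2 * pi * real k / real n)) = 0"
proof -
  have "n > 0" using assms by simp
  then have "(\<Sum>k<n. cis (2 * pi * real k / real n)) = \<Sum>{z::complex. z ^ n = 1}"
    using sum.reindex_bij_betw[OF Complex.bij_betw_roots_unity, where g = "\<lambda>z. z"] by blast
  thus ?thesis using sum_roots_unity[OF assms] by simp
qed

lemma centroid_ngon:
  assumes "n \<ge> 2" "w \<noteq> 0"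
  shows "centroid (range (ngon n c w)) = c"
proof -
  have inj: "inj_on (\<lambda>k. ngon n c w (int k)) {..<n}"
    using card_ngon[of n w c] assms range_ngon[of n c w] by (intro eq_card_imp_inj_on) auto
  have "(\<Sum>x\<in>range (ngon n c w). x) = (\<Sum>k<n. ngon n c w (int k))"
    using range_ngon[of n c w] assms sum.reindex[OF inj, of "\<lambda>x. x"] by simp
  also have "\<dots> = of_nat n * c + w * (\<Sum>k<n. cis (2 * pi * real k / real n))"
    by (simp add: ngon_def sum.distrib sum_distrib_left)
  also have "\<dots> = of_nat n * c" using sum_cis_roots assms by simp
  finally show ?thesis using card_ngon assms by (simp add: centroid_def)
qed

section \<open>Edges as minimum sets of linear functionals\<close>

lemma convex_supporting_hyperplane:
  fixes S :: "'a::euclidean_space set"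
  assumes "convex S" "x \<in> S" "x \<notin> interior S"
  obtains a where "a \<noteq> 0" "\<And>y. y \<in> S \<Longrightarrow> a \<bullet> x \<le> a \<bullet> y"
proof (cases "interior S = {}")
  case True
  obtain a b where "a \<noteq> 0" "S \<subseteq> {x. a \<bullet> x = b}"
    using empty_interior_subset_hyperplane[OF assms(1) True] by blast
  moreover from this have "a \<bullet> y = b" if "y \<in> S" for y using that by auto
  ultimately show ?thesis using that[of a] assms(2) by auto
next
  case False
  hence "x \<notin> rel_interior S" using assms by (simp add: rel_interior_nonempty_interior)
  then obtain a where "a \<noteq> 0" "\<And>y. y \<in> S \<Longrightarrow> a \<bullet> x \<le> a \<bullet> y"
    using supporting_hyperplane_rel_boundary[OF assms(1,2)] by metis
  thus ?thesis using that by blast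
qed

text \<open>A supporting functional at the midpoint takes there the mean of its values at
  \<open>a\<close> and \<open>b\<close>, so it is minimal at both ends. This trades the topological
  definition of an edge for a finite linear condition on the corners.\<close>

lemma poly_edge_iff:
  assumes "finite P"
  shows "poly_edge P a b \<longleftrightarrow> a \<in> P \<and> b \<in> P \<and> a \<noteq> b \<and>
     (\<exists>e. e \<noteq> 0 \<and> e \<bullet> a = e \<bullet> b \<and> (\<forall>x\<in>P. e \<bullet> a \<le> e \<bullet> x))"
proof -
  have fr: "frontier (convex hull P) = convex hull P - interior (convex hull P)"
    using assms by (simp add: frontier_def closure_closed compact_imp_closed compact_convex_hull
        finite_imp_compact)
  show ?thesis
  proof
    assume p: "poly_edge P a b"
    then have ab: "a \<in> P" "b \<in> P" "a \<noteq> b" "closed_segment a b \<subseteq> frontier (convex hull P)"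
      by (auto simp: poly_edge_def)
    let ?m = "midpoint a b"
    have "?m \<in> frontier (convex hull P)" using ab(4) by auto
    then have "?m \<in> convex hull P" "?m \<notin> interior (convex hull P)" using fr by auto
    then obtain e where e: "e \<noteq> 0" "\<And>y. y \<in> convex hull P \<Longrightarrow> e \<bullet> ?m \<le> e \<bullet> y"
      using convex_supporting_hyperplane[OF convex_convex_hull] by metis
    have m: "e \<bullet> ?m = (e \<bullet> a + e \<bullet> b) / 2"
      by (simp add: midpoint_def inner_add_right)
    have "e \<bullet> ?m \<le> e \<bullet> a" "e \<bullet> ?m \<le> e \<bullet> b" using e(2) ab hull_inc by metis+
    then have "e \<bullet> a = e \<bullet> b" "e \<bullet> ?m = e \<bullet> a" using m by auto
    then show "a \<in> P \<and> b \<in> P \<and> a \<noteq> b \<and>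
      (\<exists>e. e \<noteq> 0 \<and> e \<bullet> a = e \<bullet> b \<and> (\<forall>x\<in>P. e \<bullet> a \<le> e \<bullet> x))"
      using ab e hull_inc by metis
  next
    assume "a \<in> P \<and> b \<in> P \<and> a \<noteq> b \<and>
      (\<exists>e. e \<noteq> 0 \<and> e \<bullet> a = e \<bullet> b \<and> (\<forall>x\<in>P. e \<bullet> a \<le> e \<bullet> x))"
    then obtain e where ab: "a \<in> P" "b \<in> P" "a \<noteq> b" and
      e: "e \<noteq> 0" "e \<bullet> a = e \<bullet> b" "\<And>x. x \<in> P \<Longrightarrow> e \<bullet> a \<le> e \<bullet> x" by blast
    have "P \<subseteq> {x. e \<bullet> a \<le> e \<bullet> x}" using e(3) by auto
    then have sub: "convex hull P \<subseteq> {x. e \<bullet> x \<ge> e \<bullet> a}"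
      using hull_minimal convex_halfspace_ge by metis
    have "interior (convex hull P) \<subseteq> {x. e \<bullet> x > e \<bullet> a}"
      using interior_mono[OF sub] e(1) by simp
    moreover have "x \<in> convex hull P \<and> e \<bullet> x = e \<bullet> a" if "x \<in> closed_segment a b" for x
    proof
      show "x \<in> convex hull P"
        using that ab closed_segment_subset_convex_hull hull_inc by (metis (no_types, opaque_lifting) subsetD)
      obtain u where "x = (1 - u) *\<^sub>R a + u *\<^sub>R b" using \<open>x \<in> closed_segment a b\<close> by (auto simp: in_segment)
      then show "e \<bullet> x = e \<bullet> a" using e(2)
        by (simp add: inner_add_right left_diff_distrib)
    qed
    ultimately have "closed_segment a b \<subseteq> convex hull P - interior (convex hull P)"
      by (smt (verit) DiffI mem_Collect_eq subset_iff)
    then have "closed_segment a b \<subseteq> frontier (convex hull P)" by (simp only: fr)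
    then show "poly_edge P a b" using ab by (simp add: poly_edge_def)
  qed
qed

lemma real_proportional:
  fixes p q r s :: real
  assumes "p * s = q * r" "r \<noteq> 0 \<or> s \<noteq> 0"
  shows "\<exists>t. p = t * r \<and> q = t * s"
proof (cases "r = 0")
  case True
  then show ?thesis using assms by (intro exI[of _ "q / s"]) auto
next
  case False
  then show ?thesis using assms by (intro exI[of _ "p / r"]) (auto simp: field_simps)
qed

text \<open>With \<open>d = a + t (b - a)\<close>, the equal distances from \<open>c\<close> give
  \<open>t (t - 1) = 0\<close>: a line meets a circle in at most two points.\<close>

lemma circle_line_two_points:
  fixes a b d c e :: complex
  assumes "e \<noteq> 0" "e \<bullet> a = e \<bullet> b" "e \<bullet> d = e \<bullet> a" "a \<noteq> b"
    and "dist c a = r" "dist c b = r" "dist c d = r"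
  shows "d = a \<or> d = b"
proof -
  have "\<exists>t::real. d - a = t *\<^sub>R (b - a)"
  proof -
    have 1: "Re e * Re (b - a) + Im e * Im (b - a) = 0" "Re e * Re (d - a) + Im e * Im (d - a) = 0"
      using assms(2,3) by (auto simp: inner_complex_def algebra_simps)
    have ba: "Re (b - a) \<noteq> 0 \<or> Im (b - a) \<noteq> 0" using assms(4) by (auto simp: complex_eq_iff)
    have e: "Re e \<noteq> 0 \<or> Im e \<noteq> 0" using assms(1) by (simp add: complex_eq_iff)
    have det: "Re (d - a) * Im (b - a) = Im (d - a) * Re (b - a)"
    proof -
      have "Re e * (Re (d - a) * Im (b - a) - Im (d - a) * Re (b - a)) = 0"
        using 1 by algebra
      moreover have "Im e * (Re (d - a) * Im (b - a) - Im (d - a) * Re (b - a)) = 0"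
        using 1 by algebra
      ultimately show ?thesis using e by auto
    qed
    obtain t where "Re (d - a) = t * Re (b - a)" "Im (d - a) = t * Im (b - a)"
      using real_proportional[OF det ba] by blast
    then show ?thesis by (intro exI[of _ t]) (simp add: complex_eq_iff)
  qed
  then obtain t :: real where t: "d - a = t *\<^sub>R (b - a)" by blast
  define u v where "u = a - c" and "v = b - a"
  have "norm (u + v) = norm u" "norm (u + t *\<^sub>R v) = norm u"
  proof -
    have "u + v = b - c" by (simp add: u_def v_def)
    moreover have "u + t *\<^sub>R v = d - c" unfolding v_def t[symmetric] by (simp add: u_def)
    ultimately show "norm (u + v) = norm u" "norm (u + t *\<^sub>R v) = norm u"
      using assms(5-7) by (metis dist_norm norm_minus_commute u_def)+
  qed
  then have "(u + v) \<bullet> (u + v) = u \<bullet> u" "(u + t *\<^sub>R v) \<bullet> (u + t *\<^sub>R v) = u \<bullet> u"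
    by (simp_all add: norm_eq)
  then have 2: "2 * (u \<bullet> v) = - (v \<bullet> v)" "2 * t * (u \<bullet> v) + t\<^sup>2 * (v \<bullet> v) = 0"
    by (auto simp: inner_add_left inner_add_right inner_commute algebra_simps power2_eq_square)
  have "t * (t - 1) * (v \<bullet> v) = 2 * t * (u \<bullet> v) + t\<^sup>2 * (v \<bullet> v)"
    using 2(1) by algebra
  then have "t * (t - 1) * (v \<bullet> v) = 0" using 2(2) by simp
  moreover have "v \<bullet> v \<noteq> 0" using assms(4) by (simp add: v_def)
  ultimately have "t = 0 \<or> t = 1" by simp
  then show ?thesis using t by auto
qed

lemma dist_ngon: "dist c (ngon n c w k) = norm w"
  by (simp add: ngon_def dist_norm norm_mult)

lemma cos_add_2pi_int: "cos (x + 2 * pi * real_of_int m) = cos x"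
  by (metis sin_cos_eq_iff)

text \<open>Sum-to-product turns the two inequalities into signs of the sine at
  \<open>x + d / 2\<close> and \<open>x - d / 2\<close>. This locates the corner of a polygon at
  which a linear functional is extremal.\<close>

lemma cos_max_step:
  assumes d: "0 < d" "d \<le> pi" and x: "- pi < x" "x \<le> pi"
    and "cos (x + d) \<le> cos x" "cos (x - d) \<le> cos x"
  shows "\<bar>x\<bar> \<le> d / 2"
proof -
  have s: "sin (d / 2) > 0" using d by (intro sin_gt_zero) auto
  have "cos x - cos (x + d) = 2 * sin (x + d / 2) * sin (d / 2)"
  proof -
    have "(x + (x + d)) / 2 = x + d / 2" "(x + d - x) / 2 = d / 2" by simp_all
    then show ?thesis using cos_diff_cos[of x "x + d"] by (simp only:)
  qed
  with assms have "0 \<le> 2 * sin (x + d / 2) * sin (d / 2)" by linarith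
  then have 1: "sin (x + d / 2) \<ge> 0" using s by (simp add: zero_le_mult_iff)
  have "cos (x - d) - cos x = 2 * sin (x - d / 2) * sin (d / 2)"
  proof -
    have "(x - d + x) / 2 = x - d / 2" "(x - (x - d)) / 2 = d / 2" by simp_all
    then show ?thesis using cos_diff_cos[of "x - d" x] by (simp only:)
  qed
  with assms have "2 * sin (x - d / 2) * sin (d / 2) \<le> 0" by linarith
  then have 2: "sin (x - d / 2) \<le> 0" using s by (simp add: mult_le_0_iff)
  have "x + d / 2 \<ge> 0"
  proof (rule ccontr)
    assume "\<not> x + d / 2 \<ge> 0"
    then have "sin (- (x + d / 2)) > 0" using x d by (intro sin_gt_zero) auto
    then show False using 1 by (simp only: sin_minus)
  qed
  moreover have "x - d / 2 \<le> 0"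
  proof (rule ccontr)
    assume "\<not> x - d / 2 \<le> 0"
    then have "sin (x - d / 2) > 0" using x d by (intro sin_gt_zero) auto
    then show False using 2 by simp
  qed
  ultimately show ?thesis by simp
qed

text \<open>These are the directions of the corners as seen from the normal of an edge; the two
  nearest, at angle \<open>pi / n\<close>, are the ends of that edge.\<close>

lemma cos_half_step_le:
  assumes "n > (0::nat)"
  shows "cos ((2 * real_of_int k + 1) * pi / n) \<le> cos (pi / n)"
proof -
  define m where "m = k mod int n"
  have m: "0 \<le> m" "m \<le> int n - 1" 
    using assms pos_mod_bound[of "int n" k] by (auto simp: m_def)
  have k: "k = m + int n * (k div int n)" by (simp add: m_def)
  have "(2 * real_of_int k + 1) * pi / n = (2 * real_of_int m + 1) * pi / n + 2 * pi * (k div int n)"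
    using assms by (subst k) (simp add: field_simps)
  then have 1: "cos ((2 * real_of_int k + 1) * pi / n) = cos ((2 * real_of_int m + 1) * pi / n)"
    by (metis sin_cos_eq_iff)
  let ?y = "(2 * real_of_int m + 1) * pi / n"
  have y1: "pi / n \<le> ?y" using m assms by (simp add: field_simps)
  have y2: "?y \<le> 2 * pi - pi / n"
  proof -
    have "2 * real_of_int m + 1 \<le> 2 * real n - 1" using m by linarith
    then have "(2 * real_of_int m + 1) * pi \<le> (2 * real n - 1) * pi" by simp
    then have "?y \<le> (2 * real n - 1) * pi / n" using divide_right_mono of_nat_0_le_iff by blast
    also have "\<dots> = 2 * pi - pi / n" using assms by (simp add: field_simps)
    finally show ?thesis .
  qed
  have p: "0 \<le> pi / n" by simp
  have "cos ?y \<le> cos (pi / n)"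
  proof (cases "?y \<le> pi")
    case True
    then show ?thesis using y1 p by (intro cos_monotone_0_pi_le) auto
  next
    case False
    have "cos ?y = cos (2 * pi - ?y)" by simp
    also have "\<dots> \<le> cos (pi / n)" using False y2 p by (intro cos_monotone_0_pi_le) auto
    finally show ?thesis .
  qed
  then show ?thesis using 1 by simp
qed

lemma inner_cis: "cis x \<bullet> cis y = cos (x - y)"
  by (simp add: inner_complex_def cos_diff)

lemma inner_ngon:
  "(w * cis x) \<bullet> ngon n c w k = (w * cis x) \<bullet> c + (norm w)\<^sup>2 * cos (2 * pi * k / n - x)"
proof -
  have "(w * cis x) \<bullet> (w * cis y) = (norm w)\<^sup>2 * (cis x \<bullet> cis y)" for y
    unfolding inner_complex_def cmod_power2 by (simp add: algebra_simps power2_eq_square)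
  then show ?thesis
    by (simp add: ngon_def inner_add_right inner_cis) (metis cos_minus minus_diff_eq)
qed

lemma reduce_angle: "\<exists>(y::real) m::int. x = y + 2 * pi * m \<and> - pi < y \<and> y \<le> pi"
proof -
  define m where "m = \<lceil>(x - pi) / (2 * pi)\<rceil>"
  have "(x - pi) / (2 * pi) \<le> m" "m < (x - pi) / (2 * pi) + 1"
    unfolding m_def by linarith+
  then have "x - pi \<le> 2 * pi * m" "2 * pi * m < x - pi + 2 * pi"
    by (simp_all add: field_simps)
  then show ?thesis by (intro exI[of _ "x - 2 * pi * m"] exI[of _ m]) auto
qed

text \<open>If \<open>e\<close> is minimal at two corners, both lie within half a step of the
  direction of \<open>- e\<close>, so their indices differ by at most one modulo \<open>n\<close>.
  Conversely the inward normal of the edge is such a functional.\<close>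

lemma poly_edge_ngon:
  assumes "n \<ge> 3" "w \<noteq> 0"
  shows "poly_edge (range (ngon n c w)) (ngon n c w i) (ngon n c w j) \<longleftrightarrow>
     int n dvd i - j - 1 \<or> int n dvd j - i - 1"
proof -
  have n0: "n > 0" using assms by simp
  have fin: "finite (range (ngon n c w))" using finite_ngon n0 by simp
  have suff: "poly_edge (range (ngon n c w)) (ngon n c w i) (ngon n c w (i + 1))" for i
  proof -
    \<comment> \<open>The angle of the edge midpoint as seen from \<open>c\<close>, relative to
      \<open>w\<close>.\<close>
    let ?x = "2 * pi * (i + 1 / 2) / n"
    let ?e = "- (w * cis ?x)"
    have v: "?e \<bullet> ngon n c w k = ?e \<bullet> c - (norm w)\<^sup>2 * cos (2 * pi * k / n - ?x)" for k
      using inner_ngon[of w ?x n c k] by simp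
    have vi: "2 * pi * i / n - ?x = - (pi / n)" "2 * pi * (i + 1) / n - ?x = pi / n"
      using n0 by (simp_all add: field_simps)
    have le: "cos (2 * pi * k / n - ?x) \<le> cos (pi / n)" for k :: int
    proof -
      have "2 * pi * k / n - ?x = (2 * real_of_int (k - i - 1) + 1) * pi / n"
        using n0 by (simp add: field_simps)
      then show ?thesis using cos_half_step_le[OF n0, of "k - i - 1"] by simp
    qed
    have e1: "?e \<bullet> ngon n c w i = ?e \<bullet> c - (norm w)\<^sup>2 * cos (pi / n)" using v[of i] vi by simp
    have e2: "?e \<bullet> ngon n c w (i + 1) = ?e \<bullet> c - (norm w)\<^sup>2 * cos (pi / n)"
      using v[of "i+1"] vi by (metis of_int_1 of_int_add)
    have e3: "?e \<bullet> ngon n c w i \<le> ?e \<bullet> ngon n c w k" for k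
      unfolding e1 unfolding v using le[of k] by (simp add: mult_left_mono)
    have ne: "ngon n c w i \<noteq> ngon n c w (i + 1)"
    proof
      assume "ngon n c w i = ngon n c w (i + 1)"
      then have "int n dvd - 1" using ngon_eq_iff[OF n0 assms(2)] by simp
      then show False using assms(1) by simp
    qed
    have "?e \<noteq> 0" using assms by simp
    then show ?thesis unfolding poly_edge_iff[OF fin] using e1 e2 e3 ne by (intro conjI exI[of _ ?e]) auto
  qed
  show ?thesis
  proof
    assume p: "poly_edge (range (ngon n c w)) (ngon n c w i) (ngon n c w j)"
    then obtain e where e: "e \<noteq> 0" "e \<bullet> ngon n c w i = e \<bullet> ngon n c w j"
       "\<And>k. e \<bullet> ngon n c w i \<le> e \<bullet> ngon n c w k" and ne: "ngon n c w i \<noteq> ngon n c w j"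
      unfolding poly_edge_iff[OF fin] by auto
    \<comment> \<open>Polar form of \<open>- e\<close> relative to \<open>w\<close>: minimising
      \<open>e\<close> becomes maximising the cosine of the angle to \<open>x\<close>.\<close>
    define r where "r = norm (e / w)"
    define x where "x = Arg (- e / w)"
    have r: "r > 0" using e assms by (simp add: r_def)
    have "- e / w = r * cis x" using rcis_cmod_Arg[of "- e / w"] e assms
      by (simp add: r_def x_def rcis_def)
    then have "- e / w * w = of_real r * cis x * w" by simp
    then have "- e = of_real r * cis x * w" using assms(2) by simp
    then have "e = - of_real r * (w * cis x)" by (metis minus_minus mult.commute mult.left_commute mult_minus_left)
    then have e': "e = (- r) *\<^sub>R (w * cis x)" by (simp add: scaleR_conv_of_real)
    have v: "e \<bullet> ngon n c w k = e \<bullet> c - r * (norm w)\<^sup>2 * cos (2 * pi * k / n - x)" for k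
      unfolding e' inner_scaleR_left inner_ngon by (simp add: algebra_simps)
    have rw: "r * (norm w)\<^sup>2 > 0" using r assms by simp
    let ?a = "\<lambda>k::int. 2 * pi * k / n - x"
    let ?d = "2 * pi / n"
    have d: "0 < ?d" "?d < pi" using assms(1) by (auto simp: field_simps)
    have mx: "cos (?a k) \<le> cos (?a i)" for k
    proof -
      have "r * (norm w)\<^sup>2 * cos (?a k) \<le> r * (norm w)\<^sup>2 * cos (?a i)"
        using e(3)[of k] unfolding v by simp
      then show ?thesis using rw by (simp only: mult_le_cancel_left_pos)
    qed
    have "r * (norm w)\<^sup>2 * cos (?a i) = r * (norm w)\<^sup>2 * cos (?a j)"
      using e(2) unfolding v by simp
    then have ij: "cos (?a i) = cos (?a j)" using rw by (metis less_irrefl mult_cancel_left)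
    have step: "\<exists>y m. ?a l = y + 2 * pi * real_of_int m \<and> \<bar>y\<bar> \<le> ?d / 2" if "cos (?a l) = cos (?a i)" for l
    proof -
      obtain y m where ym: "?a l = y + 2 * pi * real_of_int m" "- pi < y" "y \<le> pi"
        using reduce_angle by blast
      have cy: "cos (y + z) = cos (?a l + z)" for z
        unfolding ym(1) using cos_add_2pi_int[of "y + z" m] by (simp add: algebra_simps)
      have "?a l + ?d = ?a (l + 1)" "?a l + - ?d = ?a (l - 1)"
        using n0 by (simp_all add: field_simps)
      then have "cos (y + ?d) = cos (?a (l + 1))" "cos (y + - ?d) = cos (?a (l - 1))"
        using cy[of ?d] cy[of "- ?d"] by (simp_all only:)
      moreover have "cos y = cos (?a i)" using cy[of 0] that by simp
      ultimately have "cos (y + ?d) \<le> cos y" "cos (y + - ?d) \<le> cos y"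
        using mx[of "l+1"] mx[of "l-1"] by (simp_all only:)
      then have "\<bar>y\<bar> \<le> ?d / 2" using cos_max_step[of ?d y] d ym(2,3) by simp
      then show ?thesis using ym by blast
    qed
    obtain y1 m1 where 1: "?a i = y1 + 2 * pi * real_of_int m1" "\<bar>y1\<bar> \<le> ?d / 2" using step by blast
    obtain y2 m2 where 2: "?a j = y2 + 2 * pi * real_of_int m2" "\<bar>y2\<bar> \<le> ?d / 2" using step ij by metis
    have "?d * real_of_int (i - j) = (y1 - y2) + 2 * pi * real_of_int (m1 - m2)"
      using 1(1) 2(1) by (simp add: algebra_simps diff_divide_distrib)
    moreover have "?d * real_of_int ((m1 - m2) * int n) = 2 * pi * real_of_int (m1 - m2)"
      using n0 by simp
    moreover have "?d * real_of_int (i - j - (m1 - m2) * int n)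
        = ?d * real_of_int (i - j) - ?d * real_of_int ((m1 - m2) * int n)"
      by (metis of_int_diff right_diff_distrib)
    ultimately have eq: "?d * real_of_int (i - j - (m1 - m2) * int n) = y1 - y2" by linarith
    have "\<bar>y1 - y2\<bar> \<le> ?d / 2 + ?d / 2"
      using abs_triangle_ineq4[of y1 y2] add_mono[OF 1(2) 2(2)] by (rule order_trans)
    then have "\<bar>y1 - y2\<bar> \<le> ?d" by (simp only: field_sum_of_halves)
    then have "?d * \<bar>real_of_int (i - j - (m1 - m2) * int n)\<bar> \<le> ?d * 1"
      using eq d(1) by (metis abs_mult abs_of_pos mult.right_neutral)
    then have "\<bar>real_of_int (i - j - (m1 - m2) * int n)\<bar> \<le> 1"
      using d(1) by (simp only: mult_le_cancel_left_pos)
    then have "\<bar>i - j - (m1 - m2) * int n\<bar> \<le> 1" by linarith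
    moreover have "i - j - (m1 - m2) * int n \<noteq> 0"
    proof
      assume "i - j - (m1 - m2) * int n = 0"
      then have "int n dvd i - j" by (metis dvd_triv_right eq_iff_diff_eq_0)
      then show False using ne ngon_eq_iff[OF n0 assms(2)] by simp
    qed
    ultimately have "i - j - 1 = (m1 - m2) * int n \<or> j - i - 1 = (m2 - m1) * int n"
      by (simp add: algebra_simps) linarith
    then show "int n dvd i - j - 1 \<or> int n dvd j - i - 1" by auto
  next
    assume "int n dvd i - j - 1 \<or> int n dvd j - i - 1"
    then show "poly_edge (range (ngon n c w)) (ngon n c w i) (ngon n c w j)"
    proof
      assume "int n dvd i - j - 1"
      then have "ngon n c w (j + 1) = ngon n c w i"
        using ngon_eq_iff[OF n0 assms(2), where i = i and j = "j + 1"] by (simp add: algebra_simps)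
      then show ?thesis using suff[of j] by (metis poly_edge_def closed_segment_commute)
    next
      assume "int n dvd j - i - 1"
      then have "ngon n c w (i + 1) = ngon n c w j"
        using ngon_eq_iff[OF n0 assms(2), where i = j and j = "i + 1"] by (simp add: algebra_simps)
      then show ?thesis using suff[of i] by metis
    qed
  qed
qed

lemma regular_polygon_finite: "regular_polygon P \<Longrightarrow> finite P"
  by (auto simp: regular_polygon_def)

section \<open>Centre and sides of a regular polygon\<close>

lemma convex_interior_pointI:
  fixes S :: "'a::euclidean_space set"
  assumes "convex S" "x \<in> S" "\<And>a. a \<noteq> 0 \<Longrightarrow> \<exists>y\<in>S. a \<bullet> y < a \<bullet> x"
  shows "x \<in> interior S"
  using convex_supporting_hyperplane[OF assms(1,2)] assms(3) by (metis not_le)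

text \<open>A functional minimal at the centre over the hull would have nonnegative deviations at
  the corners with sum zero, hence would be constant on them; but three corners on a circle are not
  collinear.\<close>

lemma regular_polygon_centroid_interior:
  assumes "regular_polygon P"
  shows "centroid P \<in> interior (convex hull P)"
proof -
  obtain n c w where n: "n \<ge> 3" and w: "w \<noteq> 0" and P: "P = range (ngon n c w)"
    using regular_polygonD[OF assms] .
  have n0: "n > 0" using n by simp
  have c: "centroid P = c" using centroid_ngon n w P by simp
  have fin: "finite P" using P finite_ngon n0 by simp
  have cardP: "card P = n" using card_ngon[OF n0 w] P by simp
  have sum: "(\<Sum>x\<in>P. x) = of_nat n * c"
    using c cardP n0 by (auto simp: centroid_def field_simps)
  have mean: "(\<Sum>x\<in>P. (1 / real n) *\<^sub>R x) = c"
  proof -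
    have "(\<Sum>x\<in>P. (1 / real n) *\<^sub>R x) = (1 / real n) *\<^sub>R (\<Sum>x\<in>P. x)"
      by (simp only: scaleR_right.sum)
    then show ?thesis using sum n0 by (simp add: scaleR_conv_of_real)
  qed
  have "c \<in> convex hull P"
  proof -
    have "(\<Sum>x\<in>P. (1 / real n) *\<^sub>R x) \<in> convex hull P"
      using fin cardP n0 by (intro convex_sum) (auto simp: hull_inc)
    then show ?thesis using mean by simp
  qed
  moreover have "\<exists>y\<in>convex hull P. e \<bullet> y < e \<bullet> c" if "e \<noteq> 0" for e
  proof (rule ccontr)
    assume "\<not> (\<exists>y\<in>convex hull P. e \<bullet> y < e \<bullet> c)"
    then have ge: "e \<bullet> c \<le> e \<bullet> x" if "x \<in> P" for x using that hull_inc by (metis not_le)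
    have "(\<Sum>x\<in>P. e \<bullet> x - e \<bullet> c) = e \<bullet> (\<Sum>x\<in>P. x) - real n * (e \<bullet> c)"
      using cardP by (simp add: sum_subtractf inner_sum_right)
    also have "\<dots> = 0" unfolding sum
      by (metis diff_self inner_scaleR_right of_real_of_nat_eq scaleR_conv_of_real)
    finally have "\<forall>x\<in>P. e \<bullet> x - e \<bullet> c = 0"
      using sum_nonneg_eq_0_iff[OF fin, of "\<lambda>x. e \<bullet> x - e \<bullet> c"] ge by fastforce
    then have eq: "e \<bullet> ngon n c w k = e \<bullet> c" for k using P by auto
    have ne: "ngon n c w i \<noteq> ngon n c w j" if "i - j \<in> {1,2}" for i j
    proof
      assume "ngon n c w i = ngon n c w j"
      then have "int n dvd i - j" using ngon_eq_iff[OF n0 w] by simp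
      then show False using that n zdvd_imp_le[of "int n" "i - j"] by auto
    qed
    have "ngon n c w 2 = ngon n c w 0 \<or> ngon n c w 2 = ngon n c w 1"
      by (rule circle_line_two_points[OF that, where c = c and r = "norm w"])
        (use eq ne[of 1 0] in \<open>auto simp: dist_ngon\<close>)
    then show False using ne[of 2 0] ne[of 2 1] by auto
  qed
  ultimately show ?thesis unfolding c using convex_interior_pointI[OF convex_convex_hull] by blast
qed

lemma regular_polygon_circle:
  assumes "regular_polygon P"
  obtains r where "\<And>x. x \<in> P \<Longrightarrow> dist (centroid P) x = r"
proof -
  obtain n c w where n: "n \<ge> 3" and w: "w \<noteq> 0" and P: "P = range (ngon n c w)"
    using regular_polygonD[OF assms] .
  have "centroid P = c" using centroid_ngon n w P by simp
  then have "\<And>x. x \<in> P \<Longrightarrow> dist (centroid P) x = norm w" using P by (auto simp: dist_ngon)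
  then show ?thesis using that by blast
qed

lemma poly_edge_sym: "poly_edge P a b \<longleftrightarrow> poly_edge P b a"
  by (auto simp: poly_edge_def closed_segment_commute)

text \<open>The circumscribed circle meets the line of the edge only in \<open>a\<close> and
  \<open>b\<close>, so no third corner attains the minimum.\<close>

lemma poly_edge_functional:
  assumes "regular_polygon P" "poly_edge P a b"
  obtains e where "e \<noteq> 0" "e \<bullet> a = e \<bullet> b" "\<And>x. x \<in> convex hull P \<Longrightarrow> e \<bullet> a \<le> e \<bullet> x"
    "\<And>x. x \<in> P \<Longrightarrow> e \<bullet> x = e \<bullet> a \<Longrightarrow> x = a \<or> x = b"
proof -
  obtain e where e: "e \<noteq> 0" "e \<bullet> a = e \<bullet> b" "\<And>x. x \<in> P \<Longrightarrow> e \<bullet> a \<le> e \<bullet> x"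
    and ab: "a \<in> P" "b \<in> P" "a \<noteq> b"
    using assms(2) poly_edge_iff[OF regular_polygon_finite[OF assms(1)]] by metis
  obtain r where r: "\<And>x. x \<in> P \<Longrightarrow> dist (centroid P) x = r"
    using regular_polygon_circle[OF assms(1)] by blast
  have "convex hull P \<subseteq> {x. e \<bullet> x \<ge> e \<bullet> a}"
    using e(3) by (intro hull_minimal) (auto simp: convex_halfspace_ge)
  moreover have "x = a \<or> x = b" if "x \<in> P" "e \<bullet> x = e \<bullet> a" for x
    using circle_line_two_points[OF e(1,2) that(2) ab(3)] r ab that by metis
  ultimately show ?thesis using that[OF e(1,2)] by blast
qed

text \<open>The sign of \<open>l\<close> below records on which side of the oriented edge the polygon lies.\<close>

lemma poly_edge_centroid:
  assumes "regular_polygon P" "poly_edge P a b"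
  obtains l :: real where "l \<noteq> 0" "centroid P = midpoint a b + of_real l * (\<i> * (b - a))"
proof -
  have ab: "a \<in> P" "b \<in> P" "a \<noteq> b" using assms(2) by (auto simp: poly_edge_def)
  obtain r where r: "\<And>x. x \<in> P \<Longrightarrow> dist (centroid P) x = r"
    using regular_polygon_circle[OF assms(1)] by blast
  define d where "d = centroid P - midpoint a b"
  define v where "v = b - a"
  have v: "v \<noteq> 0" using ab by (simp add: v_def)
  have "centroid P - a = d + v / 2" "centroid P - b = d - v / 2"
    by (simp_all add: d_def v_def midpoint_def scaleR_conv_of_real field_simps)
  then have "norm (d + v / 2) = norm (d - v / 2)" using r ab by (metis dist_norm)
  then have "(d + v / 2) \<bullet> (d + v / 2) = (d - v / 2) \<bullet> (d - v / 2)" by (simp add: norm_eq)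
  then have "d \<bullet> v = 0" by (simp add: inner_complex_def algebra_simps)
  then have o: "Re d * Re v + Im d * Im v = 0" by (simp add: inner_complex_def)
  have "\<exists>l. Re d = l * (- Im v) \<and> Im d = l * Re v"
    by (rule real_proportional) (use o v in \<open>auto simp: complex_eq_iff algebra_simps\<close>)
  then obtain l where "Re d = l * (- Im v)" "Im d = l * Re v" by blast
  then have d: "d = of_real l * (\<i> * v)" by (simp add: complex_eq_iff)
  have "l \<noteq> 0"
  proof
    assume "l = 0"
    then have "centroid P = midpoint a b" using d by (simp add: d_def)
    moreover have "midpoint a b \<in> frontier (convex hull P)"
      using assms(2) by (auto simp: poly_edge_def)
    ultimately show False using regular_polygon_centroid_interior[OF assms(1)]
      by (simp add: frontier_def)
  qed
  then show ?thesis using that d by (metis d_def v_def add.commute diff_add_cancel)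
qed

text \<open>The segments from the edge midpoint to the two centres lie on one ray and, apart from
  the midpoint, in the respective interiors; so they overlap there.\<close>

lemma same_side_interiors_meet:
  assumes P: "regular_polygon P" "poly_edge P a b"
      and lP: "centroid P = midpoint a b + of_real l * (\<i> * (b - a))"
      and Q: "regular_polygon Q" "poly_edge Q a b"
      and lQ: "centroid Q = midpoint a b + of_real m * (\<i> * (b - a))"
      and lm: "l * m > 0"
  shows "interior (convex hull P) \<inter> interior (convex hull Q) \<noteq> {}"
proof -
  have toward: "midpoint a b + of_real (t * s) * (\<i> * (b - a)) \<in> interior (convex hull R)"
    if R: "regular_polygon R" "poly_edge R a b"
      and c: "centroid R = midpoint a b + of_real s * (\<i> * (b - a))"
      and t: "0 < t" "t \<le> 1" for R and s t :: real
  proof -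
    have "midpoint a b \<in> frontier (convex hull R)" using R(2) by (auto simp: poly_edge_def)
    then have m: "midpoint a b \<in> closure (convex hull R)" by (simp add: frontier_def)
    have "midpoint a b - t *\<^sub>R (midpoint a b - centroid R) \<in> interior (convex hull R)"
      using mem_interior_closure_convex_shrink[OF convex_convex_hull
          regular_polygon_centroid_interior[OF R(1)] m t] .
    moreover have "midpoint a b - t *\<^sub>R (midpoint a b - centroid R)
        = midpoint a b + of_real (t * s) * (\<i> * (b - a))"
      unfolding c by (simp add: scaleR_conv_of_real algebra_simps)
    ultimately show ?thesis by simp
  qed
  \<comment> \<open>Chosen so that \<open>t * l = u * m\<close>: one point on both segments.\<close>
  define t where "t = m / (l + m)"
  define u where "u = l / (l + m)"
  have "(l > 0 \<and> m > 0) \<or> (l < 0 \<and> m < 0)" using lm by (simp add: zero_less_mult_iff)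
  then have "0 < t" "t \<le> 1" "0 < u" "u \<le> 1" "t * l = u * m"
    by (auto simp: t_def u_def field_simps divide_neg_neg)
  then show ?thesis using toward[OF P lP, of t] toward[OF Q lQ, of u] by auto
qed

subsection \<open>Cyclic parametrisations\<close>

text \<open>A periodic enumeration that also records which corners are joined by edges: what the
  combinatorial arguments need of a polygon, free of centre and radius.\<close>

definition cyc_param :: "complex set \<Rightarrow> nat \<Rightarrow> (int \<Rightarrow> complex) \<Rightarrow> bool" where
  "cyc_param P n h \<longleftrightarrow> n \<ge> 3 \<and> range h = P \<and> (\<forall>i j. h i = h j \<longleftrightarrow> int n dvd i - j) \<and>
     (\<forall>i j. poly_edge P (h i) (h j) \<longleftrightarrow> int n dvd i - j - 1 \<or> int n dvd j - i - 1)"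

lemma cyc_param_ngon:
  assumes "n \<ge> 3" "w \<noteq> 0"
  shows "cyc_param (range (ngon n c w)) n (ngon n c w)"
  using assms ngon_eq_iff[of n w c] poly_edge_ngon[OF assms, of c] by (simp add: cyc_param_def)

lemma cyc_param_eq: "cyc_param P n h \<Longrightarrow> h i = h j \<longleftrightarrow> int n dvd i - j"
  by (auto simp: cyc_param_def)

lemma cyc_param_edge:
  "cyc_param P n h \<Longrightarrow> poly_edge P (h i) (h j) \<longleftrightarrow> int n dvd i - j - 1 \<or> int n dvd j - i - 1"
  by (auto simp: cyc_param_def)

lemma cyc_param_mem: "cyc_param P n h \<Longrightarrow> h i \<in> P"
  by (auto simp: cyc_param_def)

lemma cyc_param_step: "cyc_param P n h \<Longrightarrow> poly_edge P (h i) (h (i + 1))"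
  by (simp add: cyc_param_edge)

lemma cyc_param_nbr:
  assumes "cyc_param P n h" "poly_edge P (h i) x"
  shows "x = h (i + 1) \<or> x = h (i - 1)"
proof -
  have "x \<in> P" using assms(2) by (auto simp: poly_edge_def)
  then obtain j where j: "x = h j" using assms(1) by (auto simp: cyc_param_def)
  then have "int n dvd i - j - 1 \<or> int n dvd j - i - 1"
    using cyc_param_edge[OF assms(1)] assms(2) by simp
  then have "int n dvd (i - 1) - j \<or> int n dvd j - (i + 1)" by (simp add: algebra_simps)
  then show ?thesis using cyc_param_eq[OF assms(1)] j by metis
qed

lemma cyc_param_regular:
  assumes "regular_polygon P"
  obtains h where "cyc_param P (card P) h"
proof -
  obtain n c w where n: "n \<ge> 3" and w: "w \<noteq> 0" and P: "P = range (ngon n c w)"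
    using regular_polygonD[OF assms] .
  then show ?thesis using that cyc_param_ngon[OF n w] card_ngon[of n w c] by auto
qed

lemma cyc_param_reparam:
  assumes "cyc_param P n h" "s = 1 \<or> s = - 1"
  shows "cyc_param P n (\<lambda>k. h (j + s * k))"
proof -
  have "\<exists>k. x = h (j + s * k)" if x: "x \<in> P" for x
  proof -
    obtain i where "x = h i" using x assms(1) by (auto simp: cyc_param_def)
    then have "x = h (j + s * (s * (i - j)))" using assms(2) by auto
    then show ?thesis by blast
  qed
  then have "range (\<lambda>k. h (j + s * k)) = P" using cyc_param_mem[OF assms(1)] by auto
  moreover have "int n dvd (j + s * i) - (j + s * k) \<longleftrightarrow> int n dvd i - k" for i k
    using assms(2) dvd_minus_iff[of "int n" "i - k"] by (auto simp: algebra_simps)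
  moreover have "int n dvd (j + s * i) - (j + s * k) - 1 \<or> int n dvd (j + s * k) - (j + s * i) - 1
      \<longleftrightarrow> int n dvd i - k - 1 \<or> int n dvd k - i - 1" for i k
    using assms(2) by (auto simp: algebra_simps)
  ultimately show ?thesis using assms(1) by (simp add: cyc_param_def)
qed

text \<open>The image of one edge fixes \<open>j\<close> and \<open>s\<close>. Each further corner
  is then forced, since a step back would contradict injectivity when \<open>n\<close> is at least
  3.\<close>

lemma dihedral:
  assumes p: "cyc_param P n p" and q: "cyc_param Q n q"
    and inj: "inj_on g P" and edge: "\<And>a b. poly_edge P a b \<Longrightarrow> poly_edge Q (g a) (g b)"
  obtains j s where "s = 1 \<or> s = - (1::int)" "\<And>k. g (p k) = q (j + s * k)"
proof -
  have n: "n \<ge> 3" using p by (simp add: cyc_param_def)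
  have e: "poly_edge Q (g (p k)) (g (p (k + 1)))" for k using edge cyc_param_step[OF p] .
  have "g (p 0) \<in> Q" using e[of 0] by (auto simp: poly_edge_def)
  then obtain j where j: "g (p 0) = q j" using q by (auto simp: cyc_param_def)
  have "g (p 1) = q (j + 1) \<or> g (p 1) = q (j - 1)"
    using cyc_param_nbr[OF q] e[of 0] j by simp
  then obtain s :: int where s: "s = 1 \<or> s = - 1" and j1: "g (p 1) = q (j + s)"
    by (metis add.commute uminus_add_conv_diff)
  have ind: "g (p (int k)) = q (j + s * int k) \<and> g (p (int k + 1)) = q (j + s * (int k + 1))" for k
  proof (induction k)
    case 0
    then show ?case using j j1 by simp
  next
    case (Suc k)
    have "poly_edge Q (q (j + s * (int k + 1))) (g (p (int k + 2)))"
      using e[of "int k + 1"] Suc by (simp add: algebra_simps)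
    then have "g (p (int k + 2)) = q (j + s * (int k + 1) + 1) \<or>
        g (p (int k + 2)) = q (j + s * (int k + 1) - 1)"
      using cyc_param_nbr[OF q] by blast
    then have "g (p (int k + 2)) = q (j + s * (int k + 2)) \<or> g (p (int k + 2)) = q (j + s * int k)"
      using s by (auto simp: algebra_simps)
    moreover have "g (p (int k + 2)) \<noteq> q (j + s * int k)"
    proof
      assume "g (p (int k + 2)) = q (j + s * int k)"
      then have "p (int k + 2) = p (int k)"
        using Suc inj cyc_param_mem[OF p] by (metis inj_onD)
      then have "int n dvd 2" using cyc_param_eq[OF p] by simp
      then show False using n zdvd_imp_le[of "int n" 2] by simp
    qed
    ultimately show ?case using Suc by (simp add: algebra_simps)
  qed
  have "g (p k) = q (j + s * k)" for k
  proof -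
    define m where "m = k mod int n"
    have m: "m \<ge> 0" using n by (simp add: m_def)
    have d: "int n dvd m - k"
      using minus_mult_div_eq_mod[of k "int n"] unfolding m_def
      by (metis dvd_minus_iff dvd_triv_left minus_diff_eq minus_mult_div_eq_mod diff_diff_eq2 add_diff_cancel_left')
    then have "p m = p k" using cyc_param_eq[OF p] by simp
    moreover have "g (p m) = q (j + s * m)" using ind[of "nat m"] m by simp
    moreover have "int n dvd (j + s * m) - (j + s * k)"
      using d by (metis add_diff_cancel_left dvd_mult right_diff_distrib)
    then have "q (j + s * m) = q (j + s * k)" using cyc_param_eq[OF q] by simp
    ultimately show ?thesis by simp
  qed
  then show ?thesis using that s by blast
qed

lemma cyc_param_subset_step:
  assumes h: "cyc_param P n h" and i: "h i \<in> A" and step: "\<And>k. h k \<in> A \<Longrightarrow> h (k + 1) \<in> A"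
  shows "P \<subseteq> A"
proof
  fix x assume "x \<in> P"
  then obtain j where j: "x = h j" using h by (auto simp: cyc_param_def)
  have n: "n \<ge> 3" using h by (simp add: cyc_param_def)
  have up: "h (i + int m) \<in> A" for m
  proof (induction m)
    case (Suc m)
    then show ?case using step[of "i + int m"] by (simp add: algebra_simps)
  qed (use i in simp)
  define m where "m = nat ((j - i) mod int n)"
  have m: "int m = (j - i) mod int n" using n by (simp add: m_def)
  have "i + int m - j = - (int n * ((j - i) div int n))"
    unfolding m using minus_mult_div_eq_mod[of "j - i" "int n"] by linarith
  then have "int n dvd i + int m - j" by (metis dvd_minus_iff dvd_triv_left)
  then have "h (i + int m) = h j" using cyc_param_eq[OF h] by blast
  then show "x \<in> A" using up[of m] j by simp
qed

subsection \<open>Plane isometries\<close>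

definition isom :: "(complex \<Rightarrow> complex) \<Rightarrow> bool" where
  "isom f \<longleftrightarrow> (\<forall>x y. dist (f x) (f y) = dist x y)"

definition direct :: "complex \<Rightarrow> complex \<Rightarrow> complex \<Rightarrow> complex" where
  "direct b u z = b + u * z"

definition opposite :: "complex \<Rightarrow> complex \<Rightarrow> complex \<Rightarrow> complex" where
  "opposite b u z = b + u * cnj z"

lemma isom_direct: "norm u = 1 \<Longrightarrow> isom (direct b u)"
  by (simp add: isom_def direct_def dist_norm right_diff_distrib[symmetric] norm_mult)

lemma isom_opposite: "norm u = 1 \<Longrightarrow> isom (opposite b u)"
  by (simp add: isom_def opposite_def dist_norm right_diff_distrib[symmetric] norm_mult
      complex_cnj_diff[symmetric] del: complex_cnj_diff)

text \<open>After 0 and 1 are moved back to themselves, the distances to them determine the real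
  part, and the imaginary part up to sign; the image of \<i> fixes the sign for all points at
  once.\<close>

lemma isom_cases:
  assumes "isom f"
  obtains (direct) b u where "norm u = 1" "f = direct b u"
    | (opposite) b u where "norm u = 1" "f = opposite b u"
proof -
  define b where "b = f 0"
  define u where "u = f 1 - f 0"
  have d: "norm (f x - f y) = norm (x - y)" for x y using assms by (simp add: isom_def dist_norm)
  have u: "norm u = 1" using d[of 1 0] by (simp add: u_def)
  then have u0: "u \<noteq> 0" by auto
  define g where "g z = (f z - b) / u" for z
  have g: "norm (g x - g y) = norm (x - y)" for x y
    using d[of x y] u by (simp add: g_def diff_divide_distrib[symmetric] norm_divide)
  have g0: "g 0 = 0" "g 1 = 1" using u0 by (simp_all add: g_def b_def u_def)
  have sq: "(Re (g x) - Re (g y))\<^sup>2 + (Im (g x) - Im (g y))\<^sup>2 = (Re x - Re y)\<^sup>2 + (Im x - Im y)\<^sup>2" for x y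
    using arg_cong[OF g[of x y], of "\<lambda>r. r\<^sup>2"] unfolding cmod_power2 by simp
  have re: "Re (g z) = Re z" and im: "(Im (g z))\<^sup>2 = (Im z)\<^sup>2" for z
    using sq[of z 0] sq[of z 1] g0 by (simp_all add: power2_eq_square algebra_simps)
  have "g \<i> = \<i> \<or> g \<i> = - \<i>"
    using re[of \<i>] im[of \<i>] by (auto simp: complex_eq_iff power2_eq_1_iff)
  then consider "g \<i> = \<i>" | "g \<i> = - \<i>" by blast
  then show thesis
  proof cases
    case 1
    have "g z = z" for z
      using sq[of z \<i>] re[of z] im[of z] 1 by (simp add: complex_eq_iff power2_eq_square algebra_simps)
    then have "f z = direct b u z" for z using u0 by (simp add: g_def direct_def field_simps)
    then show ?thesis using direct[OF u] by blast
  next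
    case 2
    have "g z = cnj z" for z
      using sq[of z \<i>] re[of z] im[of z] 2 by (simp add: complex_eq_iff power2_eq_square algebra_simps)
    then have "f z = opposite b u z" for z using u0 by (simp add: g_def opposite_def field_simps)
    then show ?thesis using opposite[OF u] by blast
  qed
qed

lemma isom_inj: "isom f \<Longrightarrow> inj f"
  unfolding isom_def by (metis dist_eq_0_iff injI)

lemma isom_comp: "isom f \<Longrightarrow> isom g \<Longrightarrow> isom (f \<circ> g)"
  by (simp add: isom_def)

lemma isom_surj:
  assumes "isom f" shows "surj f"
  using assms
proof (cases rule: isom_cases)
  case (direct b u)
  have "u \<noteq> 0" using direct(1) by auto
  then have "f ((y - b) / u) = y" for y unfolding direct(2) by (simp add: direct_def)
  then show ?thesis by (rule surjI)
next
  case (opposite b u)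
  have "u \<noteq> 0" using opposite(1) by auto
  then have "f (cnj ((y - b) / u)) = y" for y unfolding opposite(2)
    by (simp add: opposite_def del: complex_cnj_divide)
  then show ?thesis by (rule surjI)
qed

lemma isom_bij: "isom f \<Longrightarrow> bij f"
  by (simp add: isom_inj isom_surj bij_def)

lemma isom_inv: "isom f \<Longrightarrow> isom (inv f)"
  by (metis isom_def isom_surj surj_f_inv_f)

lemma isom_affine:
  assumes "isom f"
  obtains l b where "linear l" "f = (\<lambda>z. b + l z)"
  using assms
proof (cases rule: isom_cases)
  case (direct b u)
  have "linear (\<lambda>z. u * z)" by (simp add: linear_times)
  then show ?thesis using that direct by (metis direct_def ext)
next
  case (opposite b u)
  have "linear (\<lambda>z. u * cnj z)" 
    by (auto intro!: linearI simp: algebra_simps scaleR_conv_of_real)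
  then show ?thesis using that opposite by (metis opposite_def ext)
qed

lemma isom_convex_hull:
  assumes "isom f" shows "f ` (convex hull S) = convex hull (f ` S)"
proof -
  obtain l b where l: "linear l" "f = (\<lambda>z. b + l z)" using isom_affine[OF assms] .
  have "f ` A = (+) b ` (l ` A)" for A unfolding l by auto
  then show ?thesis by (metis convex_hull_linear_image[OF l(1)] convex_hull_translation)
qed

lemma isom_segment:
  assumes "isom f" shows "f ` closed_segment a b = closed_segment (f a) (f b)"
  using isom_convex_hull[OF assms, of "{a, b}"] by (simp add: segment_convex_hull)

lemma isom_centroid:
  assumes "isom f" "finite P" "P \<noteq> {}"
  shows "centroid (f ` P) = f (centroid P)"
proof -
  obtain l b where l: "linear l" "f = (\<lambda>z. b + l z)" using isom_affine[OF assms(1)] .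
  have inj: "inj_on f P" using isom_inj[OF assms(1)] by (rule inj_on_subset) simp
  have c: "card P > 0" using assms by (simp add: card_gt_0_iff)
  have "(\<Sum>x\<in>f ` P. x) = (\<Sum>x\<in>P. b + l x)" using sum.reindex[OF inj, of "\<lambda>x. x"] l by simp
  also have "\<dots> = of_nat (card P) * b + l (\<Sum>x\<in>P. x)"
    by (simp add: sum.distrib linear_sum[OF l(1)])
  finally have 1: "centroid (f ` P) = b + l (\<Sum>x\<in>P. x) / of_nat (card P)"
    using c card_image[OF inj] by (simp add: centroid_def add_divide_distrib)
  have "l (centroid P) = l ((1 / real (card P)) *\<^sub>R (\<Sum>x\<in>P. x))"
    by (simp add: centroid_def scaleR_conv_of_real field_simps)
  also have "\<dots> = l (\<Sum>x\<in>P. x) / of_nat (card P)"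
    unfolding linear_scale[OF l(1)] by (simp add: scaleR_conv_of_real field_simps)
  finally show ?thesis using 1 l by simp
qed

text \<open>The functional of the edge is carried along by the linear part, as \<open>u * e\<close>
  or \<open>u * cnj e\<close>, up to an additive constant.\<close>

lemma isom_poly_edge:
  assumes f: "isom f" and "poly_edge P a b" "finite P"
  shows "poly_edge (f ` P) (f a) (f b)"
proof -
  have fin: "finite (f ` P)" using assms by simp
  obtain e where e: "e \<noteq> 0" "e \<bullet> a = e \<bullet> b" "\<forall>x\<in>P. e \<bullet> a \<le> e \<bullet> x" and ab: "a \<in> P" "b \<in> P" "a \<noteq> b"
    using assms poly_edge_iff by metis
  have "\<exists>e'. e' \<noteq> 0 \<and> (\<exists>t. \<forall>z. e' \<bullet> f z = t + e \<bullet> z)"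
    using f
  proof (cases rule: isom_cases)
    case (direct b u)
    have "(Re u)\<^sup>2 + (Im u)\<^sup>2 = 1" using direct(1) cmod_power2[of u] by simp
    then have "(u * e) \<bullet> (u * z) = e \<bullet> z" for z
      unfolding inner_complex_def times_complex.sel by algebra
    then have "(u * e) \<bullet> f z = (u * e) \<bullet> b + e \<bullet> z" for z
      using direct(2) by (simp add: direct_def inner_add_right)
    moreover have "u * e \<noteq> 0" using direct(1) e(1) by auto
    ultimately show ?thesis by blast
  next
    case (opposite b u)
    have "(Re u)\<^sup>2 + (Im u)\<^sup>2 = 1" using opposite(1) cmod_power2[of u] by simp
    then have "(u * cnj e) \<bullet> (u * cnj z) = e \<bullet> z" for z
      unfolding inner_complex_def times_complex.sel cnj.sel by algebra
    then have "(u * cnj e) \<bullet> f z = (u * cnj e) \<bullet> b + e \<bullet> z" for z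
      using opposite(2) by (simp add: opposite_def inner_add_right)
    moreover have "u * cnj e \<noteq> 0" using opposite(1) e(1) by auto
    ultimately show ?thesis by blast
  qed
  then obtain e' t where e': "e' \<noteq> 0" "\<And>z. e' \<bullet> f z = t + e \<bullet> z" by blast
  have "f a \<noteq> f b" using ab isom_inj[OF f] by (simp add: inj_eq)
  then show ?thesis unfolding poly_edge_iff[OF fin] using e e' ab by (intro conjI exI[of _ e']) auto
qed

text \<open>Agreement on the corners gives agreement at the centre, and the vectors from the centre
  to two consecutive corners form a real basis.\<close>

lemma isom_regular_eq:
  assumes "isom f" "isom g" "regular_polygon P" "\<And>x. x \<in> P \<Longrightarrow> f x = g x"
  shows "f = g"
proof -
  obtain k d where k: "linear k" "f = (\<lambda>z. d + k z)" using isom_affine[OF assms(1)] .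
  obtain l b where l: "linear l" "g = (\<lambda>z. b + l z)" using isom_affine[OF assms(2)] .
  obtain n c w where n: "n \<ge> 3" and w: "w \<noteq> 0" and P: "P = range (ngon n c w)"
    using regular_polygonD[OF assms(3)] .
  have fg: "f (ngon n c w i) = g (ngon n c w i)" for i using assms(4) P by auto
  have c: "f c = g c"
  proof -
    have "f ` P = g ` P" using assms(4) by simp
    moreover have "centroid P = c" using centroid_ngon n w P by simp
    moreover have "finite P" "P \<noteq> {}" using P n by (auto simp: finite_ngon)
    ultimately show ?thesis using isom_centroid assms by metis
  qed
  have "ngon n c w 0 = c + w" by (simp add: ngon_def)
  define z where "z = cis (2 * pi / n)"
  have n1: "ngon n c w 1 = c + w * z" by (simp add: ngon_def z_def)
  have eq: "k w = l w" "k (w * z) = l (w * z)"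
  proof -
    have "d + k c + k w = b + l c + l w" "d + k c + k (w * z) = b + l c + l (w * z)" 
      using fg[of 0] fg[of 1] n1 \<open>ngon n c w 0 = c + w\<close> 
      by (auto simp: k(2) l(2) linear_add[OF k(1)] linear_add[OF l(1)] add.assoc)
    moreover have "d + k c = b + l c" using c by (simp add: k(2) l(2))
    ultimately show "k w = l w" "k (w * z) = l (w * z)" by auto
  qed
  have "0 < 2 * pi / n" "2 * pi / n < pi" using n by (auto simp: field_simps)
  then have zI: "Im z > 0" using sin_gt_zero by (simp add: z_def)
  have kl: "k x = l x" for x
  proof -
    define t where "t = Im (x / w) / Im z"
    define s where "s = Re (x / w) - t * Re z"
    have "x / w = of_real s + of_real t * z"
      using zI by (simp add: complex_eq_iff s_def t_def)
    then have "x = s *\<^sub>R w + t *\<^sub>R (w * z)"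
      using w by (simp add: field_simps scaleR_conv_of_real)
    then show ?thesis using eq
      by (simp add: linear_add[OF k(1)] linear_add[OF l(1)] linear_scale[OF k(1)] linear_scale[OF l(1)])
  qed
  moreover have "d = b" using c kl by (simp add: k l)
  ultimately show ?thesis unfolding k l by simp
qed

lemma ngon_edge_length:
  "dist (ngon n c w i) (ngon n c w (i + 1)) = norm w * norm (cis (2 * pi / n) - 1)"
proof -
  have "cis (2 * pi * real_of_int (i + 1) / n) = cis (2 * pi * i / n) * cis (2 * pi / n)"
    unfolding cis_mult by (simp add: field_simps add_divide_distrib)
  then have "ngon n c w (i + 1) - ngon n c w i = w * cis (2 * pi * i / n) * (cis (2 * pi / n) - 1)"
    unfolding ngon_def by (simp add: algebra_simps)
  then have "norm (ngon n c w (i + 1) - ngon n c w i) = norm w * norm (cis (2 * pi / n) - 1)"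
    by (simp add: norm_mult)
  then show ?thesis by (simp add: dist_norm norm_minus_commute)
qed

lemma cis_step_ne: "n \<ge> (3::nat) \<Longrightarrow> norm (cis (2 * pi / n) - 1) \<noteq> 0"
proof -
  assume n: "n \<ge> 3"
  then have "0 < 2 * pi / n" "2 * pi / n < pi" by (auto simp: field_simps)
  then have "sin (2 * pi / n) > 0" using sin_gt_zero by blast
  then show ?thesis by (auto simp: complex_eq_iff)
qed

lemma dist_poly_edge_ngon:
  assumes "n \<ge> 3" "w \<noteq> 0" "poly_edge (range (ngon n c w)) a b"
  shows "dist a b = norm w * norm (cis (2 * pi / n) - 1)"
proof -
  have cy: "cyc_param (range (ngon n c w)) n (ngon n c w)" using cyc_param_ngon assms by blast
  have "a \<in> range (ngon n c w)" using assms(3) by (auto simp: poly_edge_def)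
  then obtain i where a: "a = ngon n c w i" by auto
  then have "b = ngon n c w (i + 1) \<or> b = ngon n c w (i - 1)"
    using cyc_param_nbr[OF cy] assms(3) by simp
  then show ?thesis
    using ngon_edge_length[of n c w i] ngon_edge_length[of n c w "i - 1"] a
    by (auto simp: dist_commute)
qed

lemma ngon_isom:
  assumes n: "n \<ge> 3" and "w \<noteq> 0" "norm w = norm w'" and s: "s = 1 \<or> s = - (1::int)"
  obtains f where "isom f" "\<And>k. f (ngon n c w k) = ngon n c' w' (j + s * k)"
proof -
  let ?z = "cis (2 * pi * real_of_int j / n)"
  have nz: "ngon n c' w' (j + i) = c' + w' * ?z * cis (2 * pi * real_of_int i / n)" for i
  proof -
    have "cis (2 * pi * real_of_int (j + i) / n) = ?z * cis (2 * pi * real_of_int i / n)"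
      unfolding cis_mult by (simp add: field_simps add_divide_distrib)
    then show ?thesis by (simp add: ngon_def)
  qed
  from s show ?thesis
  proof
    assume s: "s = 1"
    let ?u = "w' * ?z / w"
    have "norm ?u = 1" using assms(2) assms(3)[symmetric] by (simp add: norm_mult norm_divide)
    moreover have "direct (c' - ?u * c) ?u (ngon n c w k) = c' + w' * ?z * cis (2 * pi * k / n)" for k
      using assms(2) by (simp add: direct_def ngon_def ring_distribs)
    then have "direct (c' - ?u * c) ?u (ngon n c w k) = ngon n c' w' (j + s * k)" for k
      unfolding s mult_1 nz .
    ultimately show ?thesis using that isom_direct by blast
  next
    assume s: "s = - 1"
    let ?u = "w' * ?z / cnj w"
    have "norm ?u = 1" using assms(2) assms(3)[symmetric] by (simp add: norm_mult norm_divide)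
    moreover have "opposite (c' - ?u * cnj c) ?u (ngon n c w k)
        = c' + w' * ?z * cis (2 * pi * real_of_int (- k) / n)" for k
      using assms(2) by (simp add: opposite_def ngon_def ring_distribs cis_cnj)
    then have "opposite (c' - ?u * cnj c) ?u (ngon n c w k) = ngon n c' w' (j + s * k)" for k
      unfolding s mult_minus1 nz .
    ultimately show ?thesis using that isom_opposite by blast
  qed
qed

text \<open>Isometries that agree at two points differ at most by the reflection in their line. In
  the second alternative \<open>\<sigma>\<close> is 1 if \<open>f\<close> preserves orientation and
  -1 if it reverses it; the formulas say that \<open>f\<close> and \<open>g\<close> send a point off
  the line to opposite sides.\<close>

lemma isom_agree_cases:
  assumes "isom f" "isom g" "f a = g a" "f b = g b" "a \<noteq> b"
  shows "f = g \<or> (\<exists>\<sigma>. (\<sigma> = 1 \<or> \<sigma> = - (1::real)) \<and> (\<forall>l::real.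
     f (midpoint a b + of_real l * (\<i> * (b - a))) = midpoint (f a) (f b) + of_real (\<sigma> * l) * (\<i> * (f b - f a)) \<and>
     g (midpoint a b + of_real l * (\<i> * (b - a))) = midpoint (g a) (g b) - of_real (\<sigma> * l) * (\<i> * (g b - g a))))"
proof -
  have D: "direct c u (midpoint a b + of_real l * (\<i> * (b - a)))
      = midpoint (direct c u a) (direct c u b) + of_real l * (\<i> * (direct c u b - direct c u a))" for c u l
    by (simp add: direct_def midpoint_def scaleR_conv_of_real field_simps)
  have O: "opposite c u (midpoint a b + of_real l * (\<i> * (b - a)))
      = midpoint (opposite c u a) (opposite c u b) - of_real l * (\<i> * (opposite c u b - opposite c u a))" for c u l
    by (simp add: opposite_def midpoint_def scaleR_conv_of_real field_simps)
  from assms(1) show ?thesis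
  proof (cases rule: isom_cases)
    case f: (direct c u)
    from assms(2) show ?thesis
    proof (cases rule: isom_cases)
      case g: (direct d v)
      have "(u - v) * (b - a) = 0"
        using assms(3,4) unfolding f g direct_def by algebra
      then have "u = v" using assms(5) by simp
      then show ?thesis using assms(3) unfolding f g direct_def by auto
    next
      case g: (opposite d v)
      show ?thesis
        by (intro disjI2 exI[of _ 1]) (simp add: f g D O)
    qed
  next
    case f: (opposite c u)
    from assms(2) show ?thesis
    proof (cases rule: isom_cases)
      case g: (opposite d v)
      have "(u - v) * (cnj b - cnj a) = 0"
        using assms(3,4) unfolding f g opposite_def by algebra
      then have "u = v" using assms(5) by simp
      then show ?thesis using assms(3) unfolding f g opposite_def by auto
    next
      case g: (direct d v)
      show ?thesis
        by (intro disjI2 exI[of _ "- 1"]) (simp add: f g D O)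
    qed
  qed
qed

section \<open>Fixed points and glide reflections\<close>

lemma affine_two_fixed_points:
  fixes b u x y :: complex
  assumes "b + u * x = x" "b + u * y = y"
  shows "(1 - u) * (x - y) = 0"
proof -
  have "(b + u * x) - (b + u * y) = u * (x - y)" by (simp add: algebra_simps)
  then have "x - y = u * (x - y)" unfolding assms .
  then show ?thesis by (metis diff_self left_diff_distrib mult_1)
qed

text \<open>A glide reflection commutes only with isometries that preserve the distance to its axis, so
  a commutative group containing one cannot act cocompactly.\<close>

lemma commutes_with_glide:
  assumes u: "norm u = 1" and nofix: "\<And>x. opposite b u x \<noteq> x"
    and f: "isom f" "\<And>z. opposite b u (f z) = f (opposite b u z)"
    and f_nofix: "f = id \<or> (\<forall>x. f x \<noteq> x)"
  shows "norm (f z - u * cnj (f z) - (b - u * cnj b) / 2) = norm (z - u * cnj z - (b - u * cnj b) / 2)"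
proof -
  \<comment> \<open>The norms compared are twice the distances to the axis:
    \<open>z - u * cnj z\<close> is twice the component of \<open>z\<close> across the axis, and on
    the axis, which runs through the midpoints of points and their images, its value is
    \<open>(b - u * cnj b) / 2\<close>.\<close>
  have uu: "u * cnj u = 1" using u complex_norm_square[of u] by simp
  from f(1) show ?thesis
  proof (cases rule: isom_cases)
    case (direct d v)
    \<comment> \<open>A rotation would fix a point.\<close>
    have "v = 1"
    proof (rule ccontr)
      assume "v \<noteq> 1"
      then have "f (d / (1 - v)) = d / (1 - v)"
        by (simp add: direct direct_def field_simps)
      then have "f = id" using f_nofix by blast
      then have "f 0 = 0" "f 1 = 1" by simp_all
      then show False using \<open>v \<noteq> 1\<close> by (simp add: direct direct_def)
    qed
    then have fz: "f z = d + z" for z by (simp add: direct direct_def)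
    have "u * cnj d = d" using f(2)[of 0] by (simp add: fz opposite_def algebra_simps)
    then have "f z - u * cnj (f z) = z - u * cnj z" by (simp add: fz algebra_simps)
    then show ?thesis by simp
  next
    case (opposite d v)
    have vv: "v * cnj v = 1" using opposite(1) complex_norm_square[of v] by simp
    have c0: "b + u * cnj d = d + v * cnj b"
      using f(2)[of 0] by (simp add: opposite opposite_def)
    have "b + u * cnj (d + v) = d + v * cnj (b + u)"
      using f(2)[of 1] by (simp add: opposite opposite_def)
    then have "(b + u * cnj d) + u * cnj v = (d + v * cnj b) + v * cnj u" by (simp add: algebra_simps)
    then have c1: "u * cnj v = v * cnj u" unfolding c0 by (rule add_left_imp_eq)
    \<comment> \<open>The linear parts commute only if the two axes are parallel or
      perpendicular.\<close>
    have "(u - v) * (u + v) = (u * cnj v - v * cnj u) * (u * v)"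
      using uu vv by algebra
    then have "(u - v) * (u + v) = 0" using c1 by simp
    then have "v = u \<or> v = - u" by (auto simp: eq_neg_iff_add_eq_0 add.commute)
    then show ?thesis
    proof
      assume v: "v = u"
      have e: "b - u * cnj b = d - u * cnj d" using c0 v by (simp add: algebra_simps)
      define k where "k = (b - u * cnj b) / 2"
      have "x = x / 2 + x / 2" for x :: complex by simp
      then have k: "d - u * cnj d = k + k" unfolding e[symmetric] k_def .
      have "f z - u * cnj (f z) = (d - u * cnj d) - (z - u * cnj z)"
        using uu by (simp add: opposite opposite_def v algebra_simps)
      then have "f z - u * cnj (f z) - k = - (z - u * cnj z - k)" unfolding k by simp
      then have "f z - u * cnj (f z) - (b - u * cnj b) / 2 = - (z - u * cnj z - (b - u * cnj b) / 2)"
        unfolding k_def .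
      then show ?thesis by (metis norm_minus_cancel)
    next
      assume v: "v = - u"
      \<comment> \<open>Perpendicular axes: the square of the glide is the translation by
        \<open>s\<close>. As \<open>s\<close> vanishes, the glide is a reflection and fixes
        \<open>b / 2\<close>.\<close>
      define s where "s = b + u * cnj b"
      have s: "s = d - u * cnj d" using c0 v by (simp add: s_def algebra_simps)
      have "u * cnj s = s" using uu by (simp add: s_def algebra_simps)
      moreover have "u * cnj s = - s" using uu by (simp add: s algebra_simps)
      ultimately have "s = 0" by simp
      then have "u * cnj b = - b" by (simp add: s_def eq_neg_iff_add_eq_0 add.commute)
      then have "u * cnj (b / 2) = - (b / 2)" by simp
      then have "opposite b u (b / 2) = b / 2" by (simp add: opposite_def)
      then show ?thesis using nofix by blast
    qed
  qed
qed

definition \<omega> :: complex where "\<omega> = cis (pi / 3)"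

definition rot :: "complex \<Rightarrow> complex \<Rightarrow> complex" where
  "rot c z = c + \<omega> * (z - c)"

lemma omega_sq: "\<omega> * \<omega> = \<omega> - 1"
  by (simp add: \<omega>_def complex_eq_iff cos_60 sin_60 field_simps)

lemma rot_isom: "isom (rot c)"
proof -
  have "rot c = direct (c - \<omega> * c) \<omega>" by (rule ext) (simp add: rot_def direct_def algebra_simps)
  then show ?thesis using isom_direct by (simp add: \<omega>_def)
qed

text \<open>Linear part 1 or -1: conjugation takes each translation to itself or to its inverse, so
  every group of translations is normalised.\<close>

definition half_turn_or_translation :: "(complex \<Rightarrow> complex) \<Rightarrow> bool" where
  "half_turn_or_translation f \<longleftrightarrow> (\<exists>b. f = (\<lambda>z. z + b) \<or> f = (\<lambda>z. b - z))"

lemma half_turn_or_translation_inv: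
  assumes "half_turn_or_translation f" shows "half_turn_or_translation (inv f)"
proof -
  obtain b where "f = (\<lambda>z. z + b) \<or> f = (\<lambda>z. b - z)"
    using assms by (auto simp: half_turn_or_translation_def)
  then show ?thesis
  proof
    assume f: "f = (\<lambda>z. z + b)"
    have "inv f = (\<lambda>z. z + (- b))" by (rule inv_unique_comp) (auto simp: f)
    then show ?thesis unfolding half_turn_or_translation_def by blast
  next
    assume f: "f = (\<lambda>z. b - z)"
    have "inv f = (\<lambda>z. b - z)" by (rule inv_unique_comp) (auto simp: f)
    then show ?thesis unfolding half_turn_or_translation_def by blast
  qed
qed

text \<open>A supporting line at \<open>x\<close> cuts out a face, the hull of some corners on that
  line. The circumscribed circle allows at most two of them, and there are two because
  \<open>x\<close> is not a corner.\<close>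

lemma frontier_point_on_edge:
  assumes P: "regular_polygon P" and x: "x \<in> convex hull P" "x \<notin> interior (convex hull P)" "x \<notin> P"
  obtains a b where "poly_edge P a b" "x \<in> open_segment a b"
proof -
  have fin: "finite P" using regular_polygon_finite[OF P] .
  obtain e where e: "e \<noteq> 0" "\<And>y. y \<in> convex hull P \<Longrightarrow> e \<bullet> x \<le> e \<bullet> y"
    using convex_supporting_hyperplane[OF convex_convex_hull x(1,2)] by metis
  let ?F = "convex hull P \<inter> {y. e \<bullet> y = e \<bullet> x}"
  have "?F face_of convex hull P"
    using e(2) by (intro face_of_Int_supporting_hyperplane_ge) auto
  then obtain S where S: "S \<subseteq> P" "?F = convex hull S"
    using face_of_convex_hull_subset fin finite_imp_compact by metis
  have eS: "e \<bullet> p = e \<bullet> x" if "p \<in> S" for p using S(2) hull_inc[OF that] by blast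
  have xS: "x \<in> convex hull S" using S(2) x(1) by blast
  then obtain a where a: "a \<in> S" by fastforce
  have "S \<noteq> {a}" using xS x(3) a S(1) by auto
  then obtain b where b: "b \<in> S" "b \<noteq> a" using a by blast
  obtain r where r: "\<And>x. x \<in> P \<Longrightarrow> dist (centroid P) x = r"
    using regular_polygon_circle[OF P] by blast
  have "S \<subseteq> {a, b}"
  proof
    fix d assume d: "d \<in> S"
    have "e \<bullet> a = e \<bullet> b" "e \<bullet> d = e \<bullet> a" using eS a b d by simp_all
    then show "d \<in> {a, b}"
      using circle_line_two_points[OF e(1) _ _ b(2)[symmetric], of d "centroid P" r] r S(1) a b d by blast
  qed
  then have seg: "x \<in> closed_segment a b"
    using xS hull_mono by (metis segment_convex_hull subsetD)
  have "x \<noteq> a" "x \<noteq> b" using x(3) S(1) a b by auto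
  moreover have "poly_edge P a b"
    unfolding poly_edge_iff[OF fin] using S(1) a b e eS hull_inc[of _ P]
    by (intro conjI exI[of _ e]) auto
  ultimately show ?thesis using that seg by (auto simp: open_segment_def)
qed

text \<open>Barycentric coordinates for the triangle: \<open>w = r / l\<close> measures the distance
  from the edge, \<open>a\<close> and \<open>b\<close> share the rest, and near an inner point of
  the edge their weights stay nonnegative.\<close>

lemma half_disc_in_triangle:
  fixes a b :: complex and l :: real
  assumes ab: "a \<noteq> b" and c: "c = midpoint a b + of_real l * (\<i> * (b - a))" and l: "l \<noteq> 0"
    and x: "x \<in> open_segment a b"
  obtains d where "d > 0"
    "\<And>y. dist y x < d \<Longrightarrow> l * Im ((y - a) / (b - a)) \<ge> 0 \<Longrightarrow> y \<in> convex hull {a, b, c}"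
proof -
  obtain t where t: "0 < t" "t < 1" "x = (1 - t) *\<^sub>R a + t *\<^sub>R b"
    using x by (auto simp: in_segment)
  \<comment> \<open>Lengths are taken in units of the edge. A displacement below \<open>e\<close>
    changes the weights of \<open>a\<close> and \<open>b\<close> by at most
    \<open>e * k\<close>.\<close>
  define k where "k = 1 + 1 / (2 * \<bar>l\<bar>)"
  have k: "k > 0" by (simp add: k_def add_pos_nonneg)
  define e where "e = min t (1 - t) / k"
  have e: "e > 0" using t k by (simp add: e_def)
  have ek: "e * k \<le> t" "e * k \<le> 1 - t" using k by (simp_all add: e_def)
  have nab: "norm (b - a) > 0" using ab by simp
  have "y \<in> convex hull {a, b, c}"
    if y: "dist y x < e * norm (b - a)" "l * Im ((y - a) / (b - a)) \<ge> 0" for y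
  proof -
    define s where "s = Re ((y - a) / (b - a))"
    define r where "r = Im ((y - a) / (b - a))"
    have z: "(y - a) / (b - a) = Complex s r" by (simp add: s_def r_def)
    have xt: "(x - a) / (b - a) = of_real t"
      using ab t(3) by (simp add: scaleR_conv_of_real field_simps)
    have "norm ((y - x) / (b - a)) < e"
      using y(1) nab by (simp add: norm_divide dist_norm divide_less_eq)
    moreover have "(y - x) / (b - a) = Complex (s - t) r"
    proof -
      have "(y - x) / (b - a) = (y - a) / (b - a) - (x - a) / (b - a)"
        by (simp add: diff_divide_distrib)
      then show ?thesis unfolding z xt by (simp add: complex_eq_iff)
    qed
    ultimately have "\<bar>s - t\<bar> < e" "\<bar>r\<bar> < e"
      using abs_Re_le_cmod[of "Complex (s - t) r"] abs_Im_le_cmod[of "Complex (s - t) r"] by auto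
    then have "\<bar>s - t\<bar> + \<bar>r\<bar> / (2 * \<bar>l\<bar>) \<le> e + e / (2 * \<bar>l\<bar>)"
      by (intro add_mono divide_right_mono) auto
    also have "\<dots> = e * k" by (simp add: k_def algebra_simps)
    finally have m: "\<bar>s - t\<bar> + \<bar>r\<bar> / (2 * \<bar>l\<bar>) \<le> e * k" .
    define w where "w = r / l"
    have w0: "w \<ge> 0" using y(2) l by (simp add: w_def r_def zero_le_mult_iff zero_le_divide_iff) linarith
    have w2: "w / 2 = \<bar>r\<bar> / (2 * \<bar>l\<bar>)"
      using w0 by (metis abs_divide abs_of_nonneg divide_divide_eq_left mult.commute w_def)
    define v where "v = s - w / 2"
    define u where "u = 1 - s - w / 2"
    have uv: "u \<ge> 0" "v \<ge> 0" "u + v + w = 1"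
      using m ek w2 by (auto simp: u_def v_def)
    have "y = a + Complex s r * (b - a)"
      using z ab by (metis add.commute diff_add_cancel nonzero_divide_eq_eq right_minus_eq)
    also have "Complex s r = of_real (v + w / 2) + of_real (w * l) * \<i>"
      using l by (simp add: complex_eq_iff v_def w_def)
    also have "a + (of_real (v + w / 2) + of_real (w * l) * \<i>) * (b - a)
        = of_real (1 - v - w) * a + of_real v * b + of_real w * c"
      unfolding c midpoint_def by (simp add: scaleR_conv_of_real field_simps)
    also have "1 - v - w = u" using uv(3) by simp
    finally have "y = u *\<^sub>R a + v *\<^sub>R b + w *\<^sub>R c" by (simp add: scaleR_conv_of_real)
    then show ?thesis unfolding convex_hull_3 using uv w0 by blast
  qed
  then show ?thesis using that[of "e * norm (b - a)"] e nab by simp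
qed

text \<open>Each polygon contains a half disc about \<open>x\<close> on its side of the edge, inside
  the triangle with its centre; the opposite signs of \<open>l\<close> and \<open>m\<close> make the
  two a full disc.\<close>

lemma opposite_sides_interior:
  assumes P: "regular_polygon P" "poly_edge P a b"
      and lP: "centroid P = midpoint a b + of_real l * (\<i> * (b - a))"
      and Q: "regular_polygon Q" "poly_edge Q a b"
      and lQ: "centroid Q = midpoint a b + of_real m * (\<i> * (b - a))"
      and lm: "l * m < 0" and x: "x \<in> open_segment a b"
  shows "x \<in> interior (convex hull P \<union> convex hull Q)"
proof -
  have ab: "a \<noteq> b" "a \<in> P" "b \<in> P" "a \<in> Q" "b \<in> Q" using P Q by (auto simp: poly_edge_def)
  have l0: "l \<noteq> 0" "m \<noteq> 0" using lm by auto
  have c: "centroid P \<in> convex hull P" "centroid Q \<in> convex hull Q"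
    using regular_polygon_centroid_interior P Q interior_subset by blast+
  have sub: "convex hull {a, b, centroid P} \<subseteq> convex hull P"
    "convex hull {a, b, centroid Q} \<subseteq> convex hull Q"
  proof -
    have "{a, b, centroid P} \<subseteq> convex hull P" "{a, b, centroid Q} \<subseteq> convex hull Q"
      using ab c by (auto simp: hull_inc)
    then show "convex hull {a, b, centroid P} \<subseteq> convex hull P"
        "convex hull {a, b, centroid Q} \<subseteq> convex hull Q"
      by (metis convex_convex_hull hull_minimal)+
  qed
  obtain d where d: "d > 0" "\<And>y. dist y x < d \<Longrightarrow> l * Im ((y - a) / (b - a)) \<ge> 0 \<Longrightarrow>
      y \<in> convex hull {a, b, centroid P}"
    using half_disc_in_triangle[OF ab(1) lP l0(1) x] by blast
  obtain d' where d': "d' > 0" "\<And>y. dist y x < d' \<Longrightarrow> m * Im ((y - a) / (b - a)) \<ge> 0 \<Longrightarrow>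
      y \<in> convex hull {a, b, centroid Q}"
    using half_disc_in_triangle[OF ab(1) lQ l0(2) x] by blast
  have "y \<in> convex hull P \<union> convex hull Q" if "y \<in> ball x (min d d')" for y
  proof -
    have "l * Im ((y - a) / (b - a)) \<ge> 0 \<or> m * Im ((y - a) / (b - a)) \<ge> 0"
      using lm by (auto simp: mult_less_0_iff zero_le_mult_iff)
    then show ?thesis using d(2)[of y] d'(2)[of y] that sub by (auto simp: dist_commute)
  qed
  then show ?thesis using d(1) d'(1) by (metis interior_maximal centre_in_ball min_less_iff_conj
        open_ball subsetI subsetD)
qed

subsection \<open>Local structure of the tiling\<close>

locale tiling_3464_4612 =
  fixes T :: "complex set set"
  assumes tiling: "edge_to_edge_tiling T"
      and types: "vertex_types T {[3,4,6,4], [4,6,12]}"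
begin

definition adj :: "complex set \<Rightarrow> complex set \<Rightarrow> complex \<Rightarrow> complex \<Rightarrow> bool" where
  "adj P Q a b \<longleftrightarrow> P \<in> T \<and> Q \<in> T \<and> P \<noteq> Q \<and> poly_edge P a b \<and> poly_edge Q a b"

lemma adj_commute: "adj P Q a b \<longleftrightarrow> adj Q P a b"
  by (auto simp: adj_def)

lemma adj_edge_commute: "adj P Q a b \<longleftrightarrow> adj P Q b a"
  by (auto simp: adj_def poly_edge_sym)

lemma tile_regular: "P \<in> T \<Longrightarrow> regular_polygon P"
  using tiling by (simp add: edge_to_edge_tiling_def)

lemma tile_finite: "P \<in> T \<Longrightarrow> finite P"
  using tile_regular regular_polygon_finite by blast

lemma tile_disjoint:
  "P \<in> T \<Longrightarrow> Q \<in> T \<Longrightarrow> x \<in> interior (convex hull P) \<Longrightarrow> x \<in> interior (convex hull Q) \<Longrightarrow> P = Q"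
  using tiling unfolding edge_to_edge_tiling_def by blast

lemma tiles_cover: "\<exists>P\<in>T. x \<in> convex hull P"
proof -
  have "\<Union>((\<lambda>P. convex hull P) ` T) = UNIV" using tiling by (simp add: edge_to_edge_tiling_def)
  then have "x \<in> \<Union>((\<lambda>P. convex hull P) ` T)" by simp
  then show ?thesis by simp
qed

lemma tile_meet:
  assumes "P \<in> T" "Q \<in> T" "P \<noteq> Q"
  shows "convex hull P \<inter> convex hull Q = {} \<or>
         (\<exists>v. v \<in> P \<and> v \<in> Q \<and> convex hull P \<inter> convex hull Q = {v}) \<or>
         (\<exists>a b. poly_edge P a b \<and> poly_edge Q a b \<and>
                convex hull P \<inter> convex hull Q = closed_segment a b)"
  using tiling assms by (simp add: edge_to_edge_tiling_def)

lemma tile_centroid_eq: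
  assumes "P \<in> T" "Q \<in> T" "centroid P = centroid Q" shows "P = Q"
  using tile_disjoint assms regular_polygon_centroid_interior tile_regular by metis

lemma adj_opposite_sides:
  assumes "adj P Q a b"
    "centroid P = midpoint a b + of_real l * (\<i> * (b - a))"
    "centroid Q = midpoint a b + of_real m * (\<i> * (b - a))"
  shows "l * m \<le> 0"
proof (rule ccontr)
  assume "\<not> l * m \<le> 0"
  then have "interior (convex hull P) \<inter> interior (convex hull Q) \<noteq> {}"
    using same_side_interiors_meet[of P a b l Q m] assms tile_regular by (simp add: adj_def)
  then show False using tile_disjoint assms(1) unfolding adj_def by blast
qed

text \<open>Three nonzero reals cannot have pairwise nonpositive products: an edge has only two
  sides.\<close>

lemma edge_two_tiles:
  assumes "P \<in> T" "Q \<in> T" "R \<in> T" "poly_edge P a b" "poly_edge Q a b" "poly_edge R a b"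
  shows "P = Q \<or> P = R \<or> Q = R"
proof (rule ccontr)
  assume "\<not> ?thesis"
  then have a: "adj P Q a b" "adj P R a b" "adj Q R a b" using assms by (auto simp: adj_def)
  obtain k where k: "k \<noteq> 0" "centroid P = midpoint a b + of_real k * (\<i> * (b - a))"
    using poly_edge_centroid tile_regular assms by metis
  obtain l where l: "l \<noteq> 0" "centroid Q = midpoint a b + of_real l * (\<i> * (b - a))"
    using poly_edge_centroid tile_regular assms by metis
  obtain m where m: "m \<noteq> 0" "centroid R = midpoint a b + of_real m * (\<i> * (b - a))"
    using poly_edge_centroid tile_regular assms by metis
  have "k * l \<le> 0" "k * m \<le> 0" "l * m \<le> 0" using adj_opposite_sides a k l m by metis+
  then show False using k l m by (auto simp: mult_le_0_iff)
qed

lemma adj_unique: "adj P Q a b \<Longrightarrow> adj P R a b \<Longrightarrow> Q = R"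
  using edge_two_tiles unfolding adj_def by blast

text \<open>Rotation and reversal of a type preserve the multiset of sizes. Consecutive tiles are
  distinct because the cycle has length at least 3, so their shared edge gives
  \<open>adj\<close>.\<close>

lemma vertex_cycle:
  assumes "u \<in> tverts T"
  obtains L where "distinct L" "length L \<ge> 3" "set L = {P \<in> T. u \<in> P}"
    "\<And>i. i < length L \<Longrightarrow> \<exists>w. adj (L ! i) (L ! ((i + 1) mod length L)) u w"
    "mset (map card L) = mset [3,4,6,4] \<or> mset (map card L) = mset [4,6,12]"
proof -
  obtain s where s: "s \<in> {[3,4,6,4], [4,6,12]}" "has_vertex_type T u s"
    using types assms unfolding vertex_types_def by blast
  obtain L where L: "distinct L" "length L \<ge> 3" "set L = {P \<in> T. u \<in> P}"
    "\<And>i. i < length L \<Longrightarrow> \<exists>w. poly_edge (L ! i) u w \<and> poly_edge (L ! ((i + 1) mod length L)) u w"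
    "cyc_equiv (map card L) s"
    using s(2) unfolding has_vertex_type_def by blast
  have "\<exists>w. adj (L ! i) (L ! ((i + 1) mod length L)) u w" if i: "i < length L" for i
  proof -
    obtain w where w: "poly_edge (L ! i) u w" "poly_edge (L ! ((i + 1) mod length L)) u w"
      using L(4) i by blast
    have i': "(i + 1) mod length L < length L" using L(2) by (intro mod_less_divisor) linarith
    have "(i + 1) mod length L \<noteq> i"
      using i L(2) by (cases "i + 1 = length L") auto
    then have "L ! i \<noteq> L ! ((i + 1) mod length L)" using nth_eq_iff_index_eq[OF L(1) i i'] by simp
    moreover have "L ! i \<in> T" "L ! ((i + 1) mod length L) \<in> T"
      using nth_mem[OF i] nth_mem[OF i'] L(3) by auto
    ultimately show ?thesis using w by (auto simp: adj_def)
  qed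
  moreover have "mset (map card L) = mset s"
  proof -
    have "mset (rotate1 xs) = mset xs" for xs :: "nat list" by (cases xs) auto
    then have "mset (rotate k xs) = mset xs" for k and xs :: "nat list"
      by (induction k) auto
    then show ?thesis using L(5) unfolding cyc_equiv_def by auto
  qed
  ultimately show ?thesis using that L s(1) by blast
qed

lemma tile_vertex: "P \<in> T \<Longrightarrow> u \<in> P \<Longrightarrow> u \<in> tverts T"
  by (auto simp: tverts_def)

lemma tile_card:
  assumes "P \<in> T" shows "card P \<in> {3,4,6,12}"
proof -
  have "P \<noteq> {}" using tile_regular[OF assms] by (auto simp: regular_polygon_def lessThan_empty_iff)
  then obtain u where u: "u \<in> P" by blast
  obtain L where L: "set L = {P \<in> T. u \<in> P}"
    "mset (map card L) = mset [3,4,6,4] \<or> mset (map card L) = mset [4,6,12]"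
    using vertex_cycle[OF tile_vertex[OF assms u]] by metis
  have "card P \<in> set (map card L)" using L(1) assms u by auto
  moreover have "set (map card L) \<subseteq> {3,4,6,12}"
  proof -
    have "set (map card L) = set [3,4,6,4] \<or> set (map card L) = set [4,6,12]"
      using L(2) by (metis set_mset_mset)
    then show ?thesis by auto
  qed
  ultimately show ?thesis by blast
qed

text \<open>The predecessor and the successor of \<open>P\<close> in the cycle at \<open>a\<close>
  are different tiles, so they lie across different edges of \<open>P\<close> at \<open>a\<close>.
  There are only two such edges, and \<open>{a, b}\<close> is one of them.\<close>

lemma edge_other_tile:
  assumes P: "P \<in> T" and e: "poly_edge P a b"
  obtains Q where "adj P Q a b"
proof -
  have a: "a \<in> P" using e by (auto simp: poly_edge_def)
  obtain L where L: "distinct L" "length L \<ge> 3" "set L = {P \<in> T. a \<in> P}"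
    "\<And>i. i < length L \<Longrightarrow> \<exists>w. adj (L ! i) (L ! ((i + 1) mod length L)) a w"
    using vertex_cycle[OF tile_vertex[OF P a]] by metis
  define n where "n = length L"
  have "P \<in> set L" using L(3) P a by simp
  then obtain i where i: "i < n" "L ! i = P" by (metis in_set_conv_nth n_def)
  define i' where "i' = (if i = 0 then n - 1 else i - 1)"
  define j where "j = (i + 1) mod n"
  have n: "n \<ge> 3" using L(2) by (simp add: n_def)
  have ii: "i' < n" "(i' + 1) mod n = i" using i n by (auto simp: i'_def)
  have jn: "j < n" using n by (simp add: j_def)
  have jj: "j \<noteq> i'"
    using i(1) n by (cases "i + 1 = n") (auto simp: i'_def j_def)
  obtain w where w: "adj P (L ! j) a w" using L(4)[of i] i by (auto simp: n_def j_def)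
  obtain w' where w': "adj (L ! i') P a w'" using L(4)[of i'] ii i by (auto simp: n_def)
  have "w \<noteq> w'"
  proof
    assume "w = w'"
    then have "L ! j = L ! i'" using adj_unique w w' adj_commute by metis
    then show False using nth_eq_iff_index_eq[OF L(1)] jj jn ii by (simp add: n_def)
  qed
  obtain h where h: "cyc_param P (card P) h" using cyc_param_regular[OF tile_regular[OF P]] .
  obtain k where k: "a = h k" using a h by (auto simp: cyc_param_def)
  have "b \<in> {h (k + 1), h (k - 1)}" "w \<in> {h (k + 1), h (k - 1)}" "w' \<in> {h (k + 1), h (k - 1)}"
    using cyc_param_nbr[OF h] k e w w' by (auto simp: adj_def)
  then have "b = w \<or> b = w'" using \<open>w \<noteq> w'\<close> by auto
  then show ?thesis using that w w' adj_commute by blast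
qed

text \<open>\<open>tedges\<close> forgets which tile an edge belongs to, and automorphisms are
  defined through \<open>tedges\<close>. Two tiles sharing both ends meet in a common edge, whose
  ends are the only corners of \<open>P\<close> on it.\<close>

lemma edge_in_tile:
  assumes "{a, b} \<in> tedges T" "P \<in> T" "a \<in> P" "b \<in> P"
  shows "poly_edge P a b"
proof -
  obtain Q where Q: "Q \<in> T" "poly_edge Q a b"
    using assms(1) unfolding tedges_def by (auto simp: doubleton_eq_iff poly_edge_sym)
  have ab: "a \<in> Q" "b \<in> Q" "a \<noteq> b" using Q by (auto simp: poly_edge_def)
  show ?thesis
  proof (cases "P = Q")
    case False
    have m: "a \<in> convex hull P \<inter> convex hull Q" "b \<in> convex hull P \<inter> convex hull Q"
      using assms ab by (auto simp: hull_inc)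
    obtain c d where cd: "poly_edge P c d" "convex hull P \<inter> convex hull Q = closed_segment c d"
    proof -
      have "\<not> (\<exists>v. convex hull P \<inter> convex hull Q = {v})" using m ab(3) by (metis singletonD)
      moreover have "convex hull P \<inter> convex hull Q \<noteq> {}" using m by blast
      ultimately show thesis using tile_meet[OF assms(2) Q(1) False] that by blast
    qed
    obtain e where e: "e \<bullet> c = e \<bullet> d" "\<And>x. x \<in> P \<Longrightarrow> e \<bullet> x = e \<bullet> c \<Longrightarrow> x = c \<or> x = d"
      using poly_edge_functional[OF tile_regular[OF assms(2)] cd(1)] by metis
    have "e \<bullet> x = e \<bullet> c" if x: "x \<in> closed_segment c d" for x
    proof -
      obtain u where "x = (1 - u) *\<^sub>R c + u *\<^sub>R d" using x by (auto simp: in_segment)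
      then show ?thesis using e(1) by (simp add: inner_add_right left_diff_distrib)
    qed
    then have "a = c \<or> a = d" "b = c \<or> b = d" using e(2) assms m cd(2) by blast+
    then show ?thesis using ab(3) cd(1) poly_edge_sym by metis
  qed (use Q in simp)
qed

subsection \<open>Connectedness and local finiteness\<close>

text \<open>The tiles have disjoint nonempty open interiors. Countability is what is available at
  this stage: local finiteness will rest on equal edge lengths, and these rest on
  connectedness.\<close>

lemma countable_tverts: "countable (tverts T)"
proof -
  let ?i = "\<lambda>P. interior (convex hull P)"
  have "inj_on ?i T"
    using tile_centroid_eq regular_polygon_centroid_interior tile_regular tile_disjoint
    by (metis (no_types, lifting) inj_onI)
  moreover have "countable (?i ` T)"
  proof (rule countable_disjoint_open_subsets)
    show "pairwise disjnt (?i ` T)"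
      unfolding pairwise_def disjnt_def using tile_disjoint by blast
  qed auto
  ultimately have "countable T" using countable_image_inj_on by blast
  then show ?thesis unfolding tverts_def
    using tile_finite by (metis countable_UN countable_finite image_ident)
qed

text \<open>Off the vertices a point of a tile lies in its interior or inside an edge, and there the
  tile across the edge completes the neighbourhood.\<close>

lemma adj_closed_nhd:
  assumes A: "A \<subseteq> T" "\<forall>P\<in>A. \<forall>Q a b. adj P Q a b \<longrightarrow> Q \<in> A"
    and x: "P \<in> A" "x \<in> convex hull P" "x \<notin> tverts T"
  shows "x \<in> interior (\<Union>Q\<in>A. convex hull Q)"
proof (cases "x \<in> interior (convex hull P)")
  case True
  then show ?thesis using interior_mono[of "convex hull P" "\<Union>Q\<in>A. convex hull Q"] x(1) by blast
next
  case False
  have P: "P \<in> T" using A x by blast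
  have "x \<notin> P" using x(3) tile_vertex[OF P] by blast
  then obtain a b where ab: "poly_edge P a b" "x \<in> open_segment a b"
    using frontier_point_on_edge[OF tile_regular[OF P] x(2) False] by blast
  obtain Q where Q: "adj P Q a b" using edge_other_tile[OF P ab(1)] .
  have QA: "Q \<in> A" using A(2) x(1) Q by blast
  have q: "regular_polygon Q" "poly_edge Q a b" using Q tile_regular by (auto simp: adj_def)
  obtain l where l: "l \<noteq> 0" "centroid P = midpoint a b + of_real l * (\<i> * (b - a))"
    using poly_edge_centroid[OF tile_regular[OF P] ab(1)] .
  obtain m where m: "m \<noteq> 0" "centroid Q = midpoint a b + of_real m * (\<i> * (b - a))"
    using poly_edge_centroid[OF q] .
  have "l * m < 0" using adj_opposite_sides[OF Q l(2) m(2)] l m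
    by (metis linorder_not_less mult_eq_0_iff order_le_less)
  then have "x \<in> interior (convex hull P \<union> convex hull Q)"
    using opposite_sides_interior[OF tile_regular[OF P] ab(1) l(2) q m(2) _ ab(2)] by blast
  moreover have "convex hull P \<union> convex hull Q \<subseteq> (\<Union>Q\<in>A. convex hull Q)" using x(1) QA by blast
  ultimately show ?thesis using interior_mono by blast
qed

text \<open>The vertices form a countable set, so the plane without them is still connected; there two
  tiles can only meet along a common edge.\<close>

lemma tiles_connected:
  assumes A: "A \<subseteq> T" "A \<noteq> {}" "\<And>P Q a b. P \<in> A \<Longrightarrow> adj P Q a b \<Longrightarrow> Q \<in> A"
  shows "A = T"
proof (rule ccontr)
  assume "A \<noteq> T"
  then obtain R where R: "R \<in> T - A" using A by blast
  let ?U = "\<lambda>B. interior (\<Union>Q\<in>B. convex hull Q)"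
  let ?X = "- tverts T"
  have con: "connected ?X"
    by (intro path_connected_imp_connected path_connected_complement_countable countable_tverts) simp
  have B: "\<forall>P\<in>T - A. \<forall>Q a b. adj P Q a b \<longrightarrow> Q \<in> T - A"
    using A(3) adj_commute unfolding adj_def by blast
  have A': "\<forall>P\<in>A. \<forall>Q a b. adj P Q a b \<longrightarrow> Q \<in> A" using A(3) by blast
  have nA: "x \<in> ?U A" if "P \<in> A" "x \<in> convex hull P" "x \<in> ?X" for x P
    using adj_closed_nhd[OF A(1) A'] that by blast
  have nB: "x \<in> ?U (T - A)" if "P \<in> T - A" "x \<in> convex hull P" "x \<in> ?X" for x P
    using adj_closed_nhd[OF _ B] that by blast
  have cover: "?X \<subseteq> ?U A \<union> ?U (T - A)"
  proof
    fix x assume x: "x \<in> ?X"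
    obtain P where "P \<in> T" "x \<in> convex hull P" using tiles_cover by blast
    then show "x \<in> ?U A \<union> ?U (T - A)" using nA nB x by blast
  qed
  have disj: "?U A \<inter> ?U (T - A) \<inter> ?X = {}"
  proof (rule ccontr)
    assume "\<not> ?thesis"
    then obtain x where x: "x \<in> ?U A" "x \<in> ?U (T - A)" "x \<in> ?X" by blast
    then obtain P Q where PQ: "P \<in> A" "x \<in> convex hull P" "Q \<in> T - A" "x \<in> convex hull Q"
      using interior_subset[of "\<Union>Q\<in>A. convex hull Q"] interior_subset[of "\<Union>Q\<in>T - A. convex hull Q"]
      by blast
    have "P \<noteq> Q" "P \<in> T" "Q \<in> T" using PQ A by auto
    have "x \<notin> P" using x(3) PQ A by (auto simp: tverts_def)
    moreover have x2: "x \<in> convex hull P \<inter> convex hull Q" using PQ by blast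
    ultimately have "\<not> (\<exists>v. v \<in> P \<and> v \<in> Q \<and> convex hull P \<inter> convex hull Q = {v})"
      by (metis singletonD)
    then obtain a b where "poly_edge P a b" "poly_edge Q a b"
      using tile_meet[OF \<open>P \<in> T\<close> \<open>Q \<in> T\<close> \<open>P \<noteq> Q\<close>] x2 by blast
    then show False using A(3)[OF PQ(1)] PQ(3) \<open>P \<noteq> Q\<close> \<open>P \<in> T\<close> unfolding adj_def by blast
  qed
  \<comment> \<open>The interior of a tile is uncountable, so the vertices do not exhaust
    it.\<close>
  have meets: "?U C \<inter> ?X \<noteq> {}" if PC: "P \<in> C" "C \<subseteq> T" for P C
  proof -
    have "centroid P \<in> interior (convex hull P)"
      using regular_polygon_centroid_interior tile_regular PC by blast
    then obtain r where "r > 0" "ball (centroid P) r \<subseteq> interior (convex hull P)"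
      using open_contains_ball open_interior by metis
    then have "\<not> countable (interior (convex hull P))"
      using uncountable_ball countable_subset by metis
    then have "\<not> interior (convex hull P) \<subseteq> tverts T"
      using countable_tverts countable_subset by metis
    then obtain x where "x \<in> interior (convex hull P)" "x \<notin> tverts T" by blast
    moreover have "interior (convex hull P) \<subseteq> ?U C" using PC by (intro interior_mono) blast
    ultimately show ?thesis by blast
  qed
  show False
  proof -
    obtain P where "P \<in> A" using A(2) by blast
    then have "?U A \<inter> ?X \<noteq> {}" using meets A(1) by simp
    moreover have "?U (T - A) \<inter> ?X \<noteq> {}" using meets[OF R] by blast
    ultimately show False using connectedD[OF con open_interior open_interior disj cover] by blast
  qed
qed

section \<open>Congruent tiles and local finiteness\<close>

lemma equal_edges:
  obtains s where "s > 0" "\<And>P a b. P \<in> T \<Longrightarrow> poly_edge P a b \<Longrightarrow> dist a b = s"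
proof -
  obtain P where P: "P \<in> T" using tiles_cover by blast
  have one: "\<exists>s. \<forall>a b. poly_edge Q a b \<longrightarrow> dist a b = s" if Q: "Q \<in> T" for Q
    using regular_polygonD[OF tile_regular[OF Q]] dist_poly_edge_ngon by metis
  obtain h where h: "cyc_param P (card P) h" using cyc_param_regular[OF tile_regular[OF P]] .
  define s where "s = dist (h 0) (h (0 + 1))"
  have e0: "poly_edge P (h 0) (h (0 + 1))" using cyc_param_step[OF h] .
  have "s > 0" using e0 by (auto simp: s_def poly_edge_def)
  let ?A = "{Q \<in> T. \<forall>a b. poly_edge Q a b \<longrightarrow> dist a b = s}"
  have "?A = T"
  proof (rule tiles_connected)
    show "?A \<noteq> {}" using one[OF P] e0 P s_def by force
    show "R \<in> ?A" if "Q \<in> ?A" "adj Q R a b" for Q R a b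
      using that one[of R] unfolding adj_def by force
  qed auto
  then show ?thesis using that[OF \<open>s > 0\<close>] by blast
qed

lemma same_card_ngons:
  assumes P: "P \<in> T" and Q: "Q \<in> T" and c: "card P = card Q"
  obtains n c w c' w' where "n \<ge> 3" "w \<noteq> 0" "norm w = norm w'"
    "P = range (ngon n c w)" "Q = range (ngon n c' w')"
proof -
  obtain s where s: "s > 0" "\<And>P a b. P \<in> T \<Longrightarrow> poly_edge P a b \<Longrightarrow> dist a b = s"
    using equal_edges by blast
  obtain n c w where n: "n \<ge> 3" and w: "w \<noteq> 0" and P': "P = range (ngon n c w)"
    using regular_polygonD[OF tile_regular[OF P]] .
  obtain n' c' w' where n': "n' \<ge> 3" and w': "w' \<noteq> 0" and Q': "Q = range (ngon n' c' w')"
    using regular_polygonD[OF tile_regular[OF Q]] .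
  have nn: "n' = n" using c card_ngon[of n w c] card_ngon[of n' w' c'] n n' w w' P' Q' by simp
  have cp: "cyc_param P n (ngon n c w)" using cyc_param_ngon[OF n w] P' by simp
  have cq: "cyc_param Q n (ngon n c' w')" using cyc_param_ngon[OF n' w'] Q' nn by simp
  have "norm w * norm (cis (2 * pi / n) - 1) = s" "norm w' * norm (cis (2 * pi / n) - 1) = s"
    using ngon_edge_length[of n c w 0] ngon_edge_length[of n c' w' 0]
      s(2)[OF P cyc_param_step[OF cp, of 0]] s(2)[OF Q cyc_param_step[OF cq, of 0]] by auto
  then have "norm w = norm w'" using cis_step_ne[OF n] by (metis mult_right_cancel)
  then show ?thesis using that[OF n w _ P'] Q' nn by blast
qed

lemma tiles_congruent:
  assumes "P \<in> T" "Q \<in> T" "card P = card Q"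
  obtains f where "isom f" "f ` P = Q"
proof -
  obtain n c w c' w' where n: "n \<ge> 3" and w: "w \<noteq> 0" "norm w = norm w'"
    and PQ: "P = range (ngon n c w)" "Q = range (ngon n c' w')"
    using same_card_ngons[OF assms] by metis
  obtain f where f: "isom f" "\<And>k. f (ngon n c w k) = ngon n c' w' (0 + 1 * k)"
    using ngon_isom[OF n w, of 1 c c' 0] by blast
  then have "f ` P = Q" unfolding PQ by (auto simp: image_iff)
  then show ?thesis using that f by blast
qed

text \<open>Such a map acts on corner indices by \<open>j + e * k\<close> (\<open>dihedral\<close>),
  and each index map of this form comes from an isometry between polygons of equal radius
  (\<open>ngon_isom\<close>).\<close>

lemma isom_of_edge_map:
  assumes PQ: "P \<in> T" "Q \<in> T" "card P = card Q"
    and g: "\<And>a b. poly_edge P a b \<Longrightarrow> poly_edge Q (g a) (g b)" "inj_on g P"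
  obtains f where "isom f" "\<And>x. x \<in> P \<Longrightarrow> f x = g x"
proof -
  obtain n c w c' w' where n: "n \<ge> 3" and w: "w \<noteq> 0" "norm w = norm w'"
    and PQ: "P = range (ngon n c w)" "Q = range (ngon n c' w')"
    using same_card_ngons[OF PQ] by metis
  have "w' \<noteq> 0" using w by auto
  then have cp: "cyc_param P n (ngon n c w)" and cq: "cyc_param Q n (ngon n c' w')"
    using cyc_param_ngon[OF n] w PQ by auto
  obtain j e where e: "e = 1 \<or> e = - (1::int)" "\<And>k. g (ngon n c w k) = ngon n c' w' (j + e * k)"
    using dihedral[OF cp cq g(2,1)] by metis
  obtain f where "isom f" "\<And>k. f (ngon n c w k) = ngon n c' w' (j + e * k)"
    using ngon_isom[OF n w e(1), of c c' j] by metis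
  then show ?thesis using that e(2) PQ by (metis rangeE)
qed

text \<open>Up to congruence there are at most four tiles, so one radius for each size
  suffices.\<close>

lemma uniform_inradius:
  obtains r where "r > 0" "\<And>P. P \<in> T \<Longrightarrow> ball (centroid P) r \<subseteq> interior (convex hull P)"
proof -
  have ex: "\<exists>r>0. \<forall>P\<in>T. card P = n \<longrightarrow> ball (centroid P) r \<subseteq> convex hull P" for n
  proof (cases "\<exists>P\<in>T. card P = n")
    case True
    then obtain P where P: "P \<in> T" "card P = n" by blast
    have ne: "P \<noteq> {}" using tile_card[OF P(1)] by auto
    obtain r where r: "r > 0" "ball (centroid P) r \<subseteq> convex hull P"
      using regular_polygon_centroid_interior[OF tile_regular[OF P(1)]] mem_interior by blast
    have "ball (centroid Q) r \<subseteq> convex hull Q" if Q: "Q \<in> T" "card Q = n" for Q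
    proof
      fix y assume y: "y \<in> ball (centroid Q) r"
      obtain f where f: "isom f" "f ` P = Q" using tiles_congruent[of P Q] P Q by auto
      obtain x where x: "y = f x" using isom_surj[OF f(1)] by (metis surjD)
      have "centroid Q = f (centroid P)" using isom_centroid[OF f(1) tile_finite[OF P(1)] ne] f(2) by simp
      then have "dist (centroid P) x < r" using y x f(1) by (simp add: isom_def)
      then have "x \<in> convex hull P" using r(2) by auto
      then show "y \<in> convex hull Q" using isom_convex_hull[OF f(1), of P] f(2) x by blast
    qed
    then show ?thesis using r(1) by blast
  next
    case False
    \<comment> \<open>No tile has \<open>n\<close> corners, so any positive radius will do.\<close>
    then show ?thesis by (intro exI[of _ 1]) auto
  qed
  obtain r3 where r3: "r3 > 0" "\<And>P. P\<in>T \<Longrightarrow> card P = 3 \<Longrightarrow> ball (centroid P) r3 \<subseteq> convex hull P"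
    using ex[of 3] by blast
  obtain r4 where r4: "r4 > 0" "\<And>P. P\<in>T \<Longrightarrow> card P = 4 \<Longrightarrow> ball (centroid P) r4 \<subseteq> convex hull P"
    using ex[of 4] by blast
  obtain r6 where r6: "r6 > 0" "\<And>P. P\<in>T \<Longrightarrow> card P = 6 \<Longrightarrow> ball (centroid P) r6 \<subseteq> convex hull P"
    using ex[of 6] by blast
  obtain r12 where r12: "r12 > 0" "\<And>P. P\<in>T \<Longrightarrow> card P = 12 \<Longrightarrow> ball (centroid P) r12 \<subseteq> convex hull P"
    using ex[of 12] by blast
  define r where "r = min (min r3 r4) (min r6 r12)"
  have r: "r > 0" "r \<le> r3" "r \<le> r4" "r \<le> r6" "r \<le> r12" using r3 r4 r6 r12 by (auto simp: r_def)
  have "ball (centroid P) r \<subseteq> interior (convex hull P)" if P: "P \<in> T" for P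
  proof -
    have "\<exists>s\<ge>r. ball (centroid P) s \<subseteq> convex hull P"
      using tile_card[OF P] r r3(2)[OF P] r4(2)[OF P] r6(2)[OF P] r12(2)[OF P] by blast
    then obtain s where "r \<le> s" "ball (centroid P) s \<subseteq> convex hull P" by blast
    then have "ball (centroid P) r \<subseteq> convex hull P" using subset_ball by blast
    then show ?thesis by (simp add: interior_maximal)
  qed
  then show ?thesis using that r(1) by blast
qed

lemma uniform_circumradius:
  obtains R where "\<And>P x. P \<in> T \<Longrightarrow> x \<in> convex hull P \<Longrightarrow> dist (centroid P) x \<le> R"
proof -
  have ex: "\<exists>R. \<forall>P\<in>T. card P = n \<longrightarrow> (\<forall>x\<in>convex hull P. dist (centroid P) x \<le> R)" for n
  proof (cases "\<exists>P\<in>T. card P = n")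
    case True
    then obtain P where P: "P \<in> T" "card P = n" by blast
    have ne: "P \<noteq> {}" using tile_card[OF P(1)] by auto
    have "bounded (convex hull P)"
      using tile_finite[OF P(1)] by (simp add: bounded_convex_hull finite_imp_bounded)
    then obtain R where R: "\<And>x. x \<in> convex hull P \<Longrightarrow> dist (centroid P) x \<le> R"
      using bounded_any_center[of "convex hull P" "centroid P"] by blast
    have "dist (centroid Q) y \<le> R" if Q: "Q \<in> T" "card Q = n" "y \<in> convex hull Q" for Q y
    proof -
      obtain f where f: "isom f" "f ` P = Q" using tiles_congruent[of P Q] P Q by auto
      obtain x where x: "y = f x" "x \<in> convex hull P"
        using isom_convex_hull[OF f(1), of P] f(2) Q(3) by auto
      have "centroid Q = f (centroid P)" using isom_centroid[OF f(1) tile_finite[OF P(1)] ne] f(2) by simp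
      then show ?thesis using x f(1) R by (simp add: isom_def)
    qed
    then show ?thesis by blast
  next
    case False
    then show ?thesis by auto
  qed
  obtain R3 where R3: "\<And>P x. P\<in>T \<Longrightarrow> card P = 3 \<Longrightarrow> x\<in>convex hull P \<Longrightarrow> dist (centroid P) x \<le> R3"
    using ex[of 3] by blast
  obtain R4 where R4: "\<And>P x. P\<in>T \<Longrightarrow> card P = 4 \<Longrightarrow> x\<in>convex hull P \<Longrightarrow> dist (centroid P) x \<le> R4"
    using ex[of 4] by blast
  obtain R6 where R6: "\<And>P x. P\<in>T \<Longrightarrow> card P = 6 \<Longrightarrow> x\<in>convex hull P \<Longrightarrow> dist (centroid P) x \<le> R6"
    using ex[of 6] by blast
  obtain R12 where R12: "\<And>P x. P\<in>T \<Longrightarrow> card P = 12 \<Longrightarrow> x\<in>convex hull P \<Longrightarrow> dist (centroid P) x \<le> R12"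
    using ex[of 12] by blast
  have "dist (centroid P) x \<le> max (max R3 R4) (max R6 R12)"
    if P: "P \<in> T" "x \<in> convex hull P" for P x
    using tile_card[OF P(1)] R3[OF P(1) _ P(2)] R4[OF P(1) _ P(2)] R6[OF P(1) _ P(2)] R12[OF P(1) _ P(2)]
    by (auto simp: le_max_iff_disj)
  then show ?thesis using that by blast
qed

text \<open>Distinct centroids are at least the uniform inradius apart, and a bounded uniformly
  discrete set is finite.\<close>

lemma locally_finite:
  assumes "bounded B"
  shows "finite {P \<in> T. convex hull P \<inter> B \<noteq> {}}"
proof -
  obtain r where r: "r > 0" "\<And>P. P \<in> T \<Longrightarrow> ball (centroid P) r \<subseteq> interior (convex hull P)"
    using uniform_inradius by blast
  obtain R where R: "\<And>P x. P \<in> T \<Longrightarrow> x \<in> convex hull P \<Longrightarrow> dist (centroid P) x \<le> R"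
    using uniform_circumradius by blast
  let ?N = "{P \<in> T. convex hull P \<inter> B \<noteq> {}}"
  obtain M where M: "\<And>x. x \<in> B \<Longrightarrow> norm x \<le> M" using assms bounded_iff by blast
  have "bounded (centroid ` ?N)"
  proof -
    have "norm (centroid P) \<le> R + M" if P: "P \<in> ?N" for P
    proof -
      obtain x where x: "x \<in> convex hull P" "x \<in> B" using P by blast
      have "norm (centroid P) \<le> dist (centroid P) x + norm x"
        by (metis dist_norm norm_triangle_sub add.commute)
      then show ?thesis using R[of P x] M[OF x(2)] x P by force
    qed
    then show ?thesis by (auto simp: bounded_iff)
  qed
  moreover have "uniform_discrete (centroid ` ?N)"
    unfolding uniform_discrete_def
  proof (intro exI[of _ r] conjI ballI impI r(1))
    fix x y assume "x \<in> centroid ` ?N" "y \<in> centroid ` ?N" and d: "dist x y < r"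
    then obtain P Q where PQ: "P \<in> T" "Q \<in> T" "x = centroid P" "y = centroid Q" by blast
    have "y \<in> interior (convex hull P)" using r(2)[OF PQ(1)] d PQ by auto
    then have "P = Q"
      using tile_disjoint PQ regular_polygon_centroid_interior tile_regular by blast
    then show "x = y" using PQ by simp
  qed
  ultimately have "finite (centroid ` ?N)" using uniform_discrete_finite_iff by blast
  moreover have "inj_on centroid ?N" using tile_centroid_eq by (auto intro: inj_onI)
  ultimately show ?thesis using finite_imageD by blast
qed

subsection \<open>Combinatorial automorphisms are isometries\<close>

abbreviation aut :: "(complex \<Rightarrow> complex) \<Rightarrow> bool" where
  "aut \<equiv> map_aut (tverts T) (tedges T) T"

lemma tile_subset: "P \<in> T \<Longrightarrow> P \<subseteq> tverts T"
  by (auto simp: tverts_def)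

lemma aut_inj: "aut \<phi> \<Longrightarrow> inj_on \<phi> (tverts T)"
  by (auto simp: map_aut_def bij_betw_def)

lemma aut_tile: "aut \<phi> \<Longrightarrow> P \<in> T \<Longrightarrow> \<phi> ` P \<in> T"
  using tile_subset unfolding map_aut_def by blast

lemma aut_card: "aut \<phi> \<Longrightarrow> P \<in> T \<Longrightarrow> card (\<phi> ` P) = card P"
  using aut_inj tile_subset by (meson card_image inj_on_subset)

lemma aut_tile_inj: "aut \<phi> \<Longrightarrow> P \<in> T \<Longrightarrow> Q \<in> T \<Longrightarrow> \<phi> ` P = \<phi> ` Q \<Longrightarrow> P = Q"
  using aut_inj tile_subset inj_on_image_eq_iff by metis

lemma aut_edge:
  assumes "aut \<phi>" "P \<in> T" "poly_edge P a b"
  shows "poly_edge (\<phi> ` P) (\<phi> a) (\<phi> b)"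
proof -
  have ab: "a \<in> P" "b \<in> P" using assms(3) by (auto simp: poly_edge_def)
  have "{a, b} \<in> tedges T" using assms by (auto simp: tedges_def)
  moreover have "{a, b} \<subseteq> tverts T" using ab tile_subset[OF assms(2)] by blast
  ultimately have "\<phi> ` {a, b} \<in> tedges T" using assms(1) unfolding map_aut_def by blast
  then have "{\<phi> a, \<phi> b} \<in> tedges T" by simp
  then show ?thesis using edge_in_tile aut_tile[OF assms(1,2)] ab by blast
qed

lemma aut_adj:
  assumes "aut \<phi>" "adj P Q a b" shows "adj (\<phi> ` P) (\<phi> ` Q) (\<phi> a) (\<phi> b)"
  using assms aut_edge aut_tile aut_tile_inj unfolding adj_def by metis

lemma aut_local_isom:
  assumes "aut \<phi>" "P \<in> T"
  obtains f where "isom f" "\<And>x. x \<in> P \<Longrightarrow> f x = \<phi> x"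
proof (rule isom_of_edge_map[OF assms(2) aut_tile[OF assms]])
  show "inj_on \<phi> P" using aut_inj[OF assms(1)] tile_subset[OF assms(2)] by (rule inj_on_subset)
qed (use aut_card[OF assms] aut_edge[OF assms] that in auto)

text \<open>Two tiles lie on opposite sides of a common edge, and so do their images; hence the
  isometries which realise an automorphism on two adjacent tiles cannot differ by a reflection.\<close>

lemma aut_adj_same_isom:
  assumes \<phi>: "aut \<phi>" and adj: "adj P Q a b"
    and f: "isom f" "\<And>x. x \<in> P \<Longrightarrow> f x = \<phi> x" and g: "isom g" "\<And>x. x \<in> Q \<Longrightarrow> g x = \<phi> x"
  shows "f = g"
proof (rule ccontr)
  assume ne: "f \<noteq> g"
  have PQ: "P \<in> T" "Q \<in> T" "poly_edge P a b" "poly_edge Q a b" using adj by (auto simp: adj_def)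
  have ab: "a \<in> P" "a \<in> Q" "b \<in> P" "b \<in> Q" "a \<noteq> b" using PQ by (auto simp: poly_edge_def)
  have nP: "finite P" "P \<noteq> {}" "finite Q" "Q \<noteq> {}" using tile_finite PQ ab by auto
  obtain l where l: "l \<noteq> 0" "centroid P = midpoint a b + of_real l * (\<i> * (b - a))"
    using poly_edge_centroid[OF tile_regular[OF PQ(1)] PQ(3)] .
  obtain m where m: "m \<noteq> 0" "centroid Q = midpoint a b + of_real m * (\<i> * (b - a))"
    using poly_edge_centroid[OF tile_regular[OF PQ(2)] PQ(4)] .
  have fa: "f a = \<phi> a" "f b = \<phi> b" "g a = \<phi> a" "g b = \<phi> b" using ab f g by auto
  obtain \<sigma> :: real where s: "\<sigma> = 1 \<or> \<sigma> = - 1"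
    "f (centroid P) = midpoint (\<phi> a) (\<phi> b) + of_real (\<sigma> * l) * (\<i> * (\<phi> b - \<phi> a))"
    "g (centroid Q) = midpoint (\<phi> a) (\<phi> b) - of_real (\<sigma> * m) * (\<i> * (\<phi> b - \<phi> a))"
    using isom_agree_cases[OF f(1) g(1), of a b] ne ab(5) unfolding fa l(2) m(2) by metis
  have im: "f ` P = \<phi> ` P" "g ` Q = \<phi> ` Q" using f g by (simp_all cong: image_cong)
  have 1: "centroid (\<phi> ` P) = midpoint (\<phi> a) (\<phi> b) + of_real (\<sigma> * l) * (\<i> * (\<phi> b - \<phi> a))"
    using isom_centroid[OF f(1) nP(1,2)] im s(2) by simp
  have 2: "centroid (\<phi> ` Q) = midpoint (\<phi> a) (\<phi> b) + of_real (- \<sigma> * m) * (\<i> * (\<phi> b - \<phi> a))"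
    using isom_centroid[OF g(1) nP(3,4)] im s(3) by simp
  have "(\<sigma> * l) * (- \<sigma> * m) \<le> 0" using adj_opposite_sides[OF aut_adj[OF \<phi> adj] 1 2] .
  then have "l * m \<ge> 0" using s(1) by auto
  moreover have "l * m \<le> 0" using adj_opposite_sides[OF adj l(2) m(2)] .
  ultimately show False using l m by auto
qed

lemma aut_isom:
  assumes \<phi>: "aut \<phi>"
  obtains f where "isom f" "\<And>v. v \<in> tverts T \<Longrightarrow> \<phi> v = f v"
proof -
  obtain P where P: "P \<in> T" using tiles_cover by blast
  obtain f where f: "isom f" "\<And>x. x \<in> P \<Longrightarrow> f x = \<phi> x" using aut_local_isom[OF \<phi> P] by blast
  let ?A = "{Q \<in> T. \<forall>x\<in>Q. f x = \<phi> x}"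
  have "?A = T"
  proof (rule tiles_connected)
    show "?A \<noteq> {}" using P f by blast
    show "R \<in> ?A" if Q: "Q \<in> ?A" and adj: "adj Q R a b" for Q R a b
    proof -
      have R: "R \<in> T" using adj by (simp add: adj_def)
      obtain g where g: "isom g" "\<And>x. x \<in> R \<Longrightarrow> g x = \<phi> x" using aut_local_isom[OF \<phi> R] by blast
      have "f = g" using aut_adj_same_isom[OF \<phi> adj f(1) _ g] Q by blast
      then show ?thesis using g R by simp
    qed
  qed auto
  then have "\<forall>Q\<in>T. \<forall>x\<in>Q. f x = \<phi> x" by blast
  then have "\<phi> v = f v" if "v \<in> tverts T" for v using that unfolding tverts_def by auto
  then show ?thesis using that f(1) by blast
qed

text \<open>A fixed point lies in \<open>P\<close> and in its image. If these differ and no corner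
  is fixed, it lies inside a common edge, and that edge turns out to be its own image.\<close>

lemma cellular_fixed_point:
  assumes P: "P \<in> T" "g ` P \<in> T" and x: "x \<in> convex hull P" "F x = x"
    and F: "F ` (convex hull P) = convex hull (g ` P)"
      "\<And>a. a \<in> P \<Longrightarrow> F a = g a"
      "\<And>a b. poly_edge P a b \<Longrightarrow> F ` closed_segment a b = closed_segment (g a) (g b)"
    and g: "\<And>a b. poly_edge P a b \<Longrightarrow> poly_edge (g ` P) (g a) (g b)"
  shows "g ` P = P \<or> (\<exists>v\<in>P. g v = v) \<or> (\<exists>a b. poly_edge P a b \<and> g ` {a, b} = {a, b})"
proof (rule ccontr)
  assume n: "\<not> ?thesis"
  have xP: "x \<notin> P" using n F(2) x(2) by auto
  have "x \<in> convex hull (g ` P)" using x F(1) by (metis imageI)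
  then have m: "x \<in> convex hull P \<inter> convex hull (g ` P)" using x by blast
  then have "\<not> (\<exists>v. v \<in> P \<and> v \<in> g ` P \<and> convex hull P \<inter> convex hull (g ` P) = {v})"
    using xP by (metis singletonD)
  then obtain c d where cd: "poly_edge P c d" "poly_edge (g ` P) c d" "x \<in> closed_segment c d"
    using tile_meet[OF P] n m by (metis empty_iff)
  have cdP: "c \<in> P" "d \<in> P" "c \<in> g ` P" "d \<in> g ` P" "c \<noteq> d" using cd by (auto simp: poly_edge_def)
  obtain t where t: "0 < t" "t < 1" "x = (1 - t) *\<^sub>R c + t *\<^sub>R d"
    using cd(3) xP cdP by (metis in_segment(2) open_segment_def DiffI empty_iff insert_iff)
  have "x \<in> closed_segment (g c) (g d)" using F(3)[OF cd(1)] cd(3) x(2) by (metis imageI)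
  then obtain s where s: "x = (1 - s) *\<^sub>R g c + s *\<^sub>R g d" by (auto simp: in_segment)
  obtain e where e: "e \<bullet> g c = e \<bullet> g d" "\<And>x. x \<in> convex hull (g ` P) \<Longrightarrow> e \<bullet> g c \<le> e \<bullet> x"
    "\<And>x. x \<in> g ` P \<Longrightarrow> e \<bullet> x = e \<bullet> g c \<Longrightarrow> x = g c \<or> x = g d"
    using poly_edge_functional[OF tile_regular[OF P(2)] g[OF cd(1)]] by metis
  \<comment> \<open>Over the image tile \<open>e\<close> is minimal at \<open>x\<close>, which lies
    strictly between \<open>c\<close> and \<open>d\<close>; so both ends attain the minimum, which
    happens only at \<open>g c\<close> and \<open>g d\<close>.\<close>
  have ex: "e \<bullet> x = e \<bullet> g c" using e(1) by (simp add: s inner_add_right left_diff_distrib)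
  have "e \<bullet> c \<ge> e \<bullet> g c" "e \<bullet> d \<ge> e \<bullet> g c" using e(2) hull_inc cdP by metis+
  moreover have "(1 - t) * (e \<bullet> c - e \<bullet> g c) + t * (e \<bullet> d - e \<bullet> g c) = 0"
    using ex t(3) by (simp add: inner_add_right algebra_simps)
  ultimately have "e \<bullet> c = e \<bullet> g c" "e \<bullet> d = e \<bullet> g c"
    using t(1,2) by (simp_all add: add_nonneg_eq_0_iff)
  then have "c = g c \<or> c = g d" "d = g c \<or> d = g d" using e(3) cdP by blast+
  then have "g ` {c, d} = {c, d}" using cdP(5) by auto
  then show False using n cd(1) by blast
qed

end

subsection \<open>The symmetry group\<close>

locale two_uniform_3464_4612 = tiling_3464_4612 +
  assumes two_orbits: "card ((\<lambda>v. {f v | f. f \<in> tiling_sym T}) ` tverts T) = 2"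
begin

abbreviation "G \<equiv> tiling_sym T"

lemma G_isom: "f \<in> G \<Longrightarrow> isom f"
  by (simp add: tiling_sym_def isom_def)

lemma G_tile: "f \<in> G \<Longrightarrow> P \<in> T \<Longrightarrow> f ` P \<in> T"
  by (auto simp: tiling_sym_def)

lemma id_G: "id \<in> G"
  by (simp add: tiling_sym_def)

lemma G_comp: "f \<in> G \<Longrightarrow> g \<in> G \<Longrightarrow> f \<circ> g \<in> G"
proof -
  assume f: "f \<in> G" and g: "g \<in> G"
  have "(\<lambda>P. (f \<circ> g) ` P) ` T = (\<lambda>P. f ` P) ` ((\<lambda>P. g ` P) ` T)"
    by (simp add: image_image image_comp)
  then have "(\<lambda>P. (f \<circ> g) ` P) ` T = T" using f g by (simp add: tiling_sym_def)
  then show ?thesis using f g by (simp add: tiling_sym_def)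
qed

lemma G_inv: "f \<in> G \<Longrightarrow> inv f \<in> G"
proof -
  assume f: "f \<in> G"
  have b: "bij f" using isom_bij[OF G_isom[OF f]] .
  have "(\<lambda>P. inv f ` P) ` ((\<lambda>P. f ` P) ` T) = T"
    using b by (simp add: image_image image_comp bij_is_inj)
  then have "(\<lambda>P. inv f ` P) ` T = T" using f by (simp add: tiling_sym_def)
  then show ?thesis using isom_inv[OF G_isom[OF f]] by (simp add: tiling_sym_def isom_def)
qed

lemma G_inj: "f \<in> G \<Longrightarrow> inj_on f A"
  using isom_inj[OF G_isom] by (metis inj_on_subset subset_UNIV)

lemma G_card: "f \<in> G \<Longrightarrow> card (f ` P) = card P"
  using G_inj card_image by blast

lemma G_edge: "f \<in> G \<Longrightarrow> P \<in> T \<Longrightarrow> poly_edge P a b \<Longrightarrow> poly_edge (f ` P) (f a) (f b)"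
  using isom_poly_edge G_isom tile_finite by blast

lemma G_adj: "f \<in> G \<Longrightarrow> adj P Q a b \<Longrightarrow> adj (f ` P) (f ` Q) (f a) (f b)"
  unfolding adj_def using G_tile G_edge G_inj[of f UNIV] by (simp add: inj_image_eq_iff)

lemma G_vertex: "f \<in> G \<Longrightarrow> v \<in> tverts T \<Longrightarrow> f v \<in> tverts T"
  using G_tile unfolding tverts_def by blast

subsection \<open>The two kinds of vertices\<close>

text \<open>The vertices of type 4.6.12, recognised by their dodecagon; in this form invariance
  under symmetries is immediate.\<close>

definition Z :: "complex set" where
  "Z = {v. \<exists>P\<in>T. card P = 12 \<and> v \<in> P}"

lemma ZI: "P \<in> T \<Longrightarrow> card P = 12 \<Longrightarrow> v \<in> P \<Longrightarrow> v \<in> Z"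
  by (auto simp: Z_def)

lemma Z_vertex: "v \<in> Z \<Longrightarrow> v \<in> tverts T"
  by (auto simp: Z_def tverts_def)

lemma G_Z: assumes f: "f \<in> G" shows "f v \<in> Z \<longleftrightarrow> v \<in> Z"
proof -
  have 1: "g v \<in> Z" if g: "g \<in> G" and v: "v \<in> Z" for g v
  proof -
    obtain P where "P \<in> T" "card P = 12" "v \<in> P" using v by (auto simp: Z_def)
    then show ?thesis using ZI[of "g ` P"] G_tile[OF g] G_card[OF g] by simp
  qed
  have "inv f (f v) = v" using isom_inj[OF G_isom[OF f]] by simp
  then show ?thesis using 1[OF f] 1[OF G_inv[OF f]] by metis
qed

lemma has_vertex_type_cards:
  assumes "has_vertex_type T u s"
  shows "card ` {P \<in> T. u \<in> P} = set s"
proof -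
  obtain L where L: "set L = {P \<in> T. u \<in> P}" "cyc_equiv (map card L) s"
    using assms unfolding has_vertex_type_def by blast
  have "set s = set (map card L)" using L(2) by (auto simp: cyc_equiv_def)
  then show ?thesis using L(1) by simp
qed

lemma exists_Z: "\<exists>v. v \<in> Z"
proof -
  obtain u where "u \<in> tverts T" "has_vertex_type T u [4,6,12]"
    using types unfolding vertex_types_def by blast
  then have "12 \<in> card ` {P \<in> T. u \<in> P}" using has_vertex_type_cards by simp
  then obtain P where "P \<in> T" "card P = 12" "u \<in> P" by auto
  then show ?thesis using ZI by blast
qed

lemma exists_W: "\<exists>v\<in>tverts T. v \<notin> Z"
proof -
  obtain u where u: "u \<in> tverts T" "has_vertex_type T u [3,4,6,4]"
    using types unfolding vertex_types_def by blast
  then have "12 \<notin> card ` {P \<in> T. u \<in> P}" using has_vertex_type_cards by simp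
  then have "u \<notin> Z" by (auto simp: Z_def)
  then show ?thesis using u(1) by blast
qed

text \<open>\<open>Z\<close> and its complement among the vertices are invariant and nonempty; with
  just two orbits in all, each of them is a single orbit.\<close>

lemma G_transitive:
  assumes "u \<in> tverts T" "v \<in> tverts T" "u \<in> Z \<longleftrightarrow> v \<in> Z"
  obtains f where "f \<in> G" "f u = v"
proof -
  define orb where "orb v = {f v | f. f \<in> G}" for v
  have self: "v \<in> orb v" for v unfolding orb_def using id_G by (metis (mono_tags, lifting) id_apply mem_Collect_eq)
  have inZ: "x \<in> Z \<longleftrightarrow> v \<in> Z" if "x \<in> orb v" for x v using that G_Z by (auto simp: orb_def)
  obtain z where z: "z \<in> Z" using exists_Z by blast
  obtain w where w: "w \<in> tverts T" "w \<notin> Z" using exists_W by blast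
  have ne: "orb z \<noteq> orb w" using inZ self z w by metis
  have c2: "card (orb ` tverts T) = 2" using two_orbits unfolding orb_def .
  then have "finite (orb ` tverts T)" by (metis card.infinite zero_neq_numeral)
  moreover have "{orb z, orb w} \<subseteq> orb ` tverts T" using Z_vertex z w by blast
  ultimately have all: "orb ` tverts T = {orb z, orb w}"
    using card_subset_eq[of "orb ` tverts T" "{orb z, orb w}"] c2 ne by simp
  have "orb u = orb v"
  proof -
    have o: "orb x = orb z \<or> orb x = orb w" if "x \<in> tverts T" for x using all that by blast
    have "orb x = (if x \<in> Z then orb z else orb w)" if "x \<in> tverts T" for x
      using o[OF that] inZ[of x z] inZ[of x w] self[of x] z w(2) by auto
    then show ?thesis using assms by simp
  qed
  then have "v \<in> orb u" using self[of v] by simp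
  then obtain f where "f \<in> G" "v = f u" unfolding orb_def by blast
  then show ?thesis using that by blast
qed

section \<open>The tiles around a vertex\<close>

lemma vertex_tiles:
  assumes "u \<in> tverts T"
  obtains L where "distinct L" "set L = {P \<in> T. u \<in> P}"
    "mset (map card L) = mset [3,4,6,4] \<or> mset (map card L) = mset [4,6,12]"
  by (rule vertex_cycle[OF assms]) (rule that; assumption)

text \<open>In both types only the size 4 can repeat. Hence a symmetry taking one vertex to another
  takes the hexagon or dodecagon of the first to that of the second.\<close>

lemma vertex_unique_tile:
  assumes "P \<in> T" "Q \<in> T" "u \<in> P" "u \<in> Q" "card P = card Q" "card P \<noteq> 4"
  shows "P = Q"
proof (rule ccontr)
  assume ne: "P \<noteq> Q"
  obtain L where L: "distinct L" "set L = {P \<in> T. u \<in> P}"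
    "mset (map card L) = mset [3,4,6,4] \<or> mset (map card L) = mset [4,6,12]"
    using vertex_tiles[OF tile_vertex[OF assms(1,3)]] .
  have "P \<in># mset L" using L(2) assms by simp
  then obtain M where M: "mset L = add_mset P M" using multi_member_split by metis
  have "Q \<in># mset L" using L(2) assms by simp
  then have "Q \<in># M" using M ne by auto
  then obtain M' where "M = add_mset Q M'" using multi_member_split by metis
  then have "count (mset (map card L)) (card P) \<ge> 2" using M assms(5) by simp
  then show False using L(3) assms(6) by (auto split: if_splits)
qed

text \<open>In a cycle of three tiles any two are consecutive, so each pair shares an edge at
  \<open>u\<close>.\<close>

lemma Z_structure:
  assumes D: "D \<in> T" "card D = 12" "u \<in> D"
  obtains S H where "{P \<in> T. u \<in> P} = {S, H, D}" "card S = 4" "card H = 6"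
    "\<exists>w. adj S H u w" "\<exists>w. adj H D u w" "\<exists>w. adj S D u w"
proof -
  obtain L where L: "distinct L" "length L \<ge> 3" "set L = {P \<in> T. u \<in> P}"
    "\<And>i. i < length L \<Longrightarrow> \<exists>w. adj (L ! i) (L ! ((i + 1) mod length L)) u w"
    "mset (map card L) = mset [3,4,6,4] \<or> mset (map card L) = mset [4,6,12]"
    by (rule vertex_cycle[OF tile_vertex[OF D(1,3)]]) (rule that; assumption)
  have DL: "D \<in> set L" using D L(3) by simp
  have ms: "mset (map card L) = mset [4,6,12]"
  proof (rule ccontr)
    assume "mset (map card L) \<noteq> mset [4,6,12]"
    then have "mset (map card L) = mset [3,4,6,4]" using L(5) by blast
    then have "set (map card L) = set [3,4,6,4]" by (metis set_mset_mset)
    moreover have "12 \<in> set (map card L)" using DL D(2) by force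
    ultimately show False by simp
  qed
  have len: "length L = 3" using arg_cong[OF ms, of size] by simp
  have st: "set (map card L) = {4,6,12}" using ms by (metis set_mset_mset list.set(1,2))
  then have "4 \<in> card ` set L" "6 \<in> card ` set L" by auto
  then obtain S H where SH: "S \<in> set L" "card S = 4" "H \<in> set L" "card H = 6" by force
  have ne: "S \<noteq> H" "S \<noteq> D" "H \<noteq> D" using SH D by auto
  have "card (set L) = 3" using L(1) len distinct_card by metis
  moreover have "card {S, H, D} = 3" using ne by simp
  ultimately have all: "set L = {S, H, D}"
    using card_subset_eq[of "set L" "{S, H, D}"] SH DL by simp
  have pair: "\<exists>w. adj A B u w" if AB: "A \<in> set L" "B \<in> set L" "A \<noteq> B" for A B
  proof -
    obtain i j where ij: "i < 3" "j < 3" "L ! i = A" "L ! j = B"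
      using AB len by (metis in_set_conv_nth)
    have "i \<noteq> j" using AB(3) ij(3,4) by blast
    moreover have "i = 0 \<or> i = 1 \<or> i = 2" "j = 0 \<or> j = 1 \<or> j = 2" using ij(1,2) by auto
    ultimately have "j = (i + 1) mod 3 \<or> i = (j + 1) mod 3" by auto
    then show ?thesis
    proof
      assume "j = (i + 1) mod 3"
      then show ?thesis using L(4)[of i] ij len by simp
    next
      assume "i = (j + 1) mod 3"
      then have "\<exists>w. adj B A u w" using L(4)[of j] ij len by simp
      then show ?thesis using adj_commute by blast
    qed
  qed
  have "{P \<in> T. u \<in> P} = {S, H, D}" using all L(3) by simp
  then show ?thesis using SH(2,4) pair[OF SH(1,3) ne(1)] pair[OF SH(3) DL ne(3)] pair[OF SH(1) DL ne(2)]
    by (rule that)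
qed

subsection \<open>Dodecagons\<close>

text \<open>The two edges of \<open>D\<close> at a corner border the square and the hexagon there,
  one each, since the tile across an edge is unique.\<close>

lemma dodecagon_edge_types:
  assumes D: "D \<in> T" "card D = 12" and p: "cyc_param D 12 p"
  shows "(\<exists>Q. adj D Q (p k) (p (k + 1)) \<and> card Q = 4 \<and>
            (\<exists>R. adj D R (p (k + 1)) (p (k + 2)) \<and> card R = 6)) \<or>
         (\<exists>Q. adj D Q (p k) (p (k + 1)) \<and> card Q = 6 \<and>
            (\<exists>R. adj D R (p (k + 1)) (p (k + 2)) \<and> card R = 4))"
proof -
  obtain S H where SH: "card S = 4" "card H = 6"
    "\<exists>w. adj H D (p (k + 1)) w" "\<exists>w. adj S D (p (k + 1)) w"
    using Z_structure[OF D cyc_param_mem[OF p, of "k + 1"]] by metis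
  obtain w where w: "adj D H (p (k + 1)) w" using SH(3) adj_commute by blast
  obtain v where v: "adj D S (p (k + 1)) v" using SH(4) adj_commute by blast
  have "w \<noteq> v" using adj_unique w v SH by force
  moreover have "w = p (k + 1 + 1) \<or> w = p (k + 1 - 1)" "v = p (k + 1 + 1) \<or> v = p (k + 1 - 1)"
    using cyc_param_nbr[OF p] w v unfolding adj_def by blast+
  moreover have "k + 1 + 1 = k + 2" "k + 1 - 1 = k" by simp_all
  ultimately have "(w = p (k + 2) \<and> v = p k) \<or> (w = p k \<and> v = p (k + 2))" by metis
  then show ?thesis using w v SH adj_edge_commute by metis
qed

definition sq :: "complex set \<Rightarrow> complex \<Rightarrow> complex \<Rightarrow> bool" where
  "sq D a b \<longleftrightarrow> (\<exists>Q. adj D Q a b \<and> card Q = 4)"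

lemma sq_commute: "sq D a b \<longleftrightarrow> sq D b a"
  unfolding sq_def using adj_edge_commute by blast

lemma G_sq: "f \<in> G \<Longrightarrow> sq D a b \<Longrightarrow> sq (f ` D) (f a) (f b)"
  unfolding sq_def using G_adj G_card by metis

lemma sq_alternates:
  assumes D: "D \<in> T" "card D = 12" and p: "cyc_param D 12 p"
  shows "sq D (p (k + 1)) (p (k + 2)) \<longleftrightarrow> \<not> sq D (p k) (p (k + 1))"
proof -
  have hex: "\<not> sq D a b" if "adj D Q a b" "card Q = 6" for Q a b
    using that adj_unique unfolding sq_def by force
  show ?thesis using dodecagon_edge_types[OF D p, of k]
  proof (elim disjE exE conjE)
    fix Q R assume "adj D Q (p k) (p (k + 1))" "card Q = 4" "adj D R (p (k + 1)) (p (k + 2))" "card R = 6"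
    then show ?thesis using hex sq_def by blast
  next
    fix Q R assume "adj D Q (p k) (p (k + 1))" "card Q = 6" "adj D R (p (k + 1)) (p (k + 2))" "card R = 4"
    then show ?thesis using hex sq_def by blast
  qed
qed

lemma sq_parity:
  assumes D: "D \<in> T" "card D = 12" and p: "cyc_param D 12 p"
  shows "sq D (p k) (p (k + 1)) \<longleftrightarrow> (sq D (p 0) (p 1) \<longleftrightarrow> even k)"
proof (induction k rule: int_induct[of _ 0])
  case base
  then show ?case by simp
next
  case (step1 k)
  have "k + 1 + 1 = k + 2" by simp
  then show ?case using sq_alternates[OF D p, of k] step1(2) by (metis even_plus_one_iff)
next
  case (step2 k)
  have "k - 1 + 1 = k" "k - 1 + 2 = k + 1" by simp_all
  then show ?case using sq_alternates[OF D p, of "k - 1"] sq_alternates[OF D p, of k] step2(2)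
    by (metis even_plus_one_iff)
qed

text \<open>A symmetry of a dodecagon preserves the alternation of squares and hexagons around it.\<close>

lemma dodecagon_symmetry:
  assumes D: "D \<in> T" "card D = 12" and p: "cyc_param D 12 p"
    and f: "f \<in> G" "f ` D = D"
  obtains j s where "s = 1 \<and> even j \<or> s = - (1::int) \<and> odd j" "\<And>k. f (p k) = p (j + s * k)"
proof -
  have fe: "\<And>a b. poly_edge D a b \<Longrightarrow> poly_edge D (f a) (f b)" using G_edge[OF f(1) D(1)] f(2) by metis
  obtain j s where s: "s = 1 \<or> s = - (1::int)" and k: "\<And>k. f (p k) = p (j + s * k)"
    using dihedral[OF p p G_inj[OF f(1)] fe] by metis
  have pres: "sq D (f a) (f b)" if "sq D a b" for a b using G_sq[OF f(1) that] f(2) by simp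
  have ab: "sq D (p j) (p (j + s))" if "sq D (p 0) (p 1)" using pres[OF that] k[of 0] k[of 1] by simp
  have bc: "sq D (p (j + s)) (p (j + 2 * s))" if "sq D (p 1) (p 2)" using pres[OF that] k[of 1] k[of 2] by (simp add: mult.commute)
  have p1: "sq D (p 1) (p 2) \<longleftrightarrow> \<not> sq D (p 0) (p 1)" using sq_alternates[OF D p, of 0] by simp
  have "s = 1 \<and> even j \<or> s = - 1 \<and> odd j"
    using s
  proof
    assume s1: "s = 1"
    show ?thesis
      using ab bc p1 s1 sq_parity[OF D p, of j] sq_parity[OF D p, of "j + 1"]
      by (cases "sq D (p 0) (p 1)") (auto simp: algebra_simps)
  next
    assume s1: "s = - 1"
    \<comment> \<open>The edge from \<open>k\<close> to \<open>k + 1\<close> goes to the one from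
      \<open>j - k - 1\<close> to \<open>j - k\<close>, so it is the parity of \<open>j - 1\<close>
      that counts.\<close>
    have "sq D (p j) (p (j - 1)) \<longleftrightarrow> (sq D (p 0) (p 1) \<longleftrightarrow> even (j - 1))"
      using sq_parity[OF D p, of "j - 1"] sq_commute by simp
    moreover have "sq D (p (j - 1)) (p (j - 2)) \<longleftrightarrow> (sq D (p 0) (p 1) \<longleftrightarrow> even (j - 2))"
      using sq_parity[OF D p, of "j - 2"] sq_commute by (simp add: algebra_simps)
    ultimately show ?thesis
      using ab bc p1 s1 by (cases "sq D (p 0) (p 1)") auto
  qed
  then show ?thesis using that k by blast
qed

text \<open>Symmetries are transitive on \<open>Z\<close>, and one taking \<open>a\<close> to
  \<open>b\<close> keeps \<open>D\<close>, the only dodecagon at \<open>b\<close>.\<close>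

lemma dodecagon_transitive:
  assumes D: "D \<in> T" "card D = 12" and ab: "a \<in> D" "b \<in> D"
  obtains f where "f \<in> G" "f ` D = D" "f a = b"
proof -
  obtain f where f: "f \<in> G" "f a = b"
    using G_transitive[of a b] tile_vertex[OF D(1)] ZI[OF D] ab by metis
  have "f ` D = D"
    using vertex_unique_tile[of "f ` D" D b] G_tile[OF f(1) D(1)] D ab f G_card[OF f(1)] by force
  then show ?thesis using that f by blast
qed

text \<open>Taking corner 0 to corner 2 makes \<open>j\<close> even, and
  \<open>dodecagon_symmetry\<close> then excludes a reversal.\<close>

lemma dodecagon_rotation:
  assumes D: "D \<in> T" "card D = 12" and p: "cyc_param D 12 p"
  obtains f where "f \<in> G" "f ` D = D" "\<And>k. f (p k) = p (k + 2)"
proof -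
  obtain f where f: "f \<in> G" "f ` D = D" "f (p 0) = p 2"
    using dodecagon_transitive[OF D] cyc_param_mem[OF p] by metis
  obtain j s where s: "s = 1 \<and> even j \<or> s = - (1::int) \<and> odd j" and k: "\<And>k. f (p k) = p (j + s * k)"
    using dodecagon_symmetry[OF D p f(1,2)] by metis
  have "p j = p 2" using k[of 0] f(3) by simp
  then have j: "12 dvd j - 2" using cyc_param_eq[OF p] by simp
  then have "even j" by presburger
  then have "s = 1" using s by blast
  then have "f (p k) = p (k + 2)" for k using k[of k] cyc_param_eq[OF p, of "j + k" "k + 2"] j by simp
  then show ?thesis using that f by blast
qed

text \<open>Taking corner 0 to corner 1 makes \<open>j\<close> odd, which forces a reversal: the
  mirror that swaps the ends of this edge.\<close>

lemma dodecagon_reflection: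
  assumes D: "D \<in> T" "card D = 12" and p: "cyc_param D 12 p"
  obtains f where "f \<in> G" "f ` D = D" "\<And>k. f (p k) = p (1 - k)"
proof -
  obtain f where f: "f \<in> G" "f ` D = D" "f (p 0) = p 1"
    using dodecagon_transitive[OF D] cyc_param_mem[OF p] by metis
  obtain j s where s: "s = 1 \<and> even j \<or> s = - (1::int) \<and> odd j" and k: "\<And>k. f (p k) = p (j + s * k)"
    using dodecagon_symmetry[OF D p f(1,2)] by metis
  have "p j = p 1" using k[of 0] f(3) by simp
  then have j: "12 dvd j - 1" using cyc_param_eq[OF p] by simp
  then have "odd j" by presburger
  then have "s = - 1" using s by blast
  then have "f (p k) = p (1 - k)" for k using k[of k] cyc_param_eq[OF p, of "j - k" "1 - k"] j by simp
  then show ?thesis using that f by blast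
qed

section \<open>Rotations, half turns and translations in the symmetry group\<close>

lemma rot_G:
  assumes D: "D \<in> T" "card D = 12" shows "rot (centroid D) \<in> G"
proof -
  obtain n c w where n: "n \<ge> 3" and w: "w \<noteq> 0" and D': "D = range (ngon n c w)"
    using regular_polygonD[OF tile_regular[OF D(1)]] .
  have n12: "n = 12" using D(2) D' card_ngon[of n w c] n w by simp
  have c: "centroid D = c" using centroid_ngon[of n w c] n w D' by simp
  have p: "cyc_param D 12 (ngon 12 c w)" using cyc_param_ngon[OF n w] D' n12 by simp
  obtain f where f: "f \<in> G" "\<And>k. f (ngon 12 c w k) = ngon 12 c w (k + 2)"
    using dodecagon_rotation[OF D p] by metis
  \<comment> \<open>Two steps along the dodecagon make 60 degrees.\<close>
  have "rot c (ngon 12 c w k) = ngon 12 c w (k + 2)" for k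
  proof -
    have "2 * pi * real_of_int (k + 2) / real 12 = pi / 3 + 2 * pi * real_of_int k / real 12"
      by (simp add: field_simps)
    then have "cis (2 * pi * real_of_int (k + 2) / real 12) = \<omega> * cis (2 * pi * real_of_int k / real 12)"
      by (simp only: \<omega>_def cis_mult)
    then show ?thesis by (simp add: rot_def ngon_def)
  qed
  then have "f x = rot c x" if "x \<in> D" for x using that f(2) D' n12 by auto
  then have "f = rot c" using isom_regular_eq[OF G_isom[OF f(1)] rot_isom tile_regular[OF D(1)]] by blast
  then show ?thesis using f(1) c by simp
qed

lemma neg_G:
  assumes D: "D \<in> T" "card D = 12" shows "(\<lambda>z. 2 * centroid D - z) \<in> G"
proof -
  let ?c = "centroid D"
  have "rot ?c (rot ?c (rot ?c z)) = 2 * ?c - z" for z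
  proof -
    have "rot ?c (rot ?c (rot ?c z)) = ?c + \<omega> * \<omega> * \<omega> * (z - ?c)" by (simp add: rot_def)
    also have "\<omega> * \<omega> * \<omega> = - 1" using omega_sq by algebra
    finally show ?thesis by simp
  qed
  then have "(\<lambda>z. 2 * ?c - z) = rot ?c \<circ> (rot ?c \<circ> rot ?c)" by auto
  then show ?thesis using G_comp rot_G[OF D] by metis
qed

text \<open>Six rotations by 60 degrees have linear part 1. The first four fix
  \<open>centroid D\<close>; the fifth, about \<open>centroid D'\<close>, and the sixth, about
  \<open>centroid D\<close> again, move it by \<open>\<omega> - \<omega> * \<omega>\<close> times
  the difference of the centres, and this factor is 1.\<close>

lemma translation_G:
  assumes D: "D \<in> T" "card D = 12" and D': "D' \<in> T" "card D' = 12"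
  shows "(\<lambda>z. z + (centroid D' - centroid D)) \<in> G"
proof -
  let ?c = "centroid D" and ?d = "centroid D'"
  let ?f = "rot ?c \<circ> (rot ?d \<circ> (rot ?c \<circ> (rot ?c \<circ> (rot ?c \<circ> rot ?c))))"
  have "?f z = z + (?d - ?c)" for z
  proof -
    have "?f z = ?c + \<omega> * (?d + \<omega> * (?c + \<omega> * (\<omega> * (\<omega> * (\<omega> * (z - ?c)))) - ?d) - ?c)"
      by (simp add: rot_def)
    also have "\<dots> = z + (?d - ?c)" using omega_sq by algebra
    finally show ?thesis .
  qed
  then have "(\<lambda>z. z + (?d - ?c)) = ?f" by auto
  moreover have "?f \<in> G" using G_comp rot_G[OF D] rot_G[OF D'] by simp
  ultimately show ?thesis by simp
qed

subsection \<open>Hexagons next to a dodecagon\<close>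

text \<open>Were every hexagon at a dodecagon to have only dodecagon vertices, then so would every tile
  that can be reached, leaving no room for the vertices of the other type.\<close>

lemma hexagon_not_all_Z:
  assumes H: "H \<in> T" "card H = 6" "a \<in> H" "a \<in> Z"
  shows "\<not> H \<subseteq> Z"
proof
  assume HZ: "H \<subseteq> Z"
  \<comment> \<open>Symmetries are transitive on \<open>Z\<close> and each of its vertices has one
    hexagon, so all these hexagons are alike.\<close>
  have hex: "H' \<subseteq> Z" if H': "H' \<in> T" "card H' = 6" "z \<in> H'" "z \<in> Z" for H' z
  proof -
    obtain f where f: "f \<in> G" "f a = z" using G_transitive[of a z] Z_vertex H(4) H'(4) by metis
    have "f ` H = H'"
      using vertex_unique_tile[of "f ` H" H' z] G_tile[OF f(1) H(1)] G_card[OF f(1)] H H' f(2) by force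
    then show ?thesis using HZ G_Z[OF f(1)] by blast
  qed
  \<comment> \<open>Two of the three tiles at \<open>z\<close> share the edge, so one of them is the
    hexagon or the dodecagon, whose corners all lie in \<open>Z\<close>.\<close>
  have nbr: "y \<in> Z" if P: "P \<in> T" and e: "poly_edge P z y" and z: "z \<in> Z" for P z y
  proof -
    obtain Q where Q: "adj P Q z y" using edge_other_tile[OF P e] .
    obtain D where D: "D \<in> T" "card D = 12" "z \<in> D" using z by (auto simp: Z_def)
    obtain S K where SK: "{P \<in> T. z \<in> P} = {S, K, D}" "card S = 4" "card K = 6"
      using Z_structure[OF D] by metis
    have zy: "z \<in> P" "z \<in> Q" "y \<in> P" "y \<in> Q" "Q \<in> T" "P \<noteq> Q"
      using Q by (auto simp: adj_def poly_edge_def)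
    have "P \<in> {S, K, D}" "Q \<in> {S, K, D}" using SK(1) P zy by blast+
    then have "y \<in> K \<or> y \<in> D" using zy by blast
    moreover have "K \<in> T" "z \<in> K" using SK(1) by blast+
    ultimately show ?thesis using hex[of K z] SK(3) z ZI[OF D(1,2)] by blast
  qed
  have tile: "P \<subseteq> Z" if P: "P \<in> T" "z \<in> P" "z \<in> Z" for P z
  proof -
    obtain h where h: "cyc_param P (card P) h" using cyc_param_regular[OF tile_regular[OF P(1)]] .
    obtain i where i: "z = h i" using P(2) h by (auto simp: cyc_param_def)
    show ?thesis
    proof (rule cyc_param_subset_step[OF h])
      show "h i \<in> Z" using i P(3) by simp
      show "h (k + 1) \<in> Z" if "h k \<in> Z" for k using nbr[OF P(1) cyc_param_step[OF h] that] .
    qed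
  qed
  let ?A = "{P \<in> T. P \<subseteq> Z}"
  have "?A = T"
  proof (rule tiles_connected)
    show "?A \<noteq> {}" using H(1) HZ by blast
    show "Q \<in> ?A" if PQ: "P \<in> ?A" "adj P Q x y" for P Q x y
    proof -
      have "x \<in> P" "x \<in> Q" "Q \<in> T" using PQ by (auto simp: adj_def poly_edge_def)
      then show ?thesis using tile[of Q x] PQ(1) by blast
    qed
  qed auto
  then have "tverts T \<subseteq> Z" unfolding tverts_def by blast
  then show False using exists_W by blast
qed

text \<open>Both enumerations are shifted, and that of the hexagon is reversed if necessary, until
  the common edge has the indices 0 and 1 in each.\<close>

lemma hexagon_at_dodecagon:
  obtains D H p h where "D \<in> T" "card D = 12" "H \<in> T" "card H = 6" "cyc_param D 12 p" "cyc_param H 6 h"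
    "h 0 = p 0" "h 1 = p 1"
proof -
  obtain D where D: "D \<in> T" "card D = 12" using exists_Z by (auto simp: Z_def)
  obtain q where q: "cyc_param D 12 q" using cyc_param_regular[OF tile_regular[OF D(1)]] D(2) by metis
  obtain i H where H: "adj D H (q i) (q (i + 1))" "card H = 6"
  proof -
    have e: "0 + 1 = (1::int)" "0 + 2 = (1::int) + 1" by simp_all
    show thesis using dodecagon_edge_types[OF D q, of 0] that[of _ 0] that[of _ 1] unfolding e by blast
  qed
  have p: "cyc_param D 12 (\<lambda>k. q (i + 1 * k))" using cyc_param_reparam[OF q] by blast
  have HT: "H \<in> T" "poly_edge H (q i) (q (i + 1))" using H(1) by (auto simp: adj_def)
  obtain g where g: "cyc_param H 6 g" using cyc_param_regular[OF tile_regular[OF HT(1)]] H(2) by metis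
  have "q i \<in> H" using HT(2) by (auto simp: poly_edge_def)
  then obtain j where j: "q i = g j" using g by (auto simp: cyc_param_def)
  then have "q (i + 1) = g (j + 1) \<or> q (i + 1) = g (j - 1)" using cyc_param_nbr[OF g] HT(2) by simp
  then obtain s :: int where s: "s = 1 \<or> s = - 1" "q (i + 1) = g (j + s)"
    by (metis add.commute uminus_add_conv_diff)
  have h: "cyc_param H 6 (\<lambda>k. g (j + s * k))" using cyc_param_reparam[OF g s(1)] .
  show ?thesis using that[OF D HT(1) H(2) p h] j s(2) by simp
qed

text \<open>Around the hexagon, corners 0, 1, 3, 4 lie in \<open>Z\<close> and 2, 5 do not. A
  symmetry taking corner 1 to corner 3 must then send \<open>k\<close> to \<open>4 - k\<close>: a
  reflection fixing corners 2 and 5, the first of which is the vertex sought.\<close>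

lemma W_reflection:
  obtains c b u where "c \<in> tverts T" "c \<notin> Z" "opposite b u \<in> G" "opposite b u c = c"
proof -
  obtain D H p h where D: "D \<in> T" "card D = 12" and H: "H \<in> T" "card H = 6"
    and p: "cyc_param D 12 p" and h: "cyc_param H 6 h" and ph: "h 0 = p 0" "h 1 = p 1"
    using hexagon_at_dodecagon by metis
  have HD: "H \<noteq> D" using D H by auto
  have he: "h i = h j \<longleftrightarrow> 6 dvd i - j" for i j using cyc_param_eq[OF h] by simp
  have hT: "h i \<in> tverts T" for i using tile_vertex[OF H(1) cyc_param_mem[OF h]] .
  have pZ: "p k \<in> Z" for k using ZI[OF D cyc_param_mem[OF p]] .
  have Z01: "h 0 \<in> Z" "h 1 \<in> Z" using ph pZ by simp_all
  have fH: "f ` H = H" if "f \<in> G" "f (h i) = h j" for f i j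
  proof (rule vertex_unique_tile)
    show "f ` H \<in> T" "H \<in> T" using G_tile[OF that(1) H(1)] H(1) by simp_all
    show "h j \<in> f ` H" using cyc_param_mem[OF h] that(2) by (metis imageI)
    show "h j \<in> H" using cyc_param_mem[OF h] .
    show "card (f ` H) = card H" "card (f ` H) \<noteq> 4" using G_card[OF that(1)] H(2) by simp_all
  qed
  have sym: "\<exists>j s. (s = 1 \<or> s = - (1::int)) \<and> (\<forall>k. f (h k) = h (j + s * k))"
    if f: "f \<in> G" "f ` H = H" for f
  proof -
    have "\<And>a b. poly_edge H a b \<Longrightarrow> poly_edge H (f a) (f b)" using G_edge[OF f(1) H(1)] f(2) by metis
    then show ?thesis using dihedral[OF h h G_inj[OF f(1)]] by metis
  qed
  obtain m where m: "m \<in> G" "\<And>k. m (p k) = p (1 - k)" using dodecagon_reflection[OF D p] by metis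
  have m01: "m (h 0) = h 1" "m (h 1) = h 0" using m(2)[of 0] m(2)[of 1] ph by simp_all
  obtain j s where js: "s = 1 \<or> s = - (1::int)" "\<And>k. m (h k) = h (j + s * k)"
    using sym[OF m(1) fH[OF m(1) m01(1)]] by blast
  have "h j = h 1" "h (j + s) = h 0" using js(2)[of 0] js(2)[of 1] m01 by simp_all
  then have d: "6 dvd j - 1" "6 dvd j + s - 0" using he by blast+
  have "s = - 1"
  proof (rule ccontr)
    assume "s \<noteq> - 1"
    then have "s = 1" using js(1) by blast
    then show False using d by presburger
  qed
  then have mh: "m (h k) = h (1 - k)" for k using js(2)[of k] d(1) he[of "j - k" "1 - k"] by simp
  \<comment> \<open>Otherwise the square at corner 1 lies across the edge 1-2, hence the dodecagon
    at corner 2 across the edge 2-3. So corner 3 lies in \<open>Z\<close>, by the mirror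
    \<open>m\<close> also 4 and 5, and the whole hexagon does.\<close>
  have Z2: "h 2 \<notin> Z"
  proof
    assume Z2: "h 2 \<in> Z"
    obtain S H' where SH: "{P \<in> T. h 1 \<in> P} = {S, H', D}" "card S = 4" "card H' = 6" "\<exists>w. adj S H' (h 1) w"
      using Z_structure[OF D, of "h 1"] cyc_param_mem[OF p] ph by metis
    have "H' = H"
      using vertex_unique_tile[of H' H "h 1"] SH(1,3) H cyc_param_mem[OF h] by force
    then obtain w where w: "adj S H (h 1) w" using SH(4) by blast
    have SD: "S \<noteq> D" using SH(2) D(2) by auto
    have "adj H D (h 1) (h 0)"
      using H(1) D(1) HD cyc_param_edge[OF h, of 1 0] cyc_param_edge[OF p, of 1 0] ph by (simp add: adj_def)
    then have "w \<noteq> h 0" using w SD adj_unique adj_commute by blast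
    moreover have "w = h (1 + 1) \<or> w = h (1 - 1)" using cyc_param_nbr[OF h] w unfolding adj_def by blast
    ultimately have w2: "adj S H (h 1) (h 2)" using w by simp
    obtain D2 where D2: "D2 \<in> T" "card D2 = 12" "h 2 \<in> D2" using Z2 by (auto simp: Z_def)
    obtain S2 H2 where SH2: "{P \<in> T. h 2 \<in> P} = {S2, H2, D2}" "card S2 = 4" "card H2 = 6"
        "\<exists>w. adj H2 D2 (h 2) w"
      using Z_structure[OF D2] by metis
    have "H2 = H" using vertex_unique_tile[of H2 H "h 2"] SH2(1,3) H cyc_param_mem[OF h] by force
    then obtain v where v: "adj H D2 (h 2) v" using SH2(4) by blast
    have "S \<noteq> D2" using SH(2) D2(2) by auto
    moreover have "adj H S (h 2) (h 1)" using w2 adj_commute adj_edge_commute by blast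
    ultimately have "v \<noteq> h 1" using v adj_unique by blast
    moreover have "v = h (2 + 1) \<or> v = h (2 - 1)" using cyc_param_nbr[OF h] v unfolding adj_def by blast
    ultimately have "v = h 3" by simp
    then have "h 3 \<in> D2" using v by (auto simp: adj_def poly_edge_def)
    then have Z3: "h 3 \<in> Z" using ZI[OF D2(1,2)] by blast
    have "h (1 - 3) \<in> Z" "h (1 - 2) \<in> Z" using G_Z[OF m(1)] mh Z2 Z3 by metis+
    moreover have "h (1 - 3) = h 4" "h (1 - 2) = h 5" using he by auto
    ultimately have all: "h 0 \<in> Z" "h 1 \<in> Z" "h 2 \<in> Z" "h 3 \<in> Z" "h 4 \<in> Z" "h 5 \<in> Z"
      using Z01 Z2 Z3 by simp_all
    have "H \<subseteq> Z"
    proof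
      fix x assume "x \<in> H"
      then obtain k where k: "x = h k" using h by (auto simp: cyc_param_def)
      have "h k = h (k mod 6)" using he by (simp add: mod_eq_dvd_iff[symmetric])
      moreover have "k mod 6 \<in> {0,1,2,3,4,5}" by auto
      ultimately show "x \<in> Z" using all k by (metis empty_iff insert_iff)
    qed
    then show False using hexagon_not_all_Z[OF H cyc_param_mem[OF h, of 0] Z01(1)] by blast
  qed
  have Z5: "h 5 \<notin> Z"
  proof -
    have "h (1 - 2) = h 5" using he by auto
    then show ?thesis using Z2 mh[of 2] G_Z[OF m(1)] by metis
  qed
  \<comment> \<open>Otherwise corners 2 and 3 are equivalent, and a symmetry between them takes
    corner 1 to 2 or corner 0 to 5, out of \<open>Z\<close>.\<close>
  have Z3: "h 3 \<in> Z"
  proof (rule ccontr)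
    assume Z3: "h 3 \<notin> Z"
    obtain g where g: "g \<in> G" "g (h 2) = h 3" using G_transitive[of "h 2" "h 3"] hT Z2 Z3 by metis
    obtain j s where js: "s = 1 \<or> s = - (1::int)" "\<And>k. g (h k) = h (j + s * k)"
      using sym[OF g(1) fH[OF g]] by blast
    have "h (j + s * 2) = h 3" using js(2)[of 2] g(2) by simp
    then have d: "6 dvd j + s * 2 - 3" using he by blast
    from js(1) show False
    proof
      assume s: "s = 1"
      then have "6 dvd (j + 1) - 2" using d by simp
      then have "g (h 1) = h 2" using js(2)[of 1] s he[of "j + 1" 2] by simp
      then show False using Z2 Z01 G_Z[OF g(1)] by metis
    next
      assume s: "s = - 1"
      then have "6 dvd j - 5" using d by simp
      then have "g (h 0) = h 5" using js(2)[of 0] s he[of j 5] by simp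
      then show False using Z5 Z01 G_Z[OF g(1)] by metis
    qed
  qed
  have Z4: "h 4 \<in> Z"
  proof -
    have "h (1 - 3) = h 4" using he by auto
    then show ?thesis using Z3 mh[of 3] G_Z[OF m(1)] by metis
  qed
  obtain g where g: "g \<in> G" "g (h 1) = h 3" using G_transitive[of "h 1" "h 3"] hT Z01 Z3 by metis
  obtain j s where js: "s = 1 \<or> s = - (1::int)" "\<And>k. g (h k) = h (j + s * k)"
    using sym[OF g(1) fH[OF g]] by blast
  have "h (j + s) = h 3" using js(2)[of 1] g(2) by simp
  then have d: "6 dvd j + s - 3" using he by blast
  \<comment> \<open>A turn by two steps would take corner 2 to corner 4, into
    \<open>Z\<close>.\<close>
  have s: "s = - 1"
  proof (rule ccontr)
    assume "s \<noteq> - 1"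
    then have s: "s = 1" using js(1) by blast
    then have "6 dvd (j + 2) - 4" using d by simp
    then have "g (h 2) = h 4" using js(2)[of 2] s he[of "j + 2" 4] by simp
    then show False using Z2 Z4 G_Z[OF g(1)] by metis
  qed
  have j4: "6 dvd j - 4" using d s by simp
  have g2: "g (h 2) = h 2" using js(2)[of 2] s he[of "j - 2" 2] j4 by simp
  have "6 dvd (j - 5) - 5" using j4 by presburger
  then have g5: "g (h 5) = h 5" using js(2)[of 5] s he[of "j - 5" 5] by simp
  from G_isom[OF g(1)] show ?thesis
  proof (cases rule: isom_cases)
    \<comment> \<open>With two fixed points it would be the identity, yet it moves corner 1.\<close>
    case (direct b u)
    have "h 2 \<noteq> h 5" using he by simp
    moreover have "(1 - u) * (h 2 - h 5) = 0"
      by (rule affine_two_fixed_points[of b]) (use g2 g5 in \<open>simp_all add: direct direct_def\<close>)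
    ultimately have "u = 1" by simp
    then have "g = (\<lambda>z. b + z)" using direct by (auto simp: direct_def)
    then have "g (h 1) = h 1" using g2 by simp
    then show ?thesis using g(2) he[of 1 3] by simp
  next
    case (opposite b u)
    then show ?thesis using that[of "h 2" b u] hT Z2 g(1) g2 by simp
  qed
qed

subsection \<open>Nine representatives\<close>

text \<open>A translation in the group brings the centre of the image of \<open>D\<close> back to
  that of \<open>D\<close>. What remains is a rotation of \<open>D\<close> by a power of \<omega>;
  since the third power is -1, exponents from 3 on are absorbed into a half turn.\<close>

lemma direct_symmetry:
  assumes D: "D \<in> T" "card D = 12" and f: "direct b u \<in> G"
  obtains g i where "g \<in> G" "half_turn_or_translation g" "i < (3::nat)"
    "\<And>z. direct b u z = g (centroid D + \<omega> ^ i * (z - centroid D))"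
proof -
  let ?f = "direct b u" and ?c = "centroid D"
  let ?E = "?f ` D"
  have E: "?E \<in> T" "card ?E = 12" using G_tile[OF f D(1)] G_card[OF f] D(2) by simp_all
  have fin: "finite D" "D \<noteq> {}" using tile_finite D by auto
  have cE: "centroid ?E = ?f ?c" using isom_centroid[OF G_isom[OF f] fin] .
  define t where "t = (\<lambda>z. z + (?c - ?f ?c))"
  have t: "t \<in> G" using translation_G[OF E D] unfolding cE t_def .
  define g where "g = t \<circ> ?f"
  have g: "g \<in> G" using G_comp[OF t f] by (simp add: g_def)
  have gz: "g z = ?c + u * (z - ?c)" for z by (simp add: g_def t_def direct_def algebra_simps)
  have gD: "g ` D = D"
  proof (rule tile_centroid_eq)
    show "centroid (g ` D) = ?c" using isom_centroid[OF G_isom[OF g] fin] gz by simp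
  qed (use G_tile[OF g D(1)] D(1) in auto)
  obtain n c w where n: "n \<ge> 3" and w: "w \<noteq> 0" and D': "D = range (ngon n c w)"
    using regular_polygonD[OF tile_regular[OF D(1)]] .
  have n12: "n = 12" using D(2) D' card_ngon[of n w c] n w by simp
  have c: "?c = c" using centroid_ngon[of n w c] n w D' by simp
  have p: "cyc_param D 12 (ngon 12 c w)" using cyc_param_ngon[OF n w] D' n12 by simp
  obtain j s where js: "s = 1 \<and> even j \<or> s = - (1::int) \<and> odd j"
    "\<And>k. g (ngon 12 c w k) = ngon 12 c w (j + s * k)"
    using dodecagon_symmetry[OF D p g gD] by metis
  \<comment> \<open>Twelfth roots of unity, indexed like the corners; \<omega> is
    \<open>\<zeta> 2\<close>.\<close>
  define \<zeta> where "\<zeta> k = cis (2 * pi * real_of_int k / real 12)" for k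
  have zadd: "\<zeta> (k + l) = \<zeta> k * \<zeta> l" for k l
  proof -
    have "2 * pi * real_of_int (k + l) / real 12
        = 2 * pi * real_of_int k / real 12 + 2 * pi * real_of_int l / real 12"
      by (simp add: field_simps)
    then show ?thesis by (simp only: \<zeta>_def cis_mult)
  qed
  have "c + u * (w * \<zeta> k) = c + w * \<zeta> (j + s * k)" for k
    using js(2)[of k] unfolding gz c by (simp add: ngon_def \<zeta>_def)
  then have uz: "u * \<zeta> k = \<zeta> (j + s * k)" for k using w by (simp add: mult.left_commute)
  have z0: "\<zeta> 0 = 1" by (simp add: \<zeta>_def)
  have u: "u = \<zeta> j" using uz[of 0] z0 by simp
  \<comment> \<open>Reversing the corners is not multiplication by a complex number: it would give
    \<open>\<zeta> (j + 1) = \<zeta> (j - 1)\<close>.\<close>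
  have "s = 1"
  proof (rule ccontr)
    assume "s \<noteq> 1"
    then have "s = - 1" using js(1) by blast
    then have "\<zeta> (j + 1) = \<zeta> (j - 1)" using uz[of 1] u zadd[of j 1] by simp
    then have "ngon 12 c w (j + 1) = ngon 12 c w (j - 1)" by (simp add: ngon_def \<zeta>_def)
    then show False using cyc_param_eq[OF p] by simp
  qed
  then have "even j" using js(1) by auto
  then obtain l where l: "j = 2 * l" by blast
  have zo: "\<zeta> 2 = \<omega>" by (simp add: \<zeta>_def \<omega>_def)
  have zn: "\<zeta> (2 * int m) = \<omega> ^ m" for m
  proof (induction m)
    case (Suc m)
    have "2 * int (Suc m) = 2 * int m + 2" by simp
    then show ?case using zadd[of "2 * int m" 2] zo Suc by (metis power_Suc2)
  qed (simp add: z0)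
  define m where "m = nat (l mod 6)"
  have m: "int m = l mod 6" "m < 6" by (simp_all add: m_def nat_less_iff)
  have "u = \<omega> ^ m"
  proof -
    have "2 * l - 2 * int m = 12 * (l div 6)"
      using mult_div_mod_eq[of 6 l] m(1) by linarith
    then have "12 dvd 2 * l - 2 * int m" by simp
    then have "ngon 12 c w (2 * l) = ngon 12 c w (2 * int m)"
      using cyc_param_eq[OF p, of "2 * l" "2 * int m"] by simp
    then have "\<zeta> (2 * l) = \<zeta> (2 * int m)" using w by (simp add: ngon_def \<zeta>_def)
    then show ?thesis using u l zn by simp
  qed
  have o3: "\<omega> ^ 3 = - 1" using omega_sq by (simp add: power3_eq_cube) algebra
  have tr: "(\<lambda>z. z + (?f ?c - ?c)) \<in> G" using translation_G[OF D E] unfolding cE .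
  have fz: "?f z = ?f ?c + u * (z - ?c)" for z by (simp add: direct_def algebra_simps)
  show ?thesis
  proof (cases "m < 3")
    case True
    show ?thesis
    proof (rule that[OF tr _ True])
      show "half_turn_or_translation (\<lambda>z. z + (?f ?c - ?c))" by (auto simp: half_turn_or_translation_def)
      show "?f z = ?c + \<omega> ^ m * (z - ?c) + (?f ?c - ?c)" for z using fz[of z] \<open>u = \<omega> ^ m\<close> by simp
    qed
  next
    case False
    then have m3: "m - 3 < 3" "m = 3 + (m - 3)" using m(2) by auto
    have um: "u = - (\<omega> ^ (m - 3))" using \<open>u = \<omega> ^ m\<close> o3 m3(2) by (metis mult_minus1 power_add)
    let ?g = "\<lambda>z. (?f ?c + ?c) - z"
    have "?g = (\<lambda>z. z + (?f ?c - ?c)) \<circ> (\<lambda>z. 2 * ?c - z)" by (auto simp: algebra_simps)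
    then have g: "?g \<in> G" using G_comp[OF tr neg_G[OF D]] by (simp only:)
    show ?thesis
    proof (rule that[OF g _ m3(1)])
      show "half_turn_or_translation ?g" by (auto simp: half_turn_or_translation_def)
      show "?f z = ?g (?c + \<omega> ^ (m - 3) * (z - ?c))" for z using fz[of z] um by simp
    qed
  qed
qed

lemma nine_representatives:
  obtains S where "finite S" "card S \<le> 9" "S \<subseteq> tverts T"
    "\<And>v. v \<in> tverts T \<Longrightarrow> \<exists>r\<in>S. \<exists>f\<in>G. half_turn_or_translation f \<and> f r = v"
proof -
  obtain D where D: "D \<in> T" "card D = 12" using exists_Z by (auto simp: Z_def)
  let ?c = "centroid D"
  obtain c b u where c: "c \<in> tverts T" "c \<notin> Z" and r: "opposite b u \<in> G" "opposite b u c = c"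
    using W_reflection by metis
  obtain n q w where n: "n \<ge> 3" and w: "w \<noteq> 0" and D': "D = range (ngon n q w)"
    using regular_polygonD[OF tile_regular[OF D(1)]] .
  have n12: "n = 12" using D(2) D' card_ngon[of n w q] n w by simp
  have q: "?c = q" using centroid_ngon[of n w q] n w D' by simp
  define p where "p = ngon 12 q w"
  have p: "cyc_param D 12 p" using cyc_param_ngon[OF n w] D' n12 by (simp add: p_def)
  \<comment> \<open>The half turn about the centre exchanges corners six steps apart, so six corners
    suffice.\<close>
  have antipode: "p (k + 6) = 2 * ?c - p k" for k
  proof -
    have "2 * pi * real_of_int (k + 6) / real 12 = 2 * pi * real_of_int k / real 12 + pi"
      by (simp add: field_simps)
    then have "cis (2 * pi * real_of_int (k + 6) / real 12) = - cis (2 * pi * real_of_int k / real 12)"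
      by (simp only: cis_mult[symmetric] cis_pi) simp
    then show ?thesis by (simp add: p_def ngon_def q)
  qed
  obtain a0 where a0: "a0 \<in> D" using D(2) by fastforce
  define ro where "ro i z = ?c + \<omega> ^ i * (z - ?c)" for i :: nat and z
  have ro_G: "ro i \<in> G" for i
  proof (induction i)
    case 0
    have "ro 0 = id" by (auto simp: ro_def)
    then show ?case using id_G by metis
  next
    case (Suc i)
    have "ro (Suc i) = rot ?c \<circ> ro i" by (auto simp: ro_def rot_def)
    then show ?case using G_comp rot_G[OF D] Suc by metis
  qed
  \<comment> \<open>One corner from each antipodal pair, and \<open>c\<close> turned by 0, 60 and
    120 degrees.\<close>
  define S where "S = (\<lambda>k. p (int k)) ` {..<6} \<union> (\<lambda>i. ro i c) ` {..<3}"
  have "finite S" by (simp add: S_def)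
  moreover have "card S \<le> 9"
  proof -
    have "card S \<le> card ((\<lambda>k. p (int k)) ` {..<6::nat}) + card ((\<lambda>i. ro i c) ` {..<3::nat})"
      unfolding S_def by (rule card_Un_le)
    also have "\<dots> \<le> card {..<6::nat} + card {..<3::nat}"
      by (intro add_mono card_image_le) auto
    finally show ?thesis by simp
  qed
  moreover have "S \<subseteq> tverts T"
    using tile_vertex[OF D(1) cyc_param_mem[OF p]] G_vertex[OF ro_G c(1)] by (auto simp: S_def)
  moreover have "\<exists>r\<in>S. \<exists>f\<in>G. half_turn_or_translation f \<and> f r = v" if v: "v \<in> tverts T" for v
  proof (cases "v \<in> Z")
    case True
    then obtain E where E: "E \<in> T" "card E = 12" "v \<in> E" by (auto simp: Z_def)
    have fin: "finite E" "E \<noteq> {}" "finite D" "D \<noteq> {}" using tile_finite D E a0 by auto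
    define t where "t = (\<lambda>z. z + (centroid E - ?c))"
    have t: "t \<in> G" using translation_G[OF D E(1,2)] by (simp add: t_def)
    have tD: "t ` D = E"
    proof (rule tile_centroid_eq)
      show "centroid (t ` D) = centroid E" using isom_centroid[OF G_isom[OF t] fin(3,4)] by (simp add: t_def)
    qed (use G_tile[OF t D(1)] E in auto)
    obtain x where x: "x \<in> D" "v = t x" using tD E(3) by blast
    obtain k where k: "x = p k" using x(1) p by (auto simp: cyc_param_def)
    define m where "m = nat (k mod 12)"
    have m: "int m = k mod 12" "m < 12" by (simp_all add: m_def nat_less_iff)
    have "int 12 dvd k - int m" unfolding m(1) by (simp add: dvd_minus_mod)
    then have xm: "x = p (int m)" using k cyc_param_eq[OF p] by simp
    show ?thesis
    proof (cases "m < 6")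
      case True
      then have "x \<in> S" using xm by (auto simp: S_def)
      moreover have "half_turn_or_translation t" by (auto simp: half_turn_or_translation_def t_def)
      ultimately show ?thesis using t x(2) by blast
    next
      case False
      define g where "g = t \<circ> (\<lambda>z. 2 * ?c - z)"
      have "g = (\<lambda>z. (?c + centroid E) - z)" by (auto simp: g_def t_def)
      then have "half_turn_or_translation g" by (auto simp: half_turn_or_translation_def)
      moreover have "g \<in> G" using G_comp[OF t neg_G[OF D]] by (simp add: g_def)
      moreover have "int m = int (m - 6) + 6" using False by simp
      then have "x = 2 * ?c - p (int (m - 6))" using xm antipode by metis
      then have "g (p (int (m - 6))) = v" using x(2) by (simp add: g_def)
      moreover have "p (int (m - 6)) \<in> S" using m(2) by (auto simp: S_def)
      ultimately show ?thesis by blast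
    qed
  next
    case False
    obtain f where f: "f \<in> G" "f c = v" using G_transitive[of c v] c v False by metis
    have "\<exists>b u. direct b u \<in> G \<and> direct b u c = v"
      using G_isom[OF f(1)]
    proof (cases rule: isom_cases)
      case (direct b u)
      then show ?thesis using f by blast
    next
      case (opposite b' u')
      \<comment> \<open>The mirror fixes \<open>c\<close>, so composing with it changes the
        orientation but not the image of \<open>c\<close>.\<close>
      have "f \<circ> opposite b u = direct (b' + u' * cnj b) (u' * cnj u)"
        by (rule ext) (simp add: opposite opposite_def direct_def algebra_simps)
      moreover have "f \<circ> opposite b u \<in> G" using G_comp f(1) r(1) by blast
      moreover have "(f \<circ> opposite b u) c = v" using r(2) f(2) by simp
      ultimately show ?thesis by metis
    qed
    then obtain b u where bu: "direct b u \<in> G" "direct b u c = v" by blast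
    obtain g i where g: "g \<in> G" "half_turn_or_translation g" "i < (3::nat)"
      "\<And>z. direct b u z = g (?c + \<omega> ^ i * (z - ?c))"
      using direct_symmetry[OF D bu(1)] by metis
    have "ro i c \<in> S" using g(3) by (auto simp: S_def)
    moreover have "g (ro i c) = v" using g(4)[of c] bu(2) by (simp add: ro_def)
    ultimately show ?thesis using g by blast
  qed
  ultimately show ?thesis using that by blast
qed

end

subsection \<open>The group of the torus\<close>

lemma map_aut_bij: "map_aut V E F g \<Longrightarrow> bij g"
proof -
  assume g: "map_aut V E F g"
  have V: "bij_betw g V V" and out: "\<And>x. x \<notin> V \<Longrightarrow> g x = x" using g by (auto simp: map_aut_def)
  have "bij_betw g (- V) (- V)"
    using out by (auto simp: bij_betw_def inj_on_def image_def)
  then have "bij_betw g (V \<union> - V) (V \<union> - V)" using V by (intro bij_betw_combine) auto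
  then show ?thesis by simp
qed

text \<open>A group element \<open>g\<close> moves only vertices; \<open>h g\<close> is its cellular
  action on the plane, and \<open>q\<close> is the projection to the torus. Both are the witnesses
  in \<open>quotient_is_torus\<close>, given names.\<close>

locale torus_action = tiling_3464_4612 +
  fixes \<Gamma> :: "(complex \<Rightarrow> complex) set" and h :: "(complex \<Rightarrow> complex) \<Rightarrow> complex \<Rightarrow> complex"
    and q :: "complex \<Rightarrow> complex \<times> complex"
  assumes free: "free_aut_subgroup T \<Gamma>"
    and h_id: "h id = id"
    and h_homeo: "\<And>g. g \<in> \<Gamma> \<Longrightarrow> homeomorphism UNIV UNIV (h g) (h (inv g))"
    and h_comp: "\<And>g g'. g \<in> \<Gamma> \<Longrightarrow> g' \<in> \<Gamma> \<Longrightarrow> h (g \<circ> g') = h g \<circ> h g'"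
    and h_vertex: "\<And>g v. g \<in> \<Gamma> \<Longrightarrow> v \<in> tverts T \<Longrightarrow> h g v = g v"
    and h_edge: "\<And>g P a b. g \<in> \<Gamma> \<Longrightarrow> P \<in> T \<Longrightarrow> poly_edge P a b \<Longrightarrow>
        h g ` closed_segment a b = closed_segment (g a) (g b)"
    and h_tile: "\<And>g P. g \<in> \<Gamma> \<Longrightarrow> P \<in> T \<Longrightarrow> h g ` (convex hull P) = convex hull (g ` P)"
    and q_map: "quotient_map euclidean torus_top q"
    and q_eq: "\<And>x y. q x = q y \<longleftrightarrow> (\<exists>g\<in>\<Gamma>. h g x = y)"
begin

lemma \<Gamma>_aut: "g \<in> \<Gamma> \<Longrightarrow> aut g"
  using free by (simp add: free_aut_subgroup_def)

lemma \<Gamma>_comp: "g \<in> \<Gamma> \<Longrightarrow> g' \<in> \<Gamma> \<Longrightarrow> g \<circ> g' \<in> \<Gamma>"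
  using free by (simp add: free_aut_subgroup_def)

lemma \<Gamma>_inv: "g \<in> \<Gamma> \<Longrightarrow> inv g \<in> \<Gamma>"
  using free by (simp add: free_aut_subgroup_def)

lemma \<Gamma>_free_vertex: "g \<in> \<Gamma> \<Longrightarrow> v \<in> tverts T \<Longrightarrow> g v = v \<Longrightarrow> g = id"
  using free unfolding free_aut_subgroup_def by blast

lemma \<Gamma>_free_tile: "g \<in> \<Gamma> \<Longrightarrow> P \<in> T \<Longrightarrow> g ` P = P \<Longrightarrow> g = id"
  using free unfolding free_aut_subgroup_def by blast

lemma \<Gamma>_free_edge:
  assumes "g \<in> \<Gamma>" "P \<in> T" "poly_edge P a b" "g ` {a, b} = {a, b}"
  shows "g = id"
proof -
  have "{a, b} \<in> tedges T" using assms by (auto simp: tedges_def)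
  then show ?thesis using free assms(1,4) unfolding free_aut_subgroup_def by blast
qed

lemma \<Gamma>_bij: "g \<in> \<Gamma> \<Longrightarrow> bij g"
  using map_aut_bij \<Gamma>_aut by blast

lemma \<Gamma>_vertex: "g \<in> \<Gamma> \<Longrightarrow> v \<in> tverts T \<Longrightarrow> g v \<in> tverts T"
  using \<Gamma>_aut[of g] unfolding map_aut_def by (metis bij_betwE)

text \<open>By freeness on vertices, an element is known by the image of a single vertex.\<close>

lemma \<Gamma>_eq:
  assumes g: "g \<in> \<Gamma>" "g' \<in> \<Gamma>" and v: "v \<in> tverts T" "g v = g' v" shows "g = g'"
proof -
  have b: "bij g'" using \<Gamma>_bij[OF g(2)] .
  have "(inv g' \<circ> g) v = v" using v(2) b by (simp add: bij_is_inj)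
  then have "inv g' \<circ> g = id" using \<Gamma>_free_vertex[OF \<Gamma>_comp[OF \<Gamma>_inv[OF g(2)] g(1)] v(1)] by blast
  then have "g' \<circ> (inv g' \<circ> g) = g'" by simp
  then show ?thesis using b by (simp add: o_assoc[symmetric] surj_iff[symmetric] bij_is_surj fun_eq_iff surj_f_inv_f)
qed

text \<open>\<open>F\<close> is kept abstract because it is needed twice: as \<open>h g\<close>, for
  freeness of the action by homeomorphisms, and as the isometry extending \<open>g\<close>.\<close>

lemma \<Gamma>_free_cell:
  assumes g: "g \<in> \<Gamma>" and x: "F x = x"
    and F: "\<And>P. P \<in> T \<Longrightarrow> F ` (convex hull P) = convex hull (g ` P)"
      "\<And>v. v \<in> tverts T \<Longrightarrow> F v = g v"
      "\<And>P a b. P \<in> T \<Longrightarrow> poly_edge P a b \<Longrightarrow> F ` closed_segment a b = closed_segment (g a) (g b)"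
  shows "g = id"
proof -
  obtain P where P: "P \<in> T" "x \<in> convex hull P" using tiles_cover by blast
  have gP: "g ` P \<in> T" using aut_tile[OF \<Gamma>_aut[OF g] P(1)] .
  have "g ` P = P \<or> (\<exists>v\<in>P. g v = v) \<or> (\<exists>a b. poly_edge P a b \<and> g ` {a, b} = {a, b})"
    by (rule cellular_fixed_point[OF P(1) gP P(2) x F(1)[OF P(1)]])
      (use F(2) tile_vertex[OF P(1)] F(3)[OF P(1)] aut_edge[OF \<Gamma>_aut[OF g] P(1)] in blast)+
  then show ?thesis
    using \<Gamma>_free_tile[OF g P(1)] \<Gamma>_free_vertex[OF g tile_vertex[OF P(1)]] \<Gamma>_free_edge[OF g P(1)] by blast
qed

lemma h_free: "g \<in> \<Gamma> \<Longrightarrow> h g x = x \<Longrightarrow> g = id"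
  by (rule \<Gamma>_free_cell[where F = "h g" and x = x]) (assumption | rule h_tile h_vertex h_edge)+

section \<open>The quotient map as a covering\<close>

lemma h_continuous: "g \<in> \<Gamma> \<Longrightarrow> continuous_on S (h g)"
  using h_homeo[of g] by (metis continuous_on_subset homeomorphism_cont1 subset_UNIV)

lemma h_open: "g \<in> \<Gamma> \<Longrightarrow> open U \<Longrightarrow> open (h g ` U)"
  using homeomorphism_imp_open_map[OF h_homeo[of g], of U] by simp

lemma h_inv: "g \<in> \<Gamma> \<Longrightarrow> h (inv g) (h g x) = x" "g \<in> \<Gamma> \<Longrightarrow> h g (h (inv g) x) = x"
  using h_homeo[of g] by (auto simp: homeomorphism_def)

lemma finite_transporters: "P \<in> T \<Longrightarrow> Q \<in> T \<Longrightarrow> finite {g \<in> \<Gamma>. g ` P = Q}"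
proof -
  assume P: "P \<in> T" and Q: "Q \<in> T"
  have "P \<noteq> {}" using tile_card[OF P] by auto
  then obtain a where a: "a \<in> P" by blast
  have "inj_on (\<lambda>g. g a) {g \<in> \<Gamma>. g ` P = Q}"
    using \<Gamma>_eq tile_vertex[OF P a] by (auto intro!: inj_onI)
  moreover have "(\<lambda>g. g a) ` {g \<in> \<Gamma>. g ` P = Q} \<subseteq> Q" using a by auto
  ultimately show ?thesis using tile_finite[OF Q] by (meson inj_on_finite)
qed

text \<open>By local finiteness and \<open>finite_transporters\<close>, only finitely many elements
  can bring a point of \<open>ball x 1\<close> back into it. Each of them other than
  \<open>id\<close> moves \<open>x\<close>, and one small radius serves them all.\<close>

lemma properly_discontinuous:
  obtains e where "e > 0" "\<And>g. g \<in> \<Gamma> \<Longrightarrow> g \<noteq> id \<Longrightarrow> h g ` ball x e \<inter> ball x e = {}"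
proof -
  define N where "N = {P \<in> T. convex hull P \<inter> ball x 1 \<noteq> {}}"
  have N: "finite N" unfolding N_def by (rule locally_finite) simp
  define K where "K = (\<Union>P\<in>N. \<Union>Q\<in>N. {g \<in> \<Gamma>. g ` P = Q}) - {id}"
  have K: "finite K" unfolding K_def using N finite_transporters by (auto simp: N_def)
  have each: "eventually (\<lambda>e. h g ` ball x e \<inter> ball x e = {}) (at_right 0)" if g: "g \<in> K" for g
  proof -
    have g: "g \<in> \<Gamma>" "g \<noteq> id" using g by (auto simp: K_def)
    define d where "d = dist (h g x) x"
    have d: "d > 0" using h_free[OF g(1)] g(2) by (auto simp: d_def)
    obtain \<delta> where \<delta>: "\<delta> > 0" "\<And>y. dist y x < \<delta> \<Longrightarrow> dist (h g y) (h g x) < d / 2"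
      using h_continuous[OF g(1), of UNIV] d unfolding continuous_on_iff
      by (metis UNIV_I half_gt_zero)
    show ?thesis
    proof (rule eventually_at_rightI[of 0 "min \<delta> (d / 2)"])
      fix e assume e: "e \<in> {0<..<min \<delta> (d / 2)}"
      show "h g ` ball x e \<inter> ball x e = {}"
      proof (rule ccontr)
        assume "\<not> ?thesis"
        then obtain y where y: "dist y x < e" "dist (h g y) x < e"
          by (auto simp: dist_commute)
        have "dist (h g x) x \<le> dist (h g y) (h g x) + dist (h g y) x"
          by (metis dist_commute dist_triangle)
        then show False using \<delta>(2)[of y] y e by (simp add: d_def)
      qed
    qed (use \<delta> d in simp)
  qed
  have "eventually (\<lambda>e. \<forall>g\<in>K. h g ` ball x e \<inter> ball x e = {}) (at_right 0)"
    by (intro eventually_ball_finite[OF K] ballI each)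
  moreover have "eventually (\<lambda>e::real. 0 < e \<and> e < 1) (at_right 0)"
    by (rule eventually_at_rightI[of 0 1]) auto
  ultimately have "eventually (\<lambda>e. (\<forall>g\<in>K. h g ` ball x e \<inter> ball x e = {}) \<and> 0 < e \<and> e < 1) (at_right 0)"
    by (rule eventually_conj)
  then obtain e where e: "\<forall>g\<in>K. h g ` ball x e \<inter> ball x e = {}" "0 < e" "e < 1"
    using eventually_happens'[OF trivial_limit_at_right_real] by blast
  have "h g ` ball x e \<inter> ball x e = {}" if g: "g \<in> \<Gamma>" "g \<noteq> id" for g
  proof (rule ccontr)
    assume ne: "\<not> ?thesis"
    then obtain y where y: "y \<in> ball x e" "h g y \<in> ball x e" by blast
    obtain P where P: "P \<in> T" "y \<in> convex hull P" using tiles_cover by blast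
    have gP: "g ` P \<in> T" using aut_tile[OF \<Gamma>_aut[OF g(1)] P(1)] .
    have "h g y \<in> convex hull (g ` P)" using h_tile[OF g(1) P(1)] P(2) by blast
    then have "P \<in> N" "g ` P \<in> N" using P gP y e(3) by (auto simp: N_def)
    then have "g \<in> K" using g by (auto simp: K_def)
    then show False using e(1) ne by blast
  qed
  then show ?thesis using that e(2) by blast
qed

definition torus :: "(complex \<times> complex) set" where
  "torus = sphere 0 1 \<times> sphere 0 1"

lemma torus_top_eq: "torus_top = top_of_set torus"
  unfolding torus_top_def torus_def
  by (metis prod_topology_euclidean subtopology_Times)

lemma q_range: "q ` UNIV = torus"
  using q_map by (simp add: quotient_map_def torus_top_eq)

lemma q_continuous: "continuous_on UNIV q"
  using quotient_imp_continuous_map[OF q_map] by (simp add: torus_top_eq continuous_map_in_subtopology)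

lemma q_preimage_image: "{x. q x \<in> q ` U} = (\<Union>g\<in>\<Gamma>. h g ` U)"
proof -
  have "q x \<in> q ` U \<longleftrightarrow> (\<exists>y\<in>U. q y = q x)" for x by (metis imageE imageI)
  then show ?thesis using q_eq by (auto simp: image_iff)
qed

lemma q_open: "open U \<Longrightarrow> openin (top_of_set torus) (q ` U)"
proof -
  assume U: "open U"
  have "q ` U \<subseteq> torus" using q_range by blast
  moreover have "open {x. q x \<in> q ` U}" unfolding q_preimage_image using h_open[OF _ U] by blast
  ultimately show ?thesis using q_map by (simp add: quotient_map_def torus_top_eq)
qed

text \<open>The sheets over the image of a small ball are the translates of the ball under
  \<open>h\<close>; they are disjoint by the choice of the radius, and \<open>q\<close> is injective
  and open on each.\<close>

lemma q_covering: "covering_space UNIV q torus"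
  unfolding covering_space_def
proof (intro conjI ballI q_continuous q_range)
  fix y assume "y \<in> torus"
  then obtain x where x: "y = q x" using q_range by blast
  obtain e where e: "e > 0" "\<And>g. g \<in> \<Gamma> \<Longrightarrow> g \<noteq> id \<Longrightarrow> h g ` ball x e \<inter> ball x e = {}"
    using properly_discontinuous[of x] by blast
  let ?B = "ball x e"
  let ?v = "(\<lambda>g. h g ` ?B) ` \<Gamma>"
  have disj: "g = g'" if g: "g \<in> \<Gamma>" "g' \<in> \<Gamma>" "h g ` ?B \<inter> h g' ` ?B \<noteq> {}" for g g'
  proof -
    obtain a b where ab: "a \<in> ?B" "b \<in> ?B" "h g a = h g' b" using g(3) by blast
    have k: "inv g' \<circ> g \<in> \<Gamma>" using \<Gamma>_comp \<Gamma>_inv g by blast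
    have "h (inv g' \<circ> g) a = b" using h_comp[OF \<Gamma>_inv[OF g(2)] g(1)] ab(3) h_inv(1)[OF g(2)] by simp
    then have "inv g' \<circ> g = id" using e(2)[OF k] ab by blast
    then have "g' \<circ> (inv g' \<circ> g) = g'" by simp
    then show ?thesis using \<Gamma>_bij[OF g(2)] by (simp add: fun_eq_iff bij_is_surj surj_f_inv_f)
  qed
  show "\<exists>Y. y \<in> Y \<and> openin (top_of_set torus) Y \<and>
      (\<exists>v. \<Union>v = UNIV \<inter> q -` Y \<and> (\<forall>u\<in>v. openin (top_of_set UNIV) u) \<and> pairwise disjnt v \<and>
           (\<forall>u\<in>v. \<exists>k. homeomorphism u Y q k))"
  proof (intro exI[of _ "q ` ?B"] conjI exI[of _ ?v] ballI)
    show "y \<in> q ` ?B" using x e(1) by simp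
    show "openin (top_of_set torus) (q ` ?B)" using q_open by simp
    show "\<Union>?v = UNIV \<inter> q -` (q ` ?B)"
      using q_preimage_image[of ?B] unfolding vimage_def by simp
    show "openin (top_of_set UNIV) u" if "u \<in> ?v" for u using that h_open by auto
    show "pairwise disjnt ?v" unfolding pairwise_def disjnt_def using disj by blast
    show "\<exists>k. homeomorphism u (q ` ?B) q k" if "u \<in> ?v" for u
    proof -
      obtain g where g: "g \<in> \<Gamma>" "u = h g ` ?B" using \<open>u \<in> ?v\<close> by blast
      have ou: "open u" using h_open g by simp
      have "q (h g z) = q z" for z using q_eq g(1) by metis
      then have im: "q ` u = q ` ?B" unfolding g(2) by (simp add: image_image)
      have inj: "inj_on q u"
      proof (rule inj_onI)
        fix a b assume ab: "a \<in> u" "b \<in> u" "q a = q b"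
        then obtain k where k: "k \<in> \<Gamma>" "h k a = b" using q_eq by blast
        have "b \<in> h (k \<circ> g) ` ?B" using ab(1) k g h_comp[OF k(1) g(1)] by auto
        then have "k \<circ> g = g" using disj[OF \<Gamma>_comp[OF k(1) g(1)] g(1)] ab(2) g(2) by blast
        then have "k = id" using \<Gamma>_bij[OF g(1)] by (metis bij_is_surj comp_id comp_assoc surj_iff)
        then show "a = b" using k(2) h_id by simp
      qed
      have "openin (top_of_set (q ` ?B)) (q ` U)" if U: "openin (top_of_set u) U" for U
      proof -
        have "open U" "U \<subseteq> u" using U ou openin_open_eq by (auto simp: openin_open_eq)
        then have "openin (top_of_set torus) (q ` U)" "q ` U \<subseteq> q ` ?B" using q_open im by blast+
        moreover have "q ` ?B \<subseteq> torus" using q_range by blast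
        ultimately show ?thesis using openin_subset_trans by blast
      qed
      then obtain k where "homeomorphism u (q ` ?B) q k"
        using homeomorphism_injective_open_map[OF continuous_on_subset[OF q_continuous] im inj] by blast
      then show ?thesis by blast
    qed
  qed
qed

text \<open>The images of the balls about 0 are open and cover the compact torus, so a ball of some
  fixed radius meets every orbit.\<close>

lemma cocompact:
  obtains N where "\<And>v. v \<in> tverts T \<Longrightarrow> \<exists>g\<in>\<Gamma>. norm (g v) < N"
proof -
  have "compact torus" unfolding torus_def by (intro compact_Times) auto
  let ?C = "range (\<lambda>n. q ` ball 0 (real n))"
  have "\<forall>c\<in>?C. openin (top_of_set torus) c" using q_open by auto
  moreover have "torus \<subseteq> \<Union>?C"
  proof
    fix y assume "y \<in> torus"
    then obtain x where x: "y = q x" using q_range by blast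
    obtain n where "norm x < real n" using reals_Archimedean2 by blast
    then have "q x \<in> q ` ball 0 (real n)" by (intro imageI) simp
    then show "y \<in> \<Union>?C" using x by blast
  qed
  ultimately obtain D where D: "D \<subseteq> ?C" "finite D" "torus \<subseteq> \<Union>D"
    using \<open>compact torus\<close> unfolding compact_eq_openin_cover by meson
  obtain M where M: "finite M" "D = (\<lambda>n. q ` ball 0 (real n)) ` M"
    using finite_subset_image[OF D(2,1)] by blast
  define N where "N = real (Max (insert 0 M))"
  have "\<exists>g\<in>\<Gamma>. norm (g v) < N" if v: "v \<in> tverts T" for v
  proof -
    have "q v \<in> torus" using q_range by blast
    then obtain n where n: "n \<in> M" "q v \<in> q ` ball 0 (real n)" using D(3) M(2) by blast
    then obtain y where y: "q v = q y" "norm y < real n" by auto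
    obtain g where g: "g \<in> \<Gamma>" "h g v = y" using q_eq y(1) by blast
    have "real n \<le> N" using n(1) M(1) by (simp add: N_def)
    then show ?thesis using g y(2) h_vertex[OF g(1) v] by (intro bexI[of _ g]) auto
  qed
  then show ?thesis using that by blast
qed

text \<open>Lifting \<open>q\<close> to the universal cover of the torus gives an injective map \<open>Q\<close> on which the group acts by
  translations; hence the group is commutative.\<close>

lemma \<Gamma>_commute:
  assumes g: "g \<in> \<Gamma>" "g' \<in> \<Gamma>" and v: "v \<in> tverts T"
  shows "g (g' v) = g' (g v)"
proof -
  have sc: "simply_connected (UNIV :: complex set)" "locally path_connected (UNIV :: complex set)"
    by (simp_all add: convex_imp_simply_connected convex_imp_locally_path_connected)
  have sc': "simply_connected (UNIV :: (real \<times> real) set)" "locally path_connected (UNIV :: (real \<times> real) set)"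
    by (simp_all add: convex_imp_simply_connected convex_imp_locally_path_connected)
  have qs: "q x \<in> torus" for x using q_range by blast
  then have n1: "norm (fst (q x)) = 1" "norm (snd (q x)) = 1" for x
    by (simp_all add: torus_def mem_Times_iff)
  have "continuous_on UNIV (\<lambda>x. fst (q x))" "continuous_on UNIV (\<lambda>x. snd (q x))"
    using q_continuous by (auto intro: continuous_intros)
  moreover have "fst (q x) \<noteq> 0" "snd (q x) \<noteq> 0" for x using n1[of x] by auto
  \<comment> \<open>Logarithms exist because the plane is simply connected. They are purely
    imaginary, as both coordinates lie on the unit circle, so \<open>Q\<close> lifts
    \<open>q\<close> through the universal covering \<open>E\<close>.\<close>
  ultimately obtain L1 L2 where L: "continuous_on UNIV L1" "\<And>x. fst (q x) = exp (L1 x)"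
     "continuous_on UNIV L2" "\<And>x. snd (q x) = exp (L2 x)"
    using continuous_logarithm_on_simply_connected[OF _ sc] by (metis UNIV_I)
  have Re0: "Re (L1 x) = 0" "Re (L2 x) = 0" for x
    using n1[of x] by (simp_all add: L norm_exp_eq_Re)
  define Q where "Q x = (Im (L1 x), Im (L2 x))" for x
  define E where "E y = (cis (fst y), cis (snd y))" for y :: "real \<times> real"
  have Qc: "continuous_on UNIV Q" unfolding Q_def using L(1,3) by (intro continuous_intros) auto
  have Ec: "continuous_on UNIV E" unfolding E_def
    by (intro continuous_on_Pair continuous_on_cis continuous_intros)
  have EQ: "E (Q x) = q x" for x
  proof (rule prod_eqI)
    show "fst (E (Q x)) = fst (q x)" "snd (E (Q x)) = snd (q x)"
      using Re0[of x] by (simp_all add: E_def Q_def L exp_eq_polar)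
  qed
  have "E \<in> UNIV \<rightarrow> torus" by (simp add: E_def torus_def)
  \<comment> \<open>Conversely \<open>E\<close> lifts through the covering \<open>q\<close>. Then
    \<open>p \<circ> Q\<close> is a lift of \<open>q\<close> through itself, hence equal to some
    \<open>h k\<close>, and \<open>Q\<close> is injective.\<close>
  then obtain p where p: "continuous_on UNIV p" "\<And>y. q (p y) = E y"
    using covering_space_lift[OF q_covering sc' Ec] by (metis UNIV_I)
  have "q 0 = q (p (Q 0))" using p EQ by simp
  then obtain k where k: "k \<in> \<Gamma>" "h k 0 = p (Q 0)" using q_eq by blast
  have pQ: "p (Q x) = h k x" for x
  proof (rule covering_space_lift_unique[OF q_covering, of "\<lambda>x. p (Q x)" 0 "h k" UNIV q x])
    show "continuous_on UNIV (\<lambda>x. p (Q x))"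
      by (rule continuous_on_compose2[OF p(1) Qc]) simp
    show "q x = q (h k x)" for x using q_eq k(1) by blast
  qed (use k q_continuous qs h_continuous[OF k(1)] p EQ in auto)
  have Qinj: "x = y" if "Q x = Q y" for x y using pQ h_inv(1)[OF k(1)] that by metis
  \<comment> \<open>The difference is continuous with values in the integer multiples of
    \<open>2 * pi\<close>, hence constant.\<close>
  have shift: "\<exists>c. \<forall>x. f (h g x) = f x + (c::real)"
    if f: "continuous_on UNIV f" "\<And>x y. q x = q y \<Longrightarrow> cis (f x) = cis (f y)" and g: "g \<in> \<Gamma>" for f g
  proof -
    have "(\<lambda>x. f (h g x) - f x) constant_on UNIV"
    proof (rule continuous_discrete_range_constant)
      show "continuous_on UNIV (\<lambda>x. f (h g x) - f x)"
        by (intro continuous_intros continuous_on_compose2[OF f(1) h_continuous[OF g]] f(1)) auto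
      have int: "\<exists>m::int. f (h g x) - f x = 2 * pi * m" for x
      proof -
        have "q (h g x) = q x" using q_eq g by metis
        then have "cis (f (h g x)) = cis (f x)" by (rule f(2))
        then show ?thesis unfolding cis_eq_iff_int by auto
      qed
      show "\<exists>e>0. \<forall>y. y \<in> UNIV \<and> f (h g y) - f y \<noteq> f (h g x) - f x \<longrightarrow>
          e \<le> norm (f (h g y) - f y - (f (h g x) - f x))" for x
      proof (intro exI[of _ "2 * pi"] conjI allI impI)
        fix y assume y: "y \<in> UNIV \<and> f (h g y) - f y \<noteq> f (h g x) - f x"
        obtain m m' :: int where m: "f (h g x) - f x = 2 * pi * m" "f (h g y) - f y = 2 * pi * m'"
          using int by meson
        then have "m' \<noteq> m" using y by auto
        then have "1 \<le> \<bar>real_of_int (m' - m)\<bar>" by linarith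
        then have "2 * pi * 1 \<le> 2 * pi * \<bar>real_of_int (m' - m)\<bar>" by (intro mult_left_mono) auto
        also have "\<dots> = \<bar>2 * pi * real_of_int (m' - m)\<bar>" by (simp add: abs_mult)
        also have "2 * pi * real_of_int (m' - m) = f (h g y) - f y - (f (h g x) - f x)"
          unfolding m by (simp add: algebra_simps)
        finally show "2 * pi \<le> norm (f (h g y) - f y - (f (h g x) - f x))" by simp
      qed simp
    qed (rule connected_UNIV)
    then obtain c where "\<And>x. f (h g x) - f x = c" unfolding constant_on_def by blast
    then show ?thesis by (intro exI[of _ c]) (simp add: algebra_simps)
  qed
  have "\<exists>c. \<forall>x. Q (h g x) = Q x + c" if g: "g \<in> \<Gamma>" for g
  proof -
    have cc: "cis (Im (L1 x)) = cis (Im (L1 y))" "cis (Im (L2 x)) = cis (Im (L2 y))" if "q x = q y" for x y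
    proof -
      have "E (Q x) = E (Q y)" unfolding EQ using that .
      then show "cis (Im (L1 x)) = cis (Im (L1 y))" "cis (Im (L2 x)) = cis (Im (L2 y))"
        by (simp_all add: E_def Q_def)
    qed
    obtain c1 where c1: "\<And>x. Im (L1 (h g x)) = Im (L1 x) + c1"
      using shift[of "\<lambda>x. Im (L1 x)", OF _ cc(1) g] L(1) by (metis continuous_on_Im)
    obtain c2 where c2: "\<And>x. Im (L2 (h g x)) = Im (L2 x) + c2"
      using shift[of "\<lambda>x. Im (L2 x)", OF _ cc(2) g] L(3) by (metis continuous_on_Im)
    show ?thesis by (intro exI[of _ "(c1, c2)"]) (simp add: Q_def c1 c2)
  qed
  then obtain c c' where "\<And>x. Q (h g x) = Q x + c" "\<And>x. Q (h g' x) = Q x + c'" using g by meson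
  then have "Q (h g (h g' v)) = Q (h g' (h g v))" by (simp add: add_ac)
  then have "h g (h g' v) = h g' (h g v)" by (rule Qinj)
  then show ?thesis using h_vertex g v \<Gamma>_vertex by simp
qed

section \<open>From commutativity to translations\<close>

lemma isom_eq_on_vertices:
  assumes "isom f" "isom f'" "\<And>v. v \<in> tverts T \<Longrightarrow> f v = f' v"
  shows "f = f'"
proof -
  obtain P where P: "P \<in> T" using tiles_cover by blast
  show ?thesis
    by (rule isom_regular_eq[OF assms(1,2) tile_regular[OF P]]) (rule assms(3)[OF tile_vertex[OF P]])
qed

text \<open>The isometry maps segments and tiles as \<open>g\<close> prescribes, so
  \<open>\<Gamma>_free_cell\<close> applies to it: the realisation by isometries is free as
  well.\<close>

lemma \<Gamma>_isom_fixed_point: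
  assumes "g \<in> \<Gamma>" "isom f" "\<And>v. v \<in> tverts T \<Longrightarrow> g v = f v" "f x = x"
  shows "f = id"
proof -
  have "g = id"
  proof (rule \<Gamma>_free_cell[where F = f and x = x])
    fix P assume P: "P \<in> T"
    have "f ` P = g ` P" using assms(3) tile_vertex[OF P] by (intro image_cong) auto
    then show "f ` (convex hull P) = convex hull (g ` P)" using isom_convex_hull[OF assms(2)] by simp
  next
    fix P a b assume P: "P \<in> T" "poly_edge P a b"
    then have "a \<in> tverts T" "b \<in> tverts T" using tile_vertex by (auto simp: poly_edge_def)
    then show "f ` closed_segment a b = closed_segment (g a) (g b)"
      using isom_segment[OF assms(2)] assms(3) by simp
  qed (use assms in auto)
  then show ?thesis using isom_eq_on_vertices[OF assms(2), of id] assms(3) by (simp add: isom_def)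
qed

lemma \<Gamma>_isoms_commute:
  assumes "g \<in> \<Gamma>" "isom f" "\<And>v. v \<in> tverts T \<Longrightarrow> g v = f v"
    and "g' \<in> \<Gamma>" "isom f'" "\<And>v. v \<in> tverts T \<Longrightarrow> g' v = f' v"
  shows "f (f' z) = f' (f z)"
proof -
  have "f \<circ> f' = f' \<circ> f"
  proof (rule isom_eq_on_vertices)
    fix v assume v: "v \<in> tverts T"
    show "(f \<circ> f') v = (f' \<circ> f) v"
      using \<Gamma>_commute[OF assms(1,4) v] assms(3,6) \<Gamma>_vertex[OF assms(1) v] \<Gamma>_vertex[OF assms(4) v] v by simp
  qed (use isom_comp assms in auto)
  then show ?thesis by (metis comp_apply)
qed

text \<open>Freeness excludes rotations. For a glide reflection, commutativity makes the distance to
  its axis constant along orbits and cocompactness bounds it, so the plane would lie in a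
  strip.\<close>

lemma \<Gamma>_translation:
  assumes g: "g \<in> \<Gamma>"
  shows "\<exists>w. \<forall>v\<in>tverts T. g v = v + w"
proof -
  obtain f where f: "isom f" "\<And>v. v \<in> tverts T \<Longrightarrow> g v = f v" using aut_isom[OF \<Gamma>_aut[OF g]] by metis
  from f(1) show ?thesis
  proof (cases rule: isom_cases)
    case (direct b u)
    show ?thesis
    proof (cases "u = 1")
      case True
      then show ?thesis using f(2) by (intro exI[of _ b]) (simp add: direct direct_def)
    next
      case False
      then have "f (b / (1 - u)) = b / (1 - u)" by (simp add: direct direct_def field_simps)
      then have "f = id" using \<Gamma>_isom_fixed_point[OF g f] by blast
      then show ?thesis using f(2) by (intro exI[of _ 0]) simp
    qed
  next
    case (opposite b u)
    have nofix: "opposite b u x \<noteq> x" for x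
    proof
      assume "opposite b u x = x"
      then have "f = id" using \<Gamma>_isom_fixed_point[OF g f] opposite by metis
      then have "opposite b u z = z" for z using opposite by simp
      from this[of 0] this[of 1] this[of \<i>] show False by (simp add: opposite_def)
    qed
    let ?k = "(b - u * cnj b) / 2"
    let ?l = "\<lambda>z. z - u * cnj z"
    obtain N where N: "\<And>v. v \<in> tverts T \<Longrightarrow> \<exists>g\<in>\<Gamma>. norm (g v) < N" using cocompact by blast
    define M where "M = 2 * N + norm ?k"
    have bound: "norm (?l v - ?k) \<le> M" if v: "v \<in> tverts T" for v
    proof -
      obtain g' where g': "g' \<in> \<Gamma>" "norm (g' v) < N" using N[OF v] by blast
      obtain f' where f': "isom f'" "\<And>v. v \<in> tverts T \<Longrightarrow> g' v = f' v" using aut_isom[OF \<Gamma>_aut[OF g'(1)]] by metis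
      have "f' = id \<or> (\<forall>x. f' x \<noteq> x)" using \<Gamma>_isom_fixed_point[OF g'(1) f'] by blast
      moreover have "opposite b u (f' z) = f' (opposite b u z)" for z
        using \<Gamma>_isoms_commute[OF g f g'(1) f'] opposite by simp
      ultimately have "norm (?l (f' v) - ?k) = norm (?l v - ?k)"
        using commutes_with_glide[OF opposite(1) nofix f'(1)] by blast
      moreover have "norm (?l (f' v) - ?k) \<le> norm (f' v) + norm (u * cnj (f' v)) + norm ?k"
        using norm_triangle_ineq4[of "?l (f' v)" ?k] norm_triangle_ineq4[of "f' v" "u * cnj (f' v)"]
        by linarith
      moreover have "norm (u * cnj (f' v)) = norm (f' v)" using opposite(1) by (simp add: norm_mult)
      moreover have "norm (f' v) < N" using g'(2) f'(2)[OF v] by simp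
      ultimately show ?thesis by (simp add: M_def)
    qed
    have lin: "linear ?l" by (auto intro!: linearI simp: algebra_simps scaleR_conv_of_real)
    \<comment> \<open>A strip is convex, so it contains a tile once it contains the corners.\<close>
    have all: "norm (?l z - ?k) \<le> M" for z
    proof -
      obtain P where P: "P \<in> T" "z \<in> convex hull P" using tiles_cover by blast
      have "convex (?l -` cball ?k M)" using convex_linear_vimage[OF lin] by blast
      moreover have "P \<subseteq> ?l -` cball ?k M"
        using bound tile_vertex[OF P(1)] by (auto simp: dist_norm norm_minus_commute)
      ultimately have "convex hull P \<subseteq> ?l -` cball ?k M" by (rule hull_minimal[rotated])
      then show ?thesis using P(2) by (auto simp: dist_norm norm_minus_commute)
    qed
    obtain x where x: "?l x \<noteq> 0"
    proof -
      \<comment> \<open>The values are \<open>1 - u\<close> and \<open>\<i> * (1 + u)\<close>, which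
        do not vanish together.\<close>
      have "?l 1 \<noteq> 0 \<or> ?l \<i> \<noteq> 0" by (auto simp: complex_eq_iff)
      then show thesis using that by blast
    qed
    \<comment> \<open>Scales \<open>x\<close> until the norm of \<open>?l\<close> is at least
      \<open>M + norm ?k + 1\<close>, outside the strip.\<close>
    define t where "t = (M + norm ?k + 1) / norm (?l x)"
    have "?l (t *\<^sub>R x) = t *\<^sub>R ?l x" using linear_scale[OF lin] by blast
    then have "norm (?l (t *\<^sub>R x)) = \<bar>t\<bar> * norm (?l x)" by (metis norm_scaleR)
    moreover have "\<bar>t\<bar> * norm (?l x) \<ge> M + norm ?k + 1"
    proof -
      have "t * norm (?l x) = M + norm ?k + 1" using x by (simp add: t_def)
      then show ?thesis by (metis abs_ge_self mult_right_mono norm_ge_zero)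
    qed
    moreover have "norm (?l (t *\<^sub>R x)) \<le> norm (?l (t *\<^sub>R x) - ?k) + norm ?k"
      by (metis norm_triangle_sub add.commute)
    ultimately show ?thesis using all[of "t *\<^sub>R x"] by linarith
  qed
qed

end

subsection \<open>Automorphisms of the quotient\<close>

lemma map_aut_comp:
  assumes "map_aut V E F f" "map_aut V E F g" shows "map_aut V E F (f \<circ> g)"
proof -
  have f: "\<sigma> \<in> E \<longleftrightarrow> f ` \<sigma> \<in> E" "\<sigma> \<in> F \<longleftrightarrow> f ` \<sigma> \<in> F" if "\<sigma> \<subseteq> V" for \<sigma>
    using assms(1) that by (simp_all add: map_aut_def)
  have g: "\<sigma> \<in> E \<longleftrightarrow> g ` \<sigma> \<in> E" "\<sigma> \<in> F \<longleftrightarrow> g ` \<sigma> \<in> F" if "\<sigma> \<subseteq> V" for \<sigma>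
    using assms(2) that by (simp_all add: map_aut_def)
  have b: "bij_betw f V V" "bij_betw g V V" using assms by (simp_all add: map_aut_def)
  have sub: "g ` \<sigma> \<subseteq> V" if "\<sigma> \<subseteq> V" for \<sigma>
    using image_mono[OF that] bij_betw_imp_surj_on[OF b(2)] by metis
  have "\<sigma> \<in> E \<longleftrightarrow> (f \<circ> g) ` \<sigma> \<in> E" "\<sigma> \<in> F \<longleftrightarrow> (f \<circ> g) ` \<sigma> \<in> F" if "\<sigma> \<subseteq> V" for \<sigma>
    using g[OF that] f[OF sub[OF that]] by (simp_all only: image_comp[symmetric])
  moreover have "(f \<circ> g) x = x" if "x \<notin> V" for x using assms that by (simp add: map_aut_def)
  ultimately show ?thesis unfolding map_aut_def using bij_betw_trans[OF b(2,1)] by simp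
qed

locale torus_quotient = two_uniform_3464_4612 + torus_action
begin

text \<open>On vertices \<open>g\<close> is a translation: a translation \<open>f\<close> commutes
  with it, a half turn conjugates it to its inverse. The second equation serves the converse
  inclusion in \<open>image_qv\<close>.\<close>

lemma normalises:
  assumes f: "f \<in> G" "half_turn_or_translation f" and g: "g \<in> \<Gamma>"
  obtains g' where "g' \<in> \<Gamma>" "\<And>v. v \<in> tverts T \<Longrightarrow> f (g v) = g' (f v)"
    "\<And>v. v \<in> tverts T \<Longrightarrow> f (g' v) = g (f v)"
proof -
  obtain w where w: "\<And>v. v \<in> tverts T \<Longrightarrow> g v = v + w" using \<Gamma>_translation[OF g] by blast
  obtain w' where w': "\<And>v. v \<in> tverts T \<Longrightarrow> inv g v = v + w'" using \<Gamma>_translation[OF \<Gamma>_inv[OF g]] by blast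
  have fv: "f v \<in> tverts T" if "v \<in> tverts T" for v using G_vertex[OF f(1) that] .
  obtain b where "f = (\<lambda>z. z + b) \<or> f = (\<lambda>z. b - z)"
    using f(2) by (auto simp: half_turn_or_translation_def)
  then show ?thesis
  proof
    assume F: "f = (\<lambda>z. z + b)"
    show ?thesis
    proof (rule that[OF g])
      fix v assume v: "v \<in> tverts T"
      show "f (g v) = g (f v)" "f (g v) = g (f v)"
        using w[OF v] w[OF fv[OF v]] by (simp_all add: F)
    qed
  next
    assume F: "f = (\<lambda>z. b - z)"
    have "w' = - w"
    proof -
      obtain v where v: "v \<in> tverts T" using exists_Z Z_vertex by blast
      have "v = g (inv g v)" using \<Gamma>_bij[OF g] by (simp add: bij_is_surj surj_f_inv_f)
      also have "\<dots> = v + w' + w" using w[OF \<Gamma>_vertex[OF \<Gamma>_inv[OF g] v]] w'[OF v] by simp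
      finally show ?thesis by (simp add: eq_neg_iff_add_eq_0)
    qed
    show ?thesis
    proof (rule that[OF \<Gamma>_inv[OF g]])
      fix v assume v: "v \<in> tverts T"
      show "f (g v) = inv g (f v)" "f (inv g v) = g (f v)"
        using w[OF v] w[OF fv[OF v]] w'[OF v] w'[OF fv[OF v]] \<open>w' = - w\<close> by (simp_all add: F)
    qed
  qed
qed

lemma image_qv:
  assumes f: "f \<in> G" "half_turn_or_translation f" and v: "v \<in> tverts T"
  shows "f ` qv \<Gamma> v = qv \<Gamma> (f v)"
proof
  show "f ` qv \<Gamma> v \<subseteq> qv \<Gamma> (f v)"
  proof
    fix x assume "x \<in> f ` qv \<Gamma> v"
    then obtain g where g: "g \<in> \<Gamma>" "x = f (g v)" by (auto simp: qv_def)
    obtain g' where "g' \<in> \<Gamma>" "f (g v) = g' (f v)" using normalises[OF f g(1)] v by metis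
    then show "x \<in> qv \<Gamma> (f v)" using g by (auto simp: qv_def)
  qed
  show "qv \<Gamma> (f v) \<subseteq> f ` qv \<Gamma> v"
  proof
    fix x assume "x \<in> qv \<Gamma> (f v)"
    then obtain g where g: "g \<in> \<Gamma>" "x = g (f v)" by (auto simp: qv_def)
    obtain g' where g': "g' \<in> \<Gamma>" "f (g' v) = g (f v)" using normalises[OF f g(1)] v by metis
    then have "g' v \<in> qv \<Gamma> v" by (auto simp: qv_def)
    then show "x \<in> f ` qv \<Gamma> v" using g(2) g'(2) by (metis imageI)
  qed
qed

lemma image_qv_image:
  assumes f: "f \<in> G" "half_turn_or_translation f" and A: "A \<subseteq> tverts T"
  shows "(\<lambda>X. f ` X) ` (qv \<Gamma> ` A) = qv \<Gamma> ` (f ` A)"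
  unfolding image_image using image_qv[OF f] A by (intro image_cong) auto

lemma G_tedges:
  assumes f: "f \<in> G" and e: "e \<in> tedges T" shows "f ` e \<in> tedges T"
proof -
  obtain a b P where P: "e = {a, b}" "P \<in> T" "poly_edge P a b" using e by (auto simp: tedges_def)
  have "poly_edge (f ` P) (f a) (f b)" "f ` P \<in> T" using G_edge[OF f P(2,3)] G_tile[OF f P(2)] .
  then show ?thesis unfolding P(1) by (auto simp: tedges_def)
qed

lemma tedges_subset: "e \<in> tedges T \<Longrightarrow> e \<subseteq> tverts T"
  using tile_vertex by (auto simp: tedges_def poly_edge_def)

text \<open>A vertex of the quotient is an orbit, a set of points, so the induced map takes images;
  elsewhere it is the identity, as \<open>map_aut\<close> demands.\<close>

definition descend :: "(complex \<Rightarrow> complex) \<Rightarrow> complex set \<Rightarrow> complex set" where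
  "descend f X = (if X \<in> qverts T \<Gamma> then f ` X else X)"

lemma descend_qv:
  "f \<in> G \<Longrightarrow> half_turn_or_translation f \<Longrightarrow> v \<in> tverts T \<Longrightarrow> descend f (qv \<Gamma> v) = qv \<Gamma> (f v)"
  using image_qv by (simp add: descend_def qverts_def)

text \<open>For edges and faces one direction is enough: applied to \<open>inv f\<close>, it yields
  the other.\<close>

lemma map_aut_descend:
  assumes f: "f \<in> G" "half_turn_or_translation f"
  shows "map_aut (qverts T \<Gamma>) (qedges T \<Gamma>) (qfaces T \<Gamma>) (descend f)"
proof -
  let ?V = "qverts T \<Gamma>" and ?I = "\<lambda>f X. f ` (X :: complex set)"
  have f': "inv f \<in> G" "half_turn_or_translation (inv f)"
    using G_inv[OF f(1)] half_turn_or_translation_inv[OF f(2)] .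
  have V: "?I k X \<in> ?V" if k: "k \<in> G" "half_turn_or_translation k" and X: "X \<in> ?V" for k X
  proof -
    obtain v where v: "v \<in> tverts T" "X = qv \<Gamma> v" using X by (auto simp: qverts_def)
    then show ?thesis using image_qv[OF k v(1)] G_vertex[OF k(1) v(1)] by (simp add: qverts_def)
  qed
  have E: "?I k ` \<sigma> \<in> qedges T \<Gamma>" if k: "k \<in> G" "half_turn_or_translation k" and s: "\<sigma> \<in> qedges T \<Gamma>" for k \<sigma>
  proof -
    obtain e where e: "e \<in> tedges T" "\<sigma> = qv \<Gamma> ` e" using s by (auto simp: qedges_def)
    then show ?thesis using image_qv_image[OF k tedges_subset[OF e(1)]] G_tedges[OF k(1) e(1)]
      by (simp add: qedges_def)
  qed
  have F: "?I k ` \<sigma> \<in> qfaces T \<Gamma>" if k: "k \<in> G" "half_turn_or_translation k" and s: "\<sigma> \<in> qfaces T \<Gamma>" for k \<sigma>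
  proof -
    obtain P where P: "P \<in> T" "\<sigma> = qv \<Gamma> ` P" using s by (auto simp: qfaces_def)
    then show ?thesis using image_qv_image[OF k tile_subset[OF P(1)]] G_tile[OF k(1) P(1)]
      by (simp add: qfaces_def)
  qed
  have b: "bij f" using isom_bij[OF G_isom[OF f(1)]] .
  have inv1: "?I (inv f) (?I f X) = X" "?I f (?I (inv f) X) = X" for X
    using b by (simp_all add: image_comp bij_is_inj bij_is_surj surj_iff[THEN iffD1])
  have inv2: "?I (inv f) ` (?I f ` \<sigma>) = \<sigma>" for \<sigma> unfolding image_image[of "?I (inv f)"] inv1 by simp
  have eq: "descend f X = ?I f X" if "X \<in> ?V" for X using that by (simp add: descend_def)
  have eqs: "descend f ` \<sigma> = ?I f ` \<sigma>" if "\<sigma> \<subseteq> ?V" for \<sigma> using that eq by (intro image_cong) auto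
  have "bij_betw (descend f) ?V ?V"
  proof (rule bij_betw_byWitness[where f' = "?I (inv f)"])
    show "\<forall>X\<in>?V. ?I (inv f) (descend f X) = X" using eq inv1 by simp
    show "\<forall>X\<in>?V. descend f (?I (inv f) X) = X" using eq V[OF f'] inv1 by simp
    show "descend f ` ?V \<subseteq> ?V" using eq V[OF f] by auto
    show "?I (inv f) ` ?V \<subseteq> ?V" using V[OF f'] by auto
  qed
  moreover have "\<sigma> \<in> qedges T \<Gamma> \<longleftrightarrow> descend f ` \<sigma> \<in> qedges T \<Gamma>" if "\<sigma> \<subseteq> ?V" for \<sigma>
    unfolding eqs[OF that] using E[OF f, of \<sigma>] E[OF f', of "?I f ` \<sigma>"] inv2[of \<sigma>] by metis
  moreover have "\<sigma> \<in> qfaces T \<Gamma> \<longleftrightarrow> descend f ` \<sigma> \<in> qfaces T \<Gamma>" if "\<sigma> \<subseteq> ?V" for \<sigma>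
    unfolding eqs[OF that] using F[OF f, of \<sigma>] F[OF f', of "?I f ` \<sigma>"] inv2[of \<sigma>] by metis
  ultimately show ?thesis unfolding map_aut_def by (simp add: descend_def)
qed

text \<open>Vertices related by a descending symmetry have the same orbit, one inclusion coming from
  \<open>f\<close> and the other from \<open>inv f\<close>. So every orbit is that of one of the
  nine representatives.\<close>

lemma card_aut_orbits: "card (aut_orbits (qverts T \<Gamma>) (qedges T \<Gamma>) (qfaces T \<Gamma>)) \<le> 9"
proof -
  let ?A = "map_aut (qverts T \<Gamma>) (qedges T \<Gamma>) (qfaces T \<Gamma>)"
  define orb where "orb x = {\<phi> x | \<phi>. ?A \<phi>}" for x
  have sub: "orb (\<psi> x) \<subseteq> orb x" if "?A \<psi>" for \<psi> x
  proof
    fix y assume "y \<in> orb (\<psi> x)"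
    then obtain \<phi> where p: "?A \<phi>" "y = \<phi> (\<psi> x)" by (auto simp: orb_def)
    have "?A (\<phi> \<circ> \<psi>)" using map_aut_comp[OF p(1) that] .
    moreover have "y = (\<phi> \<circ> \<psi>) x" using p(2) by simp
    ultimately show "y \<in> orb x" unfolding orb_def by blast
  qed
  have orb_f: "orb (qv \<Gamma> (f v)) \<subseteq> orb (qv \<Gamma> v)"
    if f: "f \<in> G" "half_turn_or_translation f" and v: "v \<in> tverts T" for f v
    using sub[OF map_aut_descend[OF f], of "qv \<Gamma> v"] descend_qv[OF f v] by simp
  obtain S where S: "finite S" "card S \<le> 9" "S \<subseteq> tverts T"
    "\<And>v. v \<in> tverts T \<Longrightarrow> \<exists>r\<in>S. \<exists>f\<in>G. half_turn_or_translation f \<and> f r = v"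
    using nine_representatives by blast
  have "orb ` qverts T \<Gamma> \<subseteq> (\<lambda>r. orb (qv \<Gamma> r)) ` S"
  proof
    fix y assume "y \<in> orb ` qverts T \<Gamma>"
    then obtain v where v: "v \<in> tverts T" "y = orb (qv \<Gamma> v)" by (auto simp: qverts_def)
    obtain r f where r: "r \<in> S" "f \<in> G" "half_turn_or_translation f" "f r = v" using S(4)[OF v(1)] by blast
    have rV: "r \<in> tverts T" using r(1) S(3) by blast
    have "inv f v = r" using r(4) isom_inj[OF G_isom[OF r(2)]] by (metis inv_f_f)
    then have "orb (qv \<Gamma> r) \<subseteq> orb (qv \<Gamma> v)"
      using orb_f[OF G_inv[OF r(2)] half_turn_or_translation_inv[OF r(3)] v(1)] by simp
    moreover have "orb (qv \<Gamma> v) \<subseteq> orb (qv \<Gamma> r)" using orb_f[OF r(2,3) rV] r(4) by simp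
    ultimately have "y = orb (qv \<Gamma> r)" using v(2) by blast
    then show "y \<in> (\<lambda>r. orb (qv \<Gamma> r)) ` S" using r(1) by blast
  qed
  then have "card (orb ` qverts T \<Gamma>) \<le> card ((\<lambda>r. orb (qv \<Gamma> r)) ` S)"
    by (intro card_mono finite_imageI S(1))
  also have "\<dots> \<le> 9" using card_image_le[OF S(1)] S(2) order_trans by blast
  finally show ?thesis unfolding aut_orbits_def orb_def .
qed

end

theorem theorem1:
  fixes T :: "complex set set" and \<Gamma> :: "(complex \<Rightarrow> complex) set"
  assumes "two_uniform_tiling T"
    and "vertex_types T {[3,4,6,4], [4,6,12]}"
    and "free_aut_subgroup T \<Gamma>"
    and "quotient_is_torus T \<Gamma>"
    and "polyhedral_quotient T \<Gamma>"
  shows "card (aut_orbits (qverts T \<Gamma>) (qedges T \<Gamma>) (qfaces T \<Gamma>)) \<le> 9"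
proof -
  obtain h q where h: "h id = id"
    "\<forall>g\<in>\<Gamma>. homeomorphism UNIV UNIV (h g) (h (inv g))"
    "\<forall>g\<in>\<Gamma>. \<forall>g'\<in>\<Gamma>. h (g \<circ> g') = h g \<circ> h g'"
    "\<forall>g\<in>\<Gamma>. \<forall>v\<in>tverts T. h g v = g v"
    "\<forall>g\<in>\<Gamma>. \<forall>P\<in>T. \<forall>a b. poly_edge P a b \<longrightarrow>
        h g ` closed_segment a b = closed_segment (g a) (g b)"
    "\<forall>g\<in>\<Gamma>. \<forall>P\<in>T. h g ` (convex hull P) = convex hull (g ` P)"
    "quotient_map euclidean torus_top q" "\<forall>x y. q x = q y \<longleftrightarrow> (\<exists>g\<in>\<Gamma>. h g x = y)"
    using assms(4) unfolding quotient_is_torus_def by (elim exE conjE) (rule that; assumption)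
  interpret torus_quotient T \<Gamma> h q
  proof unfold_locales
    show "edge_to_edge_tiling T" "card ((\<lambda>v. {f v | f. f \<in> tiling_sym T}) ` tverts T) = 2"
      using assms(1) by (simp_all add: two_uniform_tiling_def)
  qed (use assms(2,3) h in \<open>simp_all del: id_apply\<close>)
  show ?thesis by (rule card_aut_orbits)
qed

end
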